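(* Let the integers $1\le\alpha_1<\cdots<\alpha_r$, $1\le\beta_1<\cdots<\beta_t$, $0\le\gamma_1<\cdots<\gamma_s$ be fixed, and for each $N$ let $\Gamma_1(N)$ and (for $N$ even) $\Gamma_2(N),\Gamma_3(N),\Gamma_4(N)$ be the bicirculant graphs over $\mathbb{Z}_N$ described in the context, under the standing assumptions listed there. Then $$F_1(x)=\sum_{n=1}^{\infty}\tau(\Gamma_1(n))x^n,\quad F_j(x)=\sum_{n=1}^{\infty}\tau(\Gamma_j(2n))x^n\quad (j=2,3,4)$$ are rational functions with integer coefficients. Moreover, for $j=1,2,3,4$, $$F_j\left(\frac{x}{\ell_j}\right)=F_j\left(\frac{1}{\ell_j x}\right)$$ as rational functions, where $\ell_1=a_k$, $\ell_2=a_kb_k$, $\ell_3=a_kc_k$, $\ell_4=a_kd_k$ and $a_k,b_k,c_k,d_k$ are the leading coefficients of $P_1(z),P_2(z),P_3(z),P_4(z)$, respectively.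
   Context: $\tau(\Gamma)$ denotes the number of spanning trees of $\Gamma$. A rational function with integer coefficients is a quotient of two polynomials with integer coefficients. Graphs ($r,t\ge0$, $s\ge1$): $\Gamma_1(N)$ has vertex set $\{h_0:h\in\mathbb{Z}_N\}\cup\{h_1:h\in\mathbb{Z}_N\}$ ($2N$ vertices) and edges: for each $h\in\mathbb{Z}_N$ and each $i\le r$, an edge joining $h_0$ and $(h+\alpha_i)_0$; for each $h$ and each $i\le t$, an edge joining $h_1$ and $(h+\beta_i)_1$; for each $h$ and each $i\le s$, an edge joining $h_0$ and $(h+\gamma_i)_1$. For $N$ even, $\Gamma_2(N)$ is obtained from $\Gamma_1(N)$ by adding one edge between $h_0$ and $(h+\frac N2)_0$ for each unordered pair $\{h,h+\frac N2\}$; $\Gamma_3(N)$ by adding one edge between $h_1$ and $(h+\frac N2)_1$ for each such pair; $\Gamma_4(N)$ by adding both kinds of edges. When $\alpha_r,\beta_t<\frac N2$ and $\gamma_s\le N-1$ these are simple graphs, namely $\Gamma_1(N)=BC(\mathbb{Z}_N;R_0,T_0,S)$, $\Gamma_2(N)=BC(\mathbb{Z}_N;R_0\cup\{\frac N2\},T_0,S)$, $\Gamma_3(N)=BC(\mathbb{Z}_N;R_0,T_0\cup\{\frac N2\},S)$, $\Gamma_4(N)=BC(\mathbb{Z}_N;R_0\cup\{\frac N2\},T_0\cup\{\frac N2\},S)$ with $R_0=\{\pm\alpha_1,\dots,\pm\alpha_r\}$, $T_0=\{\pm\beta_1,\dots,\pm\beta_t\}$, $S=\{\gamma_1,\dots,\gamma_s\}$,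 where $BC(\mathbb{Z}_N;R,T,S)$ has edges $\{h_0,g_0\}$ for $g-h\in R$, $\{h_1,g_1\}$ for $g-h\in T$, $\{h_0,g_1\}$ for $g-h\in S$. For the finitely many smaller $N$ they are multigraphs, possibly with parallel edges (counted with multiplicity in spanning trees) and loops (irrelevant to spanning trees). Standing assumption (ensuring connectedness): for every group order $N$ considered, at least one of the following holds: (a) $\gcd(N,\alpha_1,\dots,\alpha_r)=1$; (b) $\gcd(N,\beta_1,\dots,\beta_t)=1$; (c) the gcd of $N$ and all differences $\gamma_\ell-\gamma_m$ ($1\le m<\ell\le s$) is $1$. Laurent polynomials: $\mathcal{A}(z)=2r+s-\sum_{j=1}^r(z^{\alpha_j}+z^{-\alpha_j})$, $\mathcal{B}(z)=2t+s-\sum_{j=1}^t(z^{\beta_j}+z^{-\beta_j})$, $\mathcal{C}(z)=\sum_{j=1}^s z^{\gamma_j}$, and $P_1=\mathcal{A}(z)\mathcal{B}(z)-\mathcal{C}(z^{-1})\mathcal{C}(z)$, $P_2=(\mathcal{A}(z)+2)\mathcal{B}(z)-\mathcal{C}(z^{-1})\mathcal{C}(z)$, $P_3=\mathcal{A}(z)(\mathcal{B}(z)+2)-\mathcal{C}(z^{-1})\mathcal{C}(z)$, $P_4=(\mathcal{A}(z)+2)(\mathcal{B}(z)+2)-\mathcal{C}(z^{-1})\mathcal{C}(z)$. Each satisfies $P_j(z)=P_j(z^{-1})$. It is assumed throughout that they are nonzero and have the same degree $k$, i.e. $k$ is the highest power of $z$ with nonzero coefficient; the leading coefficient is the coefficient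 of $z^k$. *)

theory Defs
  imports
    "HOL-Library.Poly_Mapping"
    "HOL-Computational_Algebra.Computational_Algebra"
begin

section \<open>Multigraphs and spanning trees\<close>

text \<open>
  Edges are labels and \<open>ends e\<close> is the set of end points of \<open>e\<close>: distinct labels with the same
  ends are parallel edges, and an edge whose set of ends is a singleton is a loop.
\<close>

record ('v, 'e) multigraph =
  verts :: "'v set"
  edges :: "'e set"
  ends :: "'e \<Rightarrow> 'v set"

definition connected_graph :: "('v, 'e) multigraph \<Rightarrow> bool" where
  "connected_graph G \<longleftrightarrow> verts G \<noteq> {} \<and>
    (\<forall>u\<in>verts G. \<forall>v\<in>verts G. (u, v) \<in> {(x, y). \<exists>e\<in>edges G. ends G e = {x, y}}\<^sup>*)"

text \<open>A loop is a cycle of length 1, and two parallel edges form a cycle of length 2.\<close>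

definition is_cycle :: "('v, 'e) multigraph \<Rightarrow> 'v list \<Rightarrow> 'e list \<Rightarrow> bool" where
  "is_cycle G vs es \<longleftrightarrow> es \<noteq> [] \<and> length vs = length es \<and> distinct vs \<and> distinct es \<and>
    set vs \<subseteq> verts G \<and> set es \<subseteq> edges G \<and>
    (\<forall>i<length es. ends G (es ! i) = {vs ! i, vs ! (Suc i mod length es)})"

definition is_tree :: "('v, 'e) multigraph \<Rightarrow> bool" where
  "is_tree G \<longleftrightarrow> connected_graph G \<and> \<not> (\<exists>vs es. is_cycle G vs es)"

definition spanning_trees :: "('v, 'e) multigraph \<Rightarrow> 'e set set" where
  "spanning_trees G = {T. T \<subseteq> edges G \<and> is_tree (G\<lparr>edges := T\<rparr>)}"

definition num_spanning_trees :: "('v, 'e) multigraph \<Rightarrow> nat"  (\<open>\<tau>\<close>) where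
  "\<tau> G = card (spanning_trees G)"


section \<open>Bicirculant graphs\<close>

text \<open>
  The vertex \<open>h\<^sub>\<epsilon>\<close> with \<open>h\<close> in \<open>\<int>\<^sub>N\<close> is the pair \<open>(h, \<epsilon>)\<close>, where \<open>\<int>\<^sub>N\<close> is \<open>{0..<N}\<close> with addition modulo
  \<open>N\<close>. The labels \<open>Diam0 h\<close>, \<open>Diam1 h\<close> are the edges between \<open>h\<close> and \<open>h + N/2\<close>; restricting to
  \<open>h < N/2\<close> yields one such edge for each unordered pair.
\<close>

datatype bc_edge = Alpha nat nat | Beta nat nat | Gamma nat nat | Diam0 nat | Diam1 nat

fun bc_ends ::
  "(nat \<Rightarrow> nat) \<Rightarrow> (nat \<Rightarrow> nat) \<Rightarrow> (nat \<Rightarrow> nat) \<Rightarrow> nat \<Rightarrow> bc_edge \<Rightarrow> (nat \<times> nat) set" where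
  "bc_ends \<alpha> \<beta> \<gamma> N (Alpha h i) = {(h, 0), ((h + \<alpha> i) mod N, 0)}"
| "bc_ends \<alpha> \<beta> \<gamma> N (Beta h i) = {(h, 1), ((h + \<beta> i) mod N, 1)}"
| "bc_ends \<alpha> \<beta> \<gamma> N (Gamma h i) = {(h, 0), ((h + \<gamma> i) mod N, 1)}"
| "bc_ends \<alpha> \<beta> \<gamma> N (Diam0 h) = {(h, 0), ((h + N div 2) mod N, 0)}"
| "bc_ends \<alpha> \<beta> \<gamma> N (Diam1 h) = {(h, 1), ((h + N div 2) mod N, 1)}"

text \<open>
  The index \<open>j\<close> ranges over 1, 2, 3, 4. For \<open>j \<noteq> 1\<close> the definition is meaningful only for even \<open>N\<close>.
\<close>

definition bicirculant ::
  "nat \<Rightarrow> nat \<Rightarrow> nat \<Rightarrow> (nat \<Rightarrow> nat) \<Rightarrow> (nat \<Rightarrow> nat) \<Rightarrow> (nat \<Rightarrow> nat) \<Rightarrow> nat \<Rightarrow> nat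
    \<Rightarrow> (nat \<times> nat, bc_edge) multigraph" where
  "bicirculant r t s \<alpha> \<beta> \<gamma> j N = \<lparr>
    verts = {0..<N} \<times> {0, 1},
    edges = {Alpha h i | h i. h < N \<and> i \<in> {1..r}}
      \<union> {Beta h i | h i. h < N \<and> i \<in> {1..t}}
      \<union> {Gamma h i | h i. h < N \<and> i \<in> {1..s}}
      \<union> (if j \<in> {2, 4} then {Diam0 h | h. h < N div 2} else {})
      \<union> (if j \<in> {3, 4} then {Diam1 h | h. h < N div 2} else {}),
    ends = bc_ends \<alpha> \<beta> \<gamma> N \<rparr>"

definition group_order :: "nat \<Rightarrow> nat \<Rightarrow> nat" where
  "group_order j n = (if j = 1 then n else 2 * n)"

definition gcd_condition ::
  "nat \<Rightarrow> nat \<Rightarrow> nat \<Rightarrow> (nat \<Rightarrow> nat) \<Rightarrow> (nat \<Rightarrow> nat) \<Rightarrow> (nat \<Rightarrow> nat) \<Rightarrow> nat \<Rightarrow> bool" where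
  "gcd_condition r t s \<alpha> \<beta> \<gamma> N \<longleftrightarrow>
    Gcd (insert N (\<alpha> ` {1..r})) = 1 \<or>
    Gcd (insert N (\<beta> ` {1..t})) = 1 \<or>
    Gcd (insert (int N) {int (\<gamma> l) - int (\<gamma> m) | l m. 1 \<le> m \<and> m < l \<and> l \<le> s}) = 1"

definition tree_gf ::
  "nat \<Rightarrow> nat \<Rightarrow> nat \<Rightarrow> (nat \<Rightarrow> nat) \<Rightarrow> (nat \<Rightarrow> nat) \<Rightarrow> (nat \<Rightarrow> nat) \<Rightarrow> nat \<Rightarrow> int fps" where
  "tree_gf r t s \<alpha> \<beta> \<gamma> j =
    Abs_fps (\<lambda>n. if n = 0 then 0 else int (\<tau> (bicirculant r t s \<alpha> \<beta> \<gamma> j (group_order j n))))"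


section \<open>Laurent polynomials\<close>

text \<open>
  The convolution ring of finitely supported functions from the integers to the integers is the
  ring of Laurent polynomials in \<open>z\<close>, with \<open>Poly_Mapping.single i c\<close> in the role of \<open>c z\<^sup>i\<close>.
\<close>

type_synonym laurent_poly = "int \<Rightarrow>\<^sub>0 int"

abbreviation zpow :: "int \<Rightarrow> laurent_poly" where
  "zpow i \<equiv> Poly_Mapping.single i 1"

text \<open>The highest exponent with nonzero coefficient; only meaningful for nonzero arguments.\<close>

definition laurent_degree :: "laurent_poly \<Rightarrow> int" where
  "laurent_degree P = Max (Poly_Mapping.keys P)"

definition laurent_lead :: "laurent_poly \<Rightarrow> int" where
  "laurent_lead P = Poly_Mapping.lookup P (laurent_degree P)"

text \<open>\<open>lap r s \<alpha>\<close> is \<open>\<A>(z)\<close>, and \<open>lap t s \<beta>\<close> is \<open>\<B>(z)\<close>.\<close>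

definition lap :: "nat \<Rightarrow> nat \<Rightarrow> (nat \<Rightarrow> nat) \<Rightarrow> laurent_poly" where
  "lap r s \<alpha> = of_nat (2 * r + s) - (\<Sum>j=1..r. zpow (int (\<alpha> j)) + zpow (- int (\<alpha> j)))"

definition P_poly ::
  "nat \<Rightarrow> nat \<Rightarrow> nat \<Rightarrow> (nat \<Rightarrow> nat) \<Rightarrow> (nat \<Rightarrow> nat) \<Rightarrow> (nat \<Rightarrow> nat) \<Rightarrow> nat \<Rightarrow> laurent_poly" where
  "P_poly r t s \<alpha> \<beta> \<gamma> j =
    (lap r s \<alpha> + (if j \<in> {2, 4} then 2 else 0)) * (lap t s \<beta> + (if j \<in> {3, 4} then 2 else 0))
    - (\<Sum>i=1..s. zpow (- int (\<gamma> i))) * (\<Sum>i=1..s. zpow (int (\<gamma> i)))"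

definition ell ::
  "nat \<Rightarrow> nat \<Rightarrow> nat \<Rightarrow> (nat \<Rightarrow> nat) \<Rightarrow> (nat \<Rightarrow> nat) \<Rightarrow> (nat \<Rightarrow> nat) \<Rightarrow> nat \<Rightarrow> int" where
  "ell r t s \<alpha> \<beta> \<gamma> j =
    (if j = 1 then laurent_lead (P_poly r t s \<alpha> \<beta> \<gamma> 1)
     else laurent_lead (P_poly r t s \<alpha> \<beta> \<gamma> 1) * laurent_lead (P_poly r t s \<alpha> \<beta> \<gamma> j))"


section \<open>Rational functions\<close>

text \<open>
  The fraction field of the integer polynomials is the field of quotients of two polynomials with
  integer coefficients.
\<close>

type_synonym rat_fun = "int poly fract"

definition var :: rat_fun where
  "var = Fract [:0, 1:] 1"

definition is_expansion :: "rat_fun \<Rightarrow> int fps \<Rightarrow> bool" where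
  "is_expansion R F \<longleftrightarrow>
    (\<exists>p q. q \<noteq> 0 \<and> R = Fract p q \<and> fps_of_poly q * F = fps_of_poly p)"

text \<open>
  The substitution \<open>R(g)\<close>. For non-constant \<open>g\<close> the denominator does not vanish, and the value does
  not depend on the representation of \<open>R\<close> as a quotient.
\<close>

definition rat_fun_subst :: "rat_fun \<Rightarrow> rat_fun \<Rightarrow> rat_fun" where
  "rat_fun_subst R g = (case quot_of_fract R of
    (p, q) \<Rightarrow> poly (map_poly of_int p) g / poly (map_poly of_int q) g)"

end

theory Submission
  imports
    Defs
    "Jordan_Normal_Form.Determinant"
    "HOL-Number_Theory.Cong"
begin

text \<open>
  By the matrix-tree theorem and diagonalization of the Laplacian over the characters of the cyclic
  group, \<open>N \<tau>(\<Gamma>)\<close> is \<open>s\<close> times the product of \<open>P\<^sub>1(z)\<close> over the nontrivial \<open>N\<close>-th roots of unity \<open>z\<close>;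
  for \<open>j > 1\<close>, the factors at the roots with \<open>z\<^bsup>N/2\<^esup> = -1\<close> are \<open>P\<^sub>j(z)\<close> instead. Each \<open>P\<^sub>j\<close> is a
  polynomial in \<open>w = z + 1/z\<close> with the same leading coefficient, and \<open>P\<^sub>1\<close> has a simple zero at \<open>w = 2\<close>.
  Writing the other roots as \<open>w = \<zeta> + 1/\<zeta>\<close>, the product over \<open>z\<^sup>n = u\<close> (\<open>u = 1\<close> or \<open>u = -1\<close>) of \<open>z + 1/z - w\<close> is
  \<open>(-1)\<^sup>n (\<zeta>\<^sup>n + \<zeta>\<^bsup>-n\<^esup> - 2u)\<close>. Hence the \<open>n\<close>-th coefficient of \<open>F\<^sub>j\<close> is \<open>n \<ell>\<^sub>j\<^sup>n f(n)\<close> with \<open>f\<close> a combination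
  of sequences \<open>x\<^sup>n + x\<^bsup>-n\<^esup>\<close>, a class closed under products, and the generating function of
  \<open>n (x\<^sup>n + x\<^bsup>-n\<^esup>)\<close> is rational and invariant under inversion of its argument.
\<close>

section \<open>Spanning trees and rooted orientations\<close>

text \<open>The trees are counted through the coefficient of u in det(u I + L), not through a minor:
  this coefficient is 2 N times the tree count, and the whole polynomial is a product of quadratics
  in u as soon as L is block diagonalized. Expanding each row into the choices "be a root" and "take
  one incident edge" makes the determinant a count, since every choice has determinant 1 or 0.

  The factor n in the coefficients has one source: 2 - w has product n^2 over the nontrivial n-th
  roots of unity, and the group order divides out one n. That 2 - w occurs only once in P_1 is a
  matter of positivity: the cofactor at w = 2 is a positive combination of squares.

  What remains is a question of fields. The numbers \<zeta> are complex, whereas the quotient must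
  consist of integer polynomials and the inversion must hold in their fraction field. A
  rational-linear functional on the complex numbers turns a complex denominator into an integer one,
  without algebraic number theory; the inversion becomes an identity of integer polynomials that is
  checked at infinitely many complex points.\<close>

definition other_end :: "('v, 'e) multigraph \<Rightarrow> 'e \<Rightarrow> 'v \<Rightarrow> 'v" where
  "other_end G e v = (THE w. ends G e = {v, w})"

definition incident :: "('v, 'e) multigraph \<Rightarrow> 'v \<Rightarrow> 'e set" where
  "incident G v = {e \<in> edges G. v \<in> ends G e}"

definition finite_graph :: "('v, 'e) multigraph \<Rightarrow> bool" where
  "finite_graph G \<longleftrightarrow> finite (verts G) \<and> finite (edges G) \<and>
    (\<forall>e\<in>edges G. \<exists>u\<in>verts G. \<exists>v\<in>verts G. ends G e = {u, v})"

lemma other_endI: "ends G e = {v, w} \<Longrightarrow> other_end G e v = w"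
  unfolding other_end_def by (rule the_equality) (auto simp: doubleton_eq_iff)

lemma ends_other_end:
  assumes "finite_graph G" "e \<in> edges G" "v \<in> ends G e"
  shows "ends G e = {v, other_end G e v}" "other_end G e v \<in> verts G" "v \<in> verts G"
proof -
  from assms obtain a b where ab: "ends G e = {a, b}" "a \<in> verts G" "b \<in> verts G"
    unfolding finite_graph_def by blast
  with assms(3) obtain w where "ends G e = {v, w}" "w \<in> verts G" "v \<in> verts G"
    by (auto simp: insert_commute)
  with other_endI[OF this(1)] show "ends G e = {v, other_end G e v}" "other_end G e v \<in> verts G"
    "v \<in> verts G"
    by auto
qed

abbreviation adjacency :: "('v, 'e) multigraph \<Rightarrow> 'e set \<Rightarrow> 'v rel" where
  "adjacency G T \<equiv> {(x, y). \<exists>e\<in>T. ends G e = {x, y}}"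

lemma sym_adjacency: "sym (adjacency G T)"
  by (auto simp: sym_def insert_commute)

text \<open>The rank that drops along \<open>g\<close> serves as the induction measure along parent
  edges and as the height by which cycles and permutations are refuted.\<close>

definition acyclic_map :: "'v set \<Rightarrow> ('v \<Rightarrow> 'v option) \<Rightarrow> bool" where
  "acyclic_map V g \<longleftrightarrow> (\<exists>d :: 'v \<Rightarrow> nat. \<forall>v\<in>V. \<forall>w. g v = Some w \<longrightarrow> d w < d v)"

text \<open>An orientation sends a vertex to \<open>None\<close> when it is a root, and otherwise to an edge leading
  to its parent.\<close>

definition orientations :: "('v, 'e) multigraph \<Rightarrow> ('v \<Rightarrow> 'e option) set" where
  "orientations G = PiE (verts G) (\<lambda>v. insert None (Some ` incident G v))"

definition parent :: "('v, 'e) multigraph \<Rightarrow> ('v \<Rightarrow> 'e option) \<Rightarrow> 'v \<Rightarrow> 'v option" where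
  "parent G c v = map_option (\<lambda>e. other_end G e v) (c v)"

definition rooted_trees :: "('v, 'e) multigraph \<Rightarrow> ('v \<Rightarrow> 'e option) set" where
  "rooted_trees G = {c \<in> orientations G. acyclic_map (verts G) (parent G c) \<and>
     card {v \<in> verts G. c v = None} = 1}"

lemma rooted_treesE:
  assumes "c \<in> rooted_trees G" "finite_graph G"
  obtains \<rho> d where "\<rho> \<in> verts G" "c \<rho> = None"
    "\<And>v. v \<in> verts G \<Longrightarrow> v \<noteq> \<rho> \<Longrightarrow> \<exists>e. c v = Some e \<and> e \<in> edges G \<and> v \<in> ends G e"
    "\<And>v e. v \<in> verts G \<Longrightarrow> c v = Some e \<Longrightarrow> (d (other_end G e v) :: nat) < d v"
    "\<And>v e. v \<in> verts G \<Longrightarrow> c v = Some e \<Longrightarrow> e \<in> edges G \<and> v \<in> ends G e"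
proof -
  from assms obtain \<rho> where \<rho>: "{v \<in> verts G. c v = None} = {\<rho>}"
    unfolding rooted_trees_def using card_1_singletonE by blast
  from assms obtain d :: "'a \<Rightarrow> nat" where d: "\<forall>v\<in>verts G. \<forall>w. parent G c v = Some w \<longrightarrow> d w < d v"
    unfolding rooted_trees_def acyclic_map_def by blast
  have c: "c v \<in> insert None (Some ` incident G v)" if "v \<in> verts G" for v
    using assms that unfolding rooted_trees_def orientations_def by (auto dest: PiE_mem)
  show thesis
  proof (rule that[of \<rho> d])
    show "\<rho> \<in> verts G" "c \<rho> = None" using \<rho> by auto
    show "\<exists>e. c v = Some e \<and> e \<in> edges G \<and> v \<in> ends G e" if "v \<in> verts G" "v \<noteq> \<rho>" for v
      using c[OF that(1)] that \<rho> by (auto simp: incident_def)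
    show "d (other_end G e v) < d v" if "v \<in> verts G" "c v = Some e" for v e
      using d that by (auto simp: parent_def)
    show "e \<in> edges G \<and> v \<in> ends G e" if "v \<in> verts G" "c v = Some e" for v e
      using c[OF that(1)] that by (auto simp: incident_def)
  qed
qed

section \<open>From rooted orientations to spanning trees\<close>

definition chosen_edges :: "('v, 'e) multigraph \<Rightarrow> ('v \<Rightarrow> 'e option) \<Rightarrow> 'e set" where
  "chosen_edges G c = {e. \<exists>v\<in>verts G. c v = Some e}"

definition root_vertex :: "('v, 'e) multigraph \<Rightarrow> ('v \<Rightarrow> 'e option) \<Rightarrow> 'v" where
  "root_vertex G c = (THE v. v \<in> verts G \<and> c v = None)"

lemma root_vertex_eqI:
  assumes "\<rho> \<in> verts G" "c \<rho> = None" "\<And>v. v \<in> verts G \<Longrightarrow> v \<noteq> \<rho> \<Longrightarrow> \<exists>e. c v = Some e"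
  shows "root_vertex G c = \<rho>"
  unfolding root_vertex_def using assms by (intro the_equality) fastforce+

text \<open>Parent edges lower the rank \<open>d\<close>, so every vertex is led to the root;
  symmetry of adjacency then joins any two vertices.\<close>

lemma chosen_edges_connect:
  assumes G: "finite_graph G" and c: "c \<in> rooted_trees G"
    and u: "u \<in> verts G" and v: "v \<in> verts G"
  shows "(u, v) \<in> (adjacency G (chosen_edges G c))\<^sup>*"
proof -
  obtain \<rho> and d :: "'a \<Rightarrow> nat" where
    \<rho>: "\<rho> \<in> verts G" "c \<rho> = None"
    and c1: "\<And>v. v \<in> verts G \<Longrightarrow> v \<noteq> \<rho> \<Longrightarrow> \<exists>e. c v = Some e \<and> e \<in> edges G \<and> v \<in> ends G e"
    and d: "\<And>v e. v \<in> verts G \<Longrightarrow> c v = Some e \<Longrightarrow> d (other_end G e v) < d v"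
    and inc: "\<And>v e. v \<in> verts G \<Longrightarrow> c v = Some e \<Longrightarrow> e \<in> edges G \<and> v \<in> ends G e"
    by (rule rooted_treesE[OF c G]) blast
  have to_root: "(v, \<rho>) \<in> (adjacency G (chosen_edges G c))\<^sup>*" if "v \<in> verts G" for v
    using that
  proof (induction "d v" arbitrary: v rule: less_induct)
    case less
    show ?case
    proof (cases "v = \<rho>")
      case False
      then obtain e where e: "c v = Some e" "e \<in> edges G" "v \<in> ends G e"
        using c1 less.prems by blast
      note o = ends_other_end[OF G e(2,3)]
      from less.hyps[OF d[OF less.prems e(1)] o(2)]
      have "(other_end G e v, \<rho>) \<in> (adjacency G (chosen_edges G c))\<^sup>*" .
      moreover have "(v, other_end G e v) \<in> adjacency G (chosen_edges G c)"
        using o(1) e(1) less.prems by (auto simp: chosen_edges_def)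
      ultimately show ?thesis by (rule converse_rtrancl_into_rtrancl[rotated])
    qed auto
  qed
  have "sym ((adjacency G (chosen_edges G c))\<^sup>*)"
    by (intro sym_rtrancl sym_adjacency)
  with to_root[OF u] to_root[OF v] show ?thesis
    by (meson rtrancl_trans symD)
qed

text \<open>At a vertex of maximal rank on a cycle both cycle edges have to be its own parent edge.
  So the cycle is a loop, and a loop cannot lower the rank.\<close>

lemma chosen_edges_no_cycle:
  assumes G: "finite_graph G" and c: "c \<in> rooted_trees G"
  shows "\<not> is_cycle (G\<lparr>edges := chosen_edges G c\<rparr>) vs es"
proof
  assume "is_cycle (G\<lparr>edges := chosen_edges G c\<rparr>) vs es"
  then have cyc: "es \<noteq> []" "length vs = length es" "distinct vs" "distinct es"
    "set vs \<subseteq> verts G" "set es \<subseteq> chosen_edges G c"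
    "\<And>i. i < length es \<Longrightarrow> ends G (es ! i) = {vs ! i, vs ! (Suc i mod length es)}"
    by (auto simp: is_cycle_def)
  obtain \<rho> and d :: "'a \<Rightarrow> nat" where
    \<rho>: "\<rho> \<in> verts G" "c \<rho> = None"
    and c1: "\<And>v. v \<in> verts G \<Longrightarrow> v \<noteq> \<rho> \<Longrightarrow> \<exists>e. c v = Some e \<and> e \<in> edges G \<and> v \<in> ends G e"
    and d: "\<And>v e. v \<in> verts G \<Longrightarrow> c v = Some e \<Longrightarrow> d (other_end G e v) < d v"
    and inc: "\<And>v e. v \<in> verts G \<Longrightarrow> c v = Some e \<Longrightarrow> e \<in> edges G \<and> v \<in> ends G e"
    by (rule rooted_treesE[OF c G]) blast
  let ?n = "length es"
  \<comment> \<open>A chosen edge is the parent edge of its end of larger rank.\<close>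
  have top: "c x = Some e" if "e \<in> chosen_edges G c" "ends G e = {x, y}" "d y \<le> d x" for e x y
  proof -
    from that(1) obtain u where u: "u \<in> verts G" "c u = Some e" by (auto simp: chosen_edges_def)
    have "ends G e = {u, other_end G e u}"
      using ends_other_end(1)[OF G] inc[OF u] by blast
    then have "u = x \<or> other_end G e u = x \<and> u = y" using that(2) by (auto simp: doubleton_eq_iff)
    with d[OF u] u that(3) show ?thesis by auto
  qed
  obtain i where i: "i < ?n" "\<And>j. j < ?n \<Longrightarrow> d (vs ! j) \<le> d (vs ! i)"
  proof -
    let ?M = "Max ((\<lambda>i. d (vs ! i)) ` {..<?n})"
    have "?M \<in> (\<lambda>i. d (vs ! i)) ` {..<?n}" using cyc(1) by (intro Max_in) auto
    then obtain i where "i < ?n" "?M = d (vs ! i)" by auto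
    then show thesis by (intro that[of i]) (auto simp flip: \<open>?M = d (vs ! i)\<close>)
  qed
  let ?x = "vs ! i"
  \<comment> \<open>The cyclic predecessor of \<open>i\<close>; adding \<open>?n\<close> before
    subtracting 1 avoids truncation at 0.\<close>
  define j where "j = (i + ?n - 1) mod ?n"
  have j: "j < ?n" "Suc j mod ?n = i"
  proof -
    show "j < ?n" unfolding j_def using i(1) by (intro mod_less_divisor) linarith
    show "Suc j mod ?n = i"
    proof (cases "i = 0")
      case True then show ?thesis using i(1) by (simp add: j_def)
    next
      case False
      then have "i + ?n - 1 = (i - 1) + ?n" by simp
      then have "j = (i - 1 + ?n) mod ?n" by (simp only: j_def)
      also have "\<dots> = i - 1" using i(1) by (simp only: mod_add_self2) (rule mod_less, linarith)
      finally show ?thesis using False i(1) by simp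
    qed
  qed
  have "c ?x = Some (es ! i)"
  proof (rule top[OF _ cyc(7)[OF i(1)]])
    show "es ! i \<in> chosen_edges G c" using cyc(6) i(1) by auto
    show "d (vs ! (Suc i mod ?n)) \<le> d ?x" using cyc(1) by (intro i(2)) simp
  qed
  moreover have "c ?x = Some (es ! j)"
  proof (rule top)
    show "es ! j \<in> chosen_edges G c" using cyc(6) j by auto
    show "ends G (es ! j) = {?x, vs ! j}" using cyc(7)[OF j(1)] j(2) by (simp add: insert_commute)
    show "d (vs ! j) \<le> d ?x" using i(2) j(1) by simp
  qed
  ultimately have "es ! i = es ! j" by simp
  then have "i = j" using cyc(4) i(1) j(1) by (simp add: nth_eq_iff_index_eq)
  have xV: "?x \<in> verts G" using cyc(2,5) i(1) by auto
  have "ends G (es ! i) = {?x, ?x}"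
    using cyc(7)[OF i(1)] j(2) \<open>i = j\<close> by simp
  then have "other_end G (es ! i) ?x = ?x" by (rule other_endI)
  with d[OF xV \<open>c ?x = Some (es ! i)\<close>] show False by simp
qed

lemma chosen_edges_spanning_tree:
  assumes G: "finite_graph G" and c: "c \<in> rooted_trees G"
  shows "chosen_edges G c \<in> spanning_trees G"
proof -
  have "chosen_edges G c \<subseteq> edges G" "verts G \<noteq> {}"
    by (rule rooted_treesE[OF c G]; force simp: chosen_edges_def)+
  moreover have "is_tree (G\<lparr>edges := chosen_edges G c\<rparr>)"
    unfolding is_tree_def connected_graph_def
    using \<open>verts G \<noteq> {}\<close> chosen_edges_connect[OF G c] chosen_edges_no_cycle[OF G c] by simp
  ultimately show ?thesis by (simp add: spanning_trees_def)
qed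

text \<open>By induction on the rank belonging to \<open>c'\<close>. If the edge chosen by
  \<open>c'\<close> at v were chosen in \<open>c\<close> by its other end u, then u would have
  smaller rank, so \<open>c'\<close> would choose the same edge at u: v and u would be parents of
  each other.\<close>

lemma rooted_trees_eqI:
  assumes G: "finite_graph G" and c: "c \<in> rooted_trees G" and c': "c' \<in> rooted_trees G"
    and r: "root_vertex G c = root_vertex G c'" and T: "chosen_edges G c = chosen_edges G c'"
  shows "c = c'"
proof -
  obtain \<rho> and d :: "'a \<Rightarrow> nat" where
    \<rho>: "\<rho> \<in> verts G" "c \<rho> = None"
    and c1: "\<And>v. v \<in> verts G \<Longrightarrow> v \<noteq> \<rho> \<Longrightarrow> \<exists>e. c v = Some e \<and> e \<in> edges G \<and> v \<in> ends G e"
    and d0: "\<And>v e. v \<in> verts G \<Longrightarrow> c v = Some e \<Longrightarrow> d (other_end G e v) < d v"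
    and inc: "\<And>v e. v \<in> verts G \<Longrightarrow> c v = Some e \<Longrightarrow> e \<in> edges G \<and> v \<in> ends G e"
    by (rule rooted_treesE[OF c G]) blast
  obtain \<rho>' and d :: "'a \<Rightarrow> nat" where
    \<rho>': "\<rho>' \<in> verts G" "c' \<rho>' = None"
    and c1': "\<And>v. v \<in> verts G \<Longrightarrow> v \<noteq> \<rho>' \<Longrightarrow> \<exists>e. c' v = Some e \<and> e \<in> edges G \<and> v \<in> ends G e"
    and d: "\<And>v e. v \<in> verts G \<Longrightarrow> c' v = Some e \<Longrightarrow> d (other_end G e v) < d v"
    and inc': "\<And>v e. v \<in> verts G \<Longrightarrow> c' v = Some e \<Longrightarrow> e \<in> edges G \<and> v \<in> ends G e"
    by (rule rooted_treesE[OF c' G]) blast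
  have "root_vertex G c = \<rho>" "root_vertex G c' = \<rho>'"
    using \<rho> \<rho>' c1 c1' by (auto intro!: root_vertex_eqI)
  with r have [simp]: "\<rho>' = \<rho>" by simp
  have eq: "c v = c' v" if "v \<in> verts G" for v
    using that
  proof (induction "d v" arbitrary: v rule: less_induct)
    case less
    show ?case
    proof (cases "v = \<rho>")
      case True then show ?thesis using \<rho> \<rho>' by simp
    next
      case False
      then obtain e where e: "c' v = Some e" "e \<in> edges G" "v \<in> ends G e"
        using c1' less.prems by auto
      then have "e \<in> chosen_edges G c" unfolding T using less.prems by (auto simp: chosen_edges_def)
      then obtain u where u: "u \<in> verts G" "c u = Some e" by (auto simp: chosen_edges_def)
      show ?thesis
      proof (cases "u = v")
        case True then show ?thesis using u e by simp
      next
        case False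
        have "ends G e = {v, u}"
          using ends_other_end(1)[OF G e(2,3)] inc[OF u] False by blast
        then have o: "other_end G e v = u" "other_end G e u = v"
          by (auto intro!: other_endI)
        have 1: "d u < d v" using d[OF less.prems e(1)] o by simp
        from less.hyps[OF 1 u(1)] u have "c' u = Some e" by simp
        from d[OF u(1) this] o 1 show ?thesis by simp
      qed
    qed
  qed
  show ?thesis
    by (rule PiE_ext[of _ "verts G" "\<lambda>v. insert None (Some ` incident G v)"])
      (use c c' eq in \<open>auto simp: rooted_trees_def orientations_def\<close>)
qed

section \<open>From spanning trees to rooted orientations\<close>

lemma distinct_path_of_rtrancl:
  assumes "(u, v) \<in> R\<^sup>*"
  shows "\<exists>p. p \<noteq> [] \<and> hd p = u \<and> last p = v \<and> distinct p \<and>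
    (\<forall>i. Suc i < length p \<longrightarrow> (p ! i, p ! Suc i) \<in> R)"
  using assms
proof (induction rule: rtrancl_induct)
  case base
  show ?case by (rule exI[of _ "[u]"]) auto
next
  case (step y z)
  then obtain p where p: "p \<noteq> []" "hd p = u" "last p = y" "distinct p"
    "\<And>i. Suc i < length p \<Longrightarrow> (p ! i, p ! Suc i) \<in> R" by blast
  show ?case
  proof (cases "z \<in> set p")
    \<comment> \<open>The path has visited \<open>z\<close> before: it is cut there instead of being
      extended.\<close>
    case True
    from split_list[OF True] obtain xs ys where xs: "p = xs @ z # ys" by blast
    show ?thesis
    proof (rule exI[of _ "xs @ [z]"], intro conjI allI impI)
      show "hd (xs @ [z]) = u" using p(2) xs by (cases xs) auto
      show "distinct (xs @ [z])" using p(4) xs by auto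
      fix i assume i: "Suc i < length (xs @ [z])"
      then have "(p ! i, p ! Suc i) \<in> R" using xs by (intro p(5)) auto
      moreover have "p ! k = (xs @ [z]) ! k" if "k < length (xs @ [z])" for k
        using that unfolding xs by (cases "k = length xs") (simp_all add: nth_append)
      then have "p ! i = (xs @ [z]) ! i" "p ! Suc i = (xs @ [z]) ! Suc i"
        using i by (metis Suc_lessD)+
      ultimately show "((xs @ [z]) ! i, (xs @ [z]) ! Suc i) \<in> R" by simp
    qed auto
  next
    case False
    show ?thesis
    proof (rule exI[of _ "p @ [z]"], intro conjI allI impI)
      fix i assume i: "Suc i < length (p @ [z])"
      show "((p @ [z]) ! i, (p @ [z]) ! Suc i) \<in> R"
      proof (cases "Suc i < length p")
        case True then show ?thesis using p(5)[OF True] by (simp add: nth_append)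
      next
        case False
        then have "Suc i = length p" using i by auto
        moreover from this have "i = length p - 1" by simp
        ultimately have "p ! i = y" using p(1,3) last_conv_nth[OF p(1)] by simp
        moreover have "(p @ [z]) ! i = p ! i" "(p @ [z]) ! Suc i = z"
          using \<open>Suc i = length p\<close> by (simp_all add: nth_append)
        ultimately show ?thesis using step.hyps(2) by simp
      qed
    qed (use p(1-4) False in auto)
  qed
qed

text \<open>The edge \<open>e\<close> closes a simple path that avoids it. The path edges are
  distinct because their end pairs are; if u = v, the path is a single vertex and the cycle is a
  loop.\<close>

lemma cycle_of_connected_ends:
  assumes V: "u \<in> verts G" "\<And>e'. e' \<in> T \<Longrightarrow> ends G e' \<subseteq> verts G"
    and e: "e \<in> T" "ends G e = {v, u}"
    and conn: "(u, v) \<in> (adjacency G (T - {e}))\<^sup>*"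
  shows "\<exists>vs es. is_cycle (G\<lparr>edges := T\<rparr>) vs es"
proof -
  from distinct_path_of_rtrancl[OF conn] obtain p where
    p: "p \<noteq> []" "hd p = u" "last p = v" "distinct p"
    "\<And>i. Suc i < length p \<Longrightarrow> (p ! i, p ! Suc i) \<in> adjacency G (T - {e})" by blast
  have "\<exists>e'. Suc i < length p \<longrightarrow> e' \<in> T - {e} \<and> ends G e' = {p ! i, p ! Suc i}" for i
    using p(5)[of i] by blast
  then obtain f where f: "\<And>i. Suc i < length p \<Longrightarrow> f i \<in> T - {e} \<and> ends G (f i) = {p ! i, p ! Suc i}"
    by metis
  let ?m = "length p - 1"
  define es where "es = map f [0..<?m] @ [e]"
  have len: "length es = length p" using p(1) by (simp add: es_def Suc_diff_1)
  have "inj_on f {0..<?m}"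
  proof (rule inj_onI)
    fix i j assume ij: "i \<in> {0..<?m}" "j \<in> {0..<?m}" "f i = f j"
    then have "Suc i < length p" "Suc j < length p" by auto
    moreover from this have "{p ! i, p ! Suc i} = {p ! j, p ! Suc j}" using f[of i] f[of j] ij(3) by simp
    ultimately show "i = j" using p(4)
      by (auto simp: doubleton_eq_iff nth_eq_iff_index_eq)
  qed
  then have dist: "distinct es"
  proof -
    have "f i \<in> T - {e}" if "i < ?m" for i
      by (rule conjunct1[OF f]) (use that in linarith)
    then have "f ` {0..<?m} \<subseteq> T - {e}" by (intro image_subsetI) simp
    then have "e \<notin> f ` {0..<?m}" by blast
    then show ?thesis using \<open>inj_on f {0..<?m}\<close> by (simp add: es_def distinct_map)
  qed
  have pV: "set p \<subseteq> verts G"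
  proof
    fix x assume "x \<in> set p"
    then obtain i where i: "i < length p" "x = p ! i" by (auto simp: in_set_conv_nth)
    show "x \<in> verts G"
    proof (cases i)
      case 0
      then show ?thesis using i p V by (simp add: hd_conv_nth)
    next
      case (Suc k)
      with i have "Suc k < length p" "x = p ! Suc k" by simp_all
      with f[of k] V(2)[of "f k"] show ?thesis by blast
    qed
  qed
  have ends: "ends G (es ! i) = {p ! i, p ! (Suc i mod length es)}" if "i < length es" for i
  proof (cases "i < ?m")
    case True
    then have "es ! i = f i" by (simp add: es_def nth_append)
    then show ?thesis using f[of i] True len by simp
  next
    case False
    then have i: "i = ?m" using that len by simp
    then have "es ! i = e" by (simp add: es_def nth_append)
    moreover have "p ! i = v" using i p(1,3) by (simp add: last_conv_nth)
    moreover have "Suc i mod length es = 0" using i len p(1) by simp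
    ultimately show ?thesis using e p(1,2) by (simp add: hd_conv_nth)
  qed
  have "f ` {0..<?m} \<subseteq> T"
    using f by (intro image_subsetI) (metis DiffD1 Suc_diff_1 Suc_mono atLeastLessThan_iff length_greater_0_conv p(1))
  then have "set es \<subseteq> T" using e by (simp add: es_def)
  moreover have "es \<noteq> []" by (simp add: es_def)
  ultimately have "is_cycle (G\<lparr>edges := T\<rparr>) p es"
    unfolding is_cycle_def using ends dist pV len p(4) by (intro conjI allI impI) simp_all
  then show ?thesis by blast
qed

text \<open>Each vertex other than \<rho> takes an edge of \<open>T\<close> towards a vertex
  strictly closer to \<rho>. The edges taken lie in \<open>T\<close> and already connect everything,
  so a further edge of \<open>T\<close> would close a cycle.\<close>

lemma spanning_tree_has_orientation:
  assumes G: "finite_graph G" and T: "T \<in> spanning_trees G" and \<rho>: "\<rho> \<in> verts G"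
  shows "\<exists>c\<in>rooted_trees G. root_vertex G c = \<rho> \<and> chosen_edges G c = T"
proof -
  let ?R = "adjacency G T"
  from T have TE: "T \<subseteq> edges G"
    and conn: "\<And>u v. u \<in> verts G \<Longrightarrow> v \<in> verts G \<Longrightarrow> (u, v) \<in> ?R\<^sup>*"
    and nocyc: "\<And>vs es. \<not> is_cycle (G\<lparr>edges := T\<rparr>) vs es"
    by (auto simp: spanning_trees_def is_tree_def connected_graph_def)
  define d where "d v = (LEAST k. (v, \<rho>) \<in> ?R ^^ k)" for v
  have "\<exists>e. e \<in> T \<and> v \<in> ends G e \<and> d (other_end G e v) < d v" if v: "v \<in> verts G" "v \<noteq> \<rho>" for v
  proof -
    from conn[OF v(1) \<rho>] obtain k where k: "(v, \<rho>) \<in> ?R ^^ k"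
      using rtrancl_imp_relpow by blast
    have dv: "(v, \<rho>) \<in> ?R ^^ d v" unfolding d_def by (rule LeastI[of _ k]) (rule k)
    have "d v \<noteq> 0"
    proof
      assume "d v = 0"
      from dv[unfolded this] show False using v(2) by simp
    qed
    then obtain m where m: "d v = Suc m" by (rule not0_implies_Suc[THEN exE])
    from relpow_Suc_D2[OF dv[unfolded m]]
    obtain w where w: "(v, w) \<in> ?R" "(w, \<rho>) \<in> ?R ^^ m" by blast
    from w(1) obtain e where e: "e \<in> T" "ends G e = {v, w}" by blast
    have "d w \<le> m" unfolding d_def by (rule Least_le) (rule w(2))
    then have "d (other_end G e v) < d v" using m other_endI[OF e(2)] by simp
    then show ?thesis using e by blast
  qed
  then obtain f where f: "\<And>v. v \<in> verts G \<Longrightarrow> v \<noteq> \<rho> \<Longrightarrow>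
      f v \<in> T \<and> v \<in> ends G (f v) \<and> d (other_end G (f v) v) < d v" by metis
  define c where "c = (\<lambda>v\<in>verts G. if v = \<rho> then None else Some (f v))"
  have "c \<in> orientations G"
    unfolding orientations_def
  proof (rule PiE_I)
    show "c v \<in> insert None (Some ` incident G v)" if "v \<in> verts G" for v
    proof (cases "v = \<rho>")
      case False
      then have "f v \<in> incident G v" using f[OF that] TE by (auto simp: incident_def)
      then show ?thesis using that False by (simp add: c_def)
    qed (use that in \<open>simp add: c_def\<close>)
  qed (simp add: c_def)
  moreover have "acyclic_map (verts G) (parent G c)"
    unfolding acyclic_map_def
  proof (intro exI[of _ d] ballI allI impI)
    fix v w assume "v \<in> verts G" "parent G c v = Some w"
    then show "d w < d v" using f[of v] by (simp add: c_def parent_def split: if_splits)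
  qed
  moreover have "{v \<in> verts G. c v = None} = {\<rho>}" using \<rho> by (auto simp: c_def)
  ultimately have c: "c \<in> rooted_trees G" by (simp add: rooted_trees_def)
  have sub: "chosen_edges G c \<subseteq> T"
  proof
    fix e assume "e \<in> chosen_edges G c"
    then obtain v where "v \<in> verts G" "c v = Some e" by (auto simp: chosen_edges_def)
    then show "e \<in> T" using f[of v] by (simp add: c_def split: if_splits)
  qed
  have "e \<in> chosen_edges G c" if "e \<in> T" for e
  proof (rule ccontr)
    assume ne: "e \<notin> chosen_edges G c"
    have "e \<in> edges G" using that TE by blast
    then obtain u v where uv: "u \<in> verts G" "v \<in> verts G" "ends G e = {v, u}"
      using G unfolding finite_graph_def by blast
    have "(u, v) \<in> (adjacency G (chosen_edges G c))\<^sup>*"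
      by (rule chosen_edges_connect[OF G c uv(1,2)])
    moreover have "adjacency G (chosen_edges G c) \<subseteq> adjacency G (T - {e})"
      using sub ne by blast
    ultimately have "(u, v) \<in> (adjacency G (T - {e}))\<^sup>*"
      using rtrancl_mono by blast
    moreover have "ends G e' \<subseteq> verts G" if "e' \<in> T" for e'
    proof -
      have "e' \<in> edges G" using that TE by blast
      then obtain a b where "a \<in> verts G" "b \<in> verts G" "ends G e' = {a, b}"
        using G unfolding finite_graph_def by blast
      then show ?thesis by simp
    qed
    ultimately show False
      using cycle_of_connected_ends[OF uv(1) _ that uv(3)] nocyc by blast
  qed
  then have "chosen_edges G c = T" using sub by blast
  moreover have "root_vertex G c = \<rho>" using \<rho> by (intro root_vertex_eqI) (auto simp: c_def)
  ultimately show ?thesis using c by blast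
qed

text \<open>Root and chosen edges together determine an orientation, and every pair of a root and a
  spanning tree occurs.\<close>

lemma card_rooted_trees:
  assumes G: "finite_graph G"
  shows "card (rooted_trees G) = card (verts G) * \<tau> G"
proof -
  let ?f = "\<lambda>c. (root_vertex G c, chosen_edges G c)"
  have "bij_betw ?f (rooted_trees G) (verts G \<times> spanning_trees G)"
    unfolding bij_betw_def
  proof (intro conjI equalityI subsetI)
    show "inj_on ?f (rooted_trees G)"
      by (rule inj_onI) (auto intro: rooted_trees_eqI[OF G])
    show "x \<in> verts G \<times> spanning_trees G" if "x \<in> ?f ` rooted_trees G" for x
    proof -
      from that obtain c where c: "c \<in> rooted_trees G" "x = ?f c" by blast
      obtain \<rho> where "\<rho> \<in> verts G" "c \<rho> = None"
        "\<And>v. v \<in> verts G \<Longrightarrow> v \<noteq> \<rho> \<Longrightarrow> \<exists>e. c v = Some e"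
        by (rule rooted_treesE[OF c(1) G]) blast
      then have "root_vertex G c \<in> verts G" using root_vertex_eqI[of \<rho> G c] by simp
      with chosen_edges_spanning_tree[OF G c(1)] c(2) show ?thesis by auto
    qed
    show "x \<in> ?f ` rooted_trees G" if "x \<in> verts G \<times> spanning_trees G" for x
      using spanning_tree_has_orientation[OF G, of "snd x" "fst x"] that by force
  qed
  then show ?thesis
    by (metis bij_betw_same_card card_cartesian_product num_spanning_trees_def)
qed

section \<open>The matrix-tree theorem\<close>

text \<open>Termination with fuel: iterating \<open>g\<close> from the vertex meets
  \<open>None\<close> after fewer than the given number of steps. The least sufficient fuel will be
  a rank.\<close>

primrec grounded_within :: "('v \<Rightarrow> 'v option) \<Rightarrow> nat \<Rightarrow> 'v \<Rightarrow> bool" where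
  "grounded_within g 0 v = False"
| "grounded_within g (Suc k) v = (case g v of None \<Rightarrow> True | Some w \<Rightarrow> grounded_within g k w)"

text \<open>\<open>W\<close> consists of the vertices from which the iteration never stops; were it
  empty, the least fuel would be a rank. The equivalence says that the indicator of \<open>W\<close>
  is fixed by the parent matrix.\<close>

lemma not_acyclic_map_trap:
  assumes nac: "\<not> acyclic_map V g" and V: "\<And>x y. x \<in> V \<Longrightarrow> g x = Some y \<Longrightarrow> y \<in> V"
  shows "\<exists>W\<subseteq>V. W \<noteq> {} \<and> (\<forall>x\<in>V. x \<in> W \<longleftrightarrow> (\<exists>y\<in>W. g x = Some y))"
proof -
  define W where "W = {x \<in> V. \<forall>k. \<not> grounded_within g k x}"
  define d where "d x = (LEAST k. grounded_within g k x)" for x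
  have "W \<noteq> {}"
  proof
    assume "W = {}"
    have "d y < d x" if xy: "x \<in> V" "g x = Some y" for x y
    proof -
      from xy \<open>W = {}\<close> obtain k where "grounded_within g k x" unfolding W_def by blast
      then have "grounded_within g (d x) x" unfolding d_def by (rule LeastI)
      then obtain m where m: "d x = Suc m" "grounded_within g m y" using xy(2)
        by (cases "d x") auto
      from Least_le[of "\<lambda>k. grounded_within g k y", OF m(2)] m(1) show ?thesis
        unfolding d_def[of y] by simp
    qed
    with nac show False unfolding acyclic_map_def by blast
  qed
  moreover have "x \<in> W \<longleftrightarrow> (\<exists>y\<in>W. g x = Some y)" if x: "x \<in> V" for x
  proof (cases "g x")
    case None
    then have "grounded_within g (Suc 0) x" by simp
    with None show ?thesis unfolding W_def by (metis (mono_tags, lifting) mem_Collect_eq option.distinct(1))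
  next
    case (Some y)
    have "(\<forall>k. \<not> grounded_within g k x) \<longleftrightarrow> (\<forall>k. \<not> grounded_within g k y)"
    proof
      assume a: "\<forall>k. \<not> grounded_within g k x"
      show "\<forall>k. \<not> grounded_within g k y" using a[rule_format, of "Suc k" for k] Some by simp
    next
      assume a: "\<forall>k. \<not> grounded_within g k y"
      show "\<forall>k. \<not> grounded_within g k x"
      proof
        fix k show "\<not> grounded_within g k x" using a Some by (cases k) auto
      qed
    qed
    with Some x V show ?thesis unfolding W_def by auto
  qed
  ultimately show ?thesis by (intro exI[of _ W]) (auto simp: W_def)
qed

text \<open>In the acyclic case, a permutation other than the identity moves an index of least rank
  among the moved ones to one that cannot be its parent, so its product contains a 0 and only the
  diagonal survives. Otherwise the indicator of the trap lies in the kernel.\<close>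

lemma det_parent_matrix:
  fixes v :: "nat \<Rightarrow> 'v"
  assumes bij: "bij_betw v {0..<n} V" and V: "\<And>x y. x \<in> V \<Longrightarrow> g x = Some y \<Longrightarrow> y \<in> V"
  shows "det (mat n n (\<lambda>(i, j). of_bool (i = j) - of_bool (g (v i) = Some (v j)))) =
    (of_bool (acyclic_map V g) :: 'a :: idom)"
proof -
  define M :: "'a mat" where
    "M = mat n n (\<lambda>(i, j). of_bool (i = j) - of_bool (g (v i) = Some (v j)))"
  have M: "M \<in> carrier_mat n n" by (simp add: M_def)
  have inj: "v i = v j \<longleftrightarrow> i = j" if "i < n" "j < n" for i j
    using bij that by (auto simp: bij_betw_def inj_on_def)
  have vV: "v i \<in> V" if "i < n" for i using bij that by (auto simp: bij_betw_def)
  have "det M = of_bool (acyclic_map V g)"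
  proof (cases "acyclic_map V g")
    case True
    then obtain d :: "'v \<Rightarrow> nat" where d: "\<And>x y. x \<in> V \<Longrightarrow> g x = Some y \<Longrightarrow> d y < d x"
      unfolding acyclic_map_def by blast
    have nloop: "g x \<noteq> Some x" if "x \<in> V" for x using d[OF that] by blast
    have zero: "(\<Prod>i = 0..<n. M $$ (i, p i)) = 0" if p: "p permutes {0..<n}" "p \<noteq> id" for p
    proof -
      let ?P = "\<lambda>i. i < n \<and> p i \<noteq> i"
      from p(2) obtain i0 where "p i0 \<noteq> i0" by (auto simp: fun_eq_iff)
      then have "?P i0" using p(1) by (auto simp: permutes_def)
      from arg_min_natI[of ?P, OF this, of "\<lambda>i. d (v i)"]
      obtain i where i: "i < n" "p i \<noteq> i" and least: "\<And>k. k < n \<Longrightarrow> p k \<noteq> k \<Longrightarrow> d (v i) \<le> d (v k)"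
        using arg_min_nat_le[of ?P _ "\<lambda>i. d (v i)"] by blast
      have pi: "p i < n" "p (p i) \<noteq> p i"
        using permutes_in_image[OF p(1), of i] i permutes_inj[OF p(1)] by (auto dest: injD)
      have "g (v i) \<noteq> Some (v (p i))"
        using least[OF pi] d[OF vV[OF i(1)]] by fastforce
      then have "M $$ (i, p i) = 0" using i pi by (simp add: M_def)
      then show ?thesis using i(1) by (intro prod_zero) auto
    qed
    have "det M = (\<Sum>p | p permutes {0..<n}. signof p * (\<Prod>i = 0..<n. M $$ (i, p i)))"
      by (rule det_def'[OF M])
    also have "\<dots> = (\<Sum>p\<in>{id}. signof p * (\<Prod>i = 0..<n. M $$ (i, p i)))"
      by (rule sum.mono_neutral_right) (auto simp: finite_permutations permutes_id zero)
    also have "\<dots> = 1"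
      by (simp add: M_def nloop vV)
    finally show ?thesis using True by simp
  next
    case False
    from not_acyclic_map_trap[OF False V] obtain W where
      "W \<subseteq> V \<and> W \<noteq> {} \<and> (\<forall>x\<in>V. x \<in> W \<longleftrightarrow> (\<exists>y\<in>W. g x = Some y))" ..
    then have W: "W \<subseteq> V" "W \<noteq> {}" "\<And>x. x \<in> V \<Longrightarrow> x \<in> W \<longleftrightarrow> (\<exists>y\<in>W. g x = Some y)"
      by simp_all
    define w :: "'a vec" where "w = vec n (\<lambda>i. of_bool (v i \<in> W))"
    from W(2) obtain x where x: "x \<in> W" by blast
    with W(1) bij have "x \<in> v ` {0..<n}" by (auto simp: bij_betw_def)
    with x obtain i where i: "i < n" "v i \<in> W" by auto
    have "w \<noteq> 0\<^sub>v n"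
    proof
      assume "w = 0\<^sub>v n"
      then have "w $ i = 0\<^sub>v n $ i" by simp
      then show False using i by (simp add: w_def)
    qed
    moreover have "M *\<^sub>v w = 0\<^sub>v n"
    proof (rule eq_vecI)
      fix i assume "i < dim_vec (0\<^sub>v n :: 'a vec)"
      then have i: "i < n" by simp
      have "(\<Sum>j = 0..<n. of_bool (g (v i) = Some (v j)) * of_bool (v j \<in> W)) =
          (of_bool (v i \<in> W) :: 'a)"
      proof (cases "g (v i)")
        case None
        then show ?thesis using W(3)[OF vV[OF i]] by simp
      next
        case (Some y)
        then have "y \<in> v ` {0..<n}" using V[OF vV[OF i] Some] bij by (simp add: bij_betw_def)
        then obtain k where k: "k < n" "y = v k" by auto
        have "(\<Sum>j = 0..<n. of_bool (g (v i) = Some (v j)) * of_bool (v j \<in> W)) =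
          (\<Sum>j = 0..<n. if j = k then of_bool (v k \<in> W) else 0 :: 'a)"
          using Some k inj by (intro sum.cong) auto
        also have "\<dots> = of_bool (v k \<in> W)" using k by simp
        finally show ?thesis using W(3)[OF vV[OF i]] Some k by simp
      qed
      then show "(M *\<^sub>v w) $ i = 0\<^sub>v n $ i"
        using i by (simp add: M_def w_def scalar_prod_def left_diff_distrib sum_subtractf)
    qed (simp add: M_def)
    moreover have "w \<in> carrier_vec n" by (simp add: w_def)
    ultimately have "det M = 0"
      using det_0_iff_vec_prod_zero[OF M] by blast
    then show ?thesis using False by simp
  qed
  then show ?thesis by (simp only: M_def)
qed

definition laplacian :: "('v, 'e) multigraph \<Rightarrow> 'v \<Rightarrow> 'v \<Rightarrow> 'a :: comm_ring_1" where
  "laplacian G x y = (\<Sum>e\<in>incident G x. of_bool (x = y) - of_bool (other_end G e x = y))"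

text \<open>Row x is a sum over the choices at x: to be a root, with weight \<open>t\<close>, or to
  take an incident edge. Multilinearity of the determinant turns this into a sum over
  orientations.\<close>

lemma det_shifted_laplacian:
  fixes G :: "('v, 'e) multigraph" and t :: "'a :: idom" and v :: "nat \<Rightarrow> 'v"
  assumes G: "finite_graph G" and bij: "bij_betw v {0..<n} (verts G)"
  shows "det (mat n n (\<lambda>(i, j). t * of_bool (i = j) + laplacian G (v i) (v j))) =
    (\<Sum>c\<in>orientations G. t ^ card {x \<in> verts G. c x = None} *
      of_bool (acyclic_map (verts G) (parent G c)))"
proof -
  let ?V = "verts G"
  have fin: "finite ?V" "finite (incident G x)" for x
    using G by (auto simp: finite_graph_def incident_def)
  have finO: "finite (orientations G)"
    unfolding orientations_def using fin by (intro finite_PiE) auto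
  have inj: "v i = v j \<longleftrightarrow> i = j" if "i < n" "j < n" for i j
    using bij that by (auto simp: bij_betw_def inj_on_def)
  have vV: "v i \<in> ?V" if "i < n" for i using bij that by (auto simp: bij_betw_def)
  define X where "X x = insert None (Some ` incident G x)" for x
  \<comment> \<open>The contribution of the choice \<open>o'\<close> to row \<open>x\<close>. It is
    \<open>wt o'\<close> times the corresponding row of the parent matrix, so roots only contribute
    the scalar \<open>t\<close>.\<close>
  define a :: "'v \<Rightarrow> 'e option \<Rightarrow> 'v \<Rightarrow> 'a" where "a x o' y = (case o' of None \<Rightarrow> t * of_bool (x = y)
    | Some e \<Rightarrow> of_bool (x = y) - of_bool (other_end G e x = y))" for x o' y
  define wt :: "'e option \<Rightarrow> 'a" where "wt o' = (if o' = None then t else 1)" for o'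
  define M :: "'a mat" where "M = mat n n (\<lambda>(i, j). t * of_bool (i = j) + laplacian G (v i) (v j))"
  define N :: "('v \<Rightarrow> 'e option) \<Rightarrow> 'a mat" where
    "N c = mat n n (\<lambda>(i, j). of_bool (i = j) - of_bool (parent G c (v i) = Some (v j)))" for c
  have M: "M \<in> carrier_mat n n" by (simp add: M_def)
  have N: "N c \<in> carrier_mat n n" for c by (simp add: N_def)
  have entry: "M $$ (i, j) = (\<Sum>o'\<in>X (v i). a (v i) o' (v j))" if "i < n" "j < n" for i j
  proof -
    have "(\<Sum>o'\<in>X (v i). a (v i) o' (v j)) =
        a (v i) None (v j) + (\<Sum>o'\<in>Some ` incident G (v i). a (v i) o' (v j))"
      unfolding X_def using fin by (subst sum.insert) auto
    also have "\<dots> = M $$ (i, j)"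
      using that inj by (simp add: sum.reindex M_def a_def laplacian_def)
    finally show ?thesis by simp
  qed
  have a_entry: "a (v i) (c (v i)) (v j) = wt (c (v i)) * N c $$ (i, j)"
    if "i < n" "j < n" for i j c
    using that inj by (cases "c (v i)") (simp_all add: a_def wt_def N_def parent_def)
  have prod: "(\<Prod>i = 0..<n. M $$ (i, p i)) =
      (\<Sum>c\<in>orientations G. (\<Prod>x\<in>?V. wt (c x)) * (\<Prod>i = 0..<n. N c $$ (i, p i)))"
    if p: "p permutes {0..<n}" for p
  proof -
    define u where "u = the_inv_into {0..<n} v"
    have u: "u (v i) = i" if "i < n" for i
      unfolding u_def using bij that by (intro the_inv_into_f_f) (auto simp: bij_betw_def)
    have pn: "p i < n" if "i < n" for i using permutes_in_image[OF p, of i] that by simp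
    have "(\<Prod>i = 0..<n. M $$ (i, p i)) =
        (\<Prod>i = 0..<n. \<Sum>o'\<in>X (v i). a (v i) o' (v (p (u (v i)))))"
      by (rule prod.cong) (simp_all add: entry pn u)
    also have "\<dots> = (\<Prod>x\<in>?V. \<Sum>o'\<in>X x. a x o' (v (p (u x))))"
      by (rule prod.reindex_bij_betw[OF bij])
    also have "\<dots> = (\<Sum>c\<in>orientations G. \<Prod>x\<in>?V. a x (c x) (v (p (u x))))"
      unfolding orientations_def X_def[symmetric]
      using fin by (intro prod_sum_PiE) (auto simp: X_def)
    also have "\<dots> = (\<Sum>c\<in>orientations G. (\<Prod>x\<in>?V. wt (c x)) * (\<Prod>i = 0..<n. N c $$ (i, p i)))"
    proof (rule sum.cong)
      fix c
      have "(\<Prod>x\<in>?V. a x (c x) (v (p (u x)))) =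
          (\<Prod>i = 0..<n. a (v i) (c (v i)) (v (p (u (v i)))))"
        by (rule prod.reindex_bij_betw[OF bij, symmetric])
      also have "\<dots> = (\<Prod>i = 0..<n. wt (c (v i)) * N c $$ (i, p i))"
        by (rule prod.cong) (simp_all add: u a_entry pn)
      also have "\<dots> = (\<Prod>i = 0..<n. wt (c (v i))) * (\<Prod>i = 0..<n. N c $$ (i, p i))"
        by (rule prod.distrib)
      also have "(\<Prod>i = 0..<n. wt (c (v i))) = (\<Prod>x\<in>?V. wt (c x))"
        by (rule prod.reindex_bij_betw[OF bij])
      finally show "(\<Prod>x\<in>?V. a x (c x) (v (p (u x)))) =
        (\<Prod>x\<in>?V. wt (c x)) * (\<Prod>i = 0..<n. N c $$ (i, p i))" .
    qed simp
    finally show ?thesis .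
  qed
  have wt: "(\<Prod>x\<in>?V. wt (c x)) = t ^ card {x \<in> ?V. c x = None}" for c
    unfolding wt_def using fin(1)
    by (subst prod.inter_filter[symmetric]) (simp_all add: Int_def)
  have "det M = (\<Sum>p | p permutes {0..<n}. signof p * (\<Prod>i = 0..<n. M $$ (i, p i)))"
    by (rule det_def'[OF M])
  also have "\<dots> = (\<Sum>p | p permutes {0..<n}. \<Sum>c\<in>orientations G.
      (\<Prod>x\<in>?V. wt (c x)) * (signof p * (\<Prod>i = 0..<n. N c $$ (i, p i))))"
    by (rule sum.cong) (simp_all add: prod sum_distrib_left mult.left_commute)
  also have "\<dots> = (\<Sum>c\<in>orientations G. (\<Prod>x\<in>?V. wt (c x)) * det (N c))"
    by (subst sum.swap) (simp add: det_def'[OF N] sum_distrib_left)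
  also have "\<dots> = (\<Sum>c\<in>orientations G. t ^ card {x \<in> ?V. c x = None} *
      of_bool (acyclic_map ?V (parent G c)))"
  proof (rule sum.cong)
    fix c assume c: "c \<in> orientations G"
    have "y \<in> ?V" if "x \<in> ?V" "parent G c x = Some y" for x y
    proof -
      from that(2) obtain e where e: "c x = Some e" "y = other_end G e x" by (auto simp: parent_def)
      have "c x \<in> insert None (Some ` incident G x)"
        using c that(1) unfolding orientations_def by (rule PiE_mem)
      with e have "e \<in> edges G" "x \<in> ends G e" by (auto simp: incident_def)
      then show ?thesis using ends_other_end(2)[OF G] e(2) by simp
    qed
    then have "det (N c) = of_bool (acyclic_map ?V (parent G c))"
      unfolding N_def by (rule det_parent_matrix[OF bij])
    then show "(\<Prod>x\<in>?V. wt (c x)) * det (N c) =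
      t ^ card {x \<in> ?V. c x = None} * of_bool (acyclic_map ?V (parent G c))"
      unfolding wt by (simp only:)
  qed simp
  finally show ?thesis by (simp only: M_def)
qed

text \<open>The coefficient at 1 selects the forests with a single root. Prescribing
  \<open>q\<close> by its values allows it to be supplied as a product over the spectrum; the values
  determine it because the ring is infinite.\<close>

theorem matrix_tree:
  fixes q :: "'a :: {idom, ring_char_0} poly" and v :: "nat \<Rightarrow> 'v"
  assumes G: "finite_graph G" and bij: "bij_betw v {0..<n} (verts G)"
    and q: "\<And>t. poly q t = det (mat n n (\<lambda>(i, j). t * of_bool (i = j) + laplacian G (v i) (v j)))"
  shows "coeff q 1 = of_nat (card (verts G) * \<tau> G)"
proof -
  have fin: "finite (orientations G)"
    unfolding orientations_def using G
    by (intro finite_PiE) (auto simp: finite_graph_def incident_def)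
  let ?A = "\<lambda>c. acyclic_map (verts G) (parent G c)"
  define f :: "'a poly" where "f = (\<Sum>c\<in>orientations G. monom (of_bool (?A c)) (card {x \<in> verts G. c x = None}))"
  have "poly q t = poly f t" for t
    unfolding q det_shifted_laplacian[OF G bij] f_def poly_sum poly_monom by (simp add: mult.commute)
  then have "q = f" using poly_eq_poly_eq_iff[of q f] by (simp add: fun_eq_iff)
  then have "coeff q 1 = (\<Sum>c\<in>orientations G. of_bool (?A c \<and> card {x \<in> verts G. c x = None} = 1))"
    by (simp add: f_def coeff_sum coeff_monom of_bool_def if_distrib cong: if_cong)
       (auto intro!: sum.cong)
  also have "\<dots> = of_nat (card (rooted_trees G))"
    using fin by (simp add: rooted_trees_def of_bool_def sum.If_cases Int_def)
  finally show ?thesis by (simp only: card_rooted_trees[OF G])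
qed

section \<open>Laplacians of bicirculant graphs\<close>

text \<open>The auxiliary direction \<open>src\<close>, \<open>tgt\<close> allows a sum over all
  edges, whatever their incidence with \<open>x\<close>; a loop contributes 0 in both terms.\<close>

lemma laplacian_apply:
  fixes f :: "'v \<Rightarrow> 'a :: comm_ring_1"
  assumes G: "finite_graph G" and x: "x \<in> verts G"
    and ends: "\<And>e. e \<in> edges G \<Longrightarrow> ends G e = {src e, tgt e}"
  shows "(\<Sum>y\<in>verts G. laplacian G x y * f y) = (\<Sum>e\<in>edges G.
    of_bool (src e = x) * (f x - f (tgt e)) + of_bool (tgt e = x) * (f x - f (src e)))"
proof -
  have fin: "finite (verts G)" "finite (edges G)" using G by (auto simp: finite_graph_def)
  have other: "other_end G e x \<in> verts G" if "e \<in> incident G x" for e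
    using that ends_other_end(2)[OF G] by (auto simp: incident_def)
  have "(\<Sum>y\<in>verts G. laplacian G x y * f y) =
      (\<Sum>e\<in>incident G x. \<Sum>y\<in>verts G. (of_bool (x = y) - of_bool (other_end G e x = y)) * f y)"
    unfolding laplacian_def sum_distrib_right by (rule sum.swap)
  also have "\<dots> = (\<Sum>e\<in>incident G x. f x - f (other_end G e x))"
    using x other fin
    by (intro sum.cong refl) (simp add: left_diff_distrib sum_subtractf)
  also have "\<dots> = (\<Sum>e\<in>incident G x.
    of_bool (src e = x) * (f x - f (tgt e)) + of_bool (tgt e = x) * (f x - f (src e)))"
  proof (rule sum.cong)
    fix e assume "e \<in> incident G x"
    then have e: "ends G e = {src e, tgt e}" "x \<in> ends G e" using ends by (auto simp: incident_def)
    then consider "src e = x" | "tgt e = x" by auto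
    then show "f x - f (other_end G e x) =
      of_bool (src e = x) * (f x - f (tgt e)) + of_bool (tgt e = x) * (f x - f (src e))"
    proof cases
      case 1
      then have "other_end G e x = tgt e" using e(1) by (intro other_endI) simp
      with 1 show ?thesis by auto
    next
      case 2
      then have "other_end G e x = src e" using e(1) by (intro other_endI) (simp add: insert_commute)
      with 2 show ?thesis by auto
    qed
  qed simp
  also have "\<dots> = (\<Sum>e\<in>edges G.
    of_bool (src e = x) * (f x - f (tgt e)) + of_bool (tgt e = x) * (f x - f (src e)))"
    using fin(2) ends by (intro sum.mono_neutral_left) (auto simp: incident_def)
  finally show ?thesis .
qed

fun bc_src :: "bc_edge \<Rightarrow> nat \<times> nat" where
  "bc_src (Alpha h i) = (h, 0)"
| "bc_src (Beta h i) = (h, 1)"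
| "bc_src (Gamma h i) = (h, 0)"
| "bc_src (Diam0 h) = (h, 0)"
| "bc_src (Diam1 h) = (h, 1)"

fun bc_tgt :: "(nat \<Rightarrow> nat) \<Rightarrow> (nat \<Rightarrow> nat) \<Rightarrow> (nat \<Rightarrow> nat) \<Rightarrow> nat \<Rightarrow> bc_edge \<Rightarrow> nat \<times> nat" where
  "bc_tgt \<alpha> \<beta> \<gamma> N (Alpha h i) = ((h + \<alpha> i) mod N, 0)"
| "bc_tgt \<alpha> \<beta> \<gamma> N (Beta h i) = ((h + \<beta> i) mod N, 1)"
| "bc_tgt \<alpha> \<beta> \<gamma> N (Gamma h i) = ((h + \<gamma> i) mod N, 1)"
| "bc_tgt \<alpha> \<beta> \<gamma> N (Diam0 h) = ((h + N div 2) mod N, 0)"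
| "bc_tgt \<alpha> \<beta> \<gamma> N (Diam1 h) = ((h + N div 2) mod N, 1)"

lemma bc_ends_eq: "bc_ends \<alpha> \<beta> \<gamma> N e = {bc_src e, bc_tgt \<alpha> \<beta> \<gamma> N e}"
  by (cases e) simp_all

lemma verts_bicirculant: "verts (bicirculant r t s \<alpha> \<beta> \<gamma> j N) = {0..<N} \<times> {0, 1}"
  by (simp add: bicirculant_def)

lemma ends_bicirculant:
  "ends (bicirculant r t s \<alpha> \<beta> \<gamma> j N) e = {bc_src e, bc_tgt \<alpha> \<beta> \<gamma> N e}"
  by (simp add: bicirculant_def bc_ends_eq)

lemma edges_bicirculant: "edges (bicirculant r t s \<alpha> \<beta> \<gamma> j N) =
  (\<lambda>(h, i). Alpha h i) ` ({..<N} \<times> {1..r}) \<union> ((\<lambda>(h, i). Beta h i) ` ({..<N} \<times> {1..t})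
   \<union> ((\<lambda>(h, i). Gamma h i) ` ({..<N} \<times> {1..s})
   \<union> (Diam0 ` (if j \<in> {2, 4} then {..<N div 2} else {})
   \<union> Diam1 ` (if j \<in> {3, 4} then {..<N div 2} else {}))))"
  by (auto simp: bicirculant_def image_iff)

lemma finite_graph_bicirculant:
  assumes "N > 0"
  shows "finite_graph (bicirculant r t s \<alpha> \<beta> \<gamma> j N)"
  unfolding finite_graph_def
proof (intro conjI ballI)
  show "finite (verts (bicirculant r t s \<alpha> \<beta> \<gamma> j N))"
    "finite (edges (bicirculant r t s \<alpha> \<beta> \<gamma> j N))"
    by (auto simp: verts_bicirculant edges_bicirculant)
next
  fix e assume "e \<in> edges (bicirculant r t s \<alpha> \<beta> \<gamma> j N)"
  then have "bc_src e \<in> {0..<N} \<times> {0, 1} \<and> bc_tgt \<alpha> \<beta> \<gamma> N e \<in> {0..<N} \<times> {0, 1}"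
    using assms by (auto simp: edges_bicirculant split: if_splits)
  then show "\<exists>u\<in>verts (bicirculant r t s \<alpha> \<beta> \<gamma> j N).
    \<exists>v\<in>verts (bicirculant r t s \<alpha> \<beta> \<gamma> j N). ends (bicirculant r t s \<alpha> \<beta> \<gamma> j N) e = {u, v}"
    unfolding verts_bicirculant ends_bicirculant
    by (intro bexI[of _ "bc_src e"] bexI[of _ "bc_tgt \<alpha> \<beta> \<gamma> N e"]) simp_all
qed

lemma sum_edges_bicirculant:
  fixes F :: "bc_edge \<Rightarrow> 'a :: comm_monoid_add"
  shows "sum F (edges (bicirculant r t s \<alpha> \<beta> \<gamma> j N)) =
    (\<Sum>i=1..r. \<Sum>h<N. F (Alpha h i)) + ((\<Sum>i=1..t. \<Sum>h<N. F (Beta h i))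
    + ((\<Sum>i=1..s. \<Sum>h<N. F (Gamma h i))
    + ((if j \<in> {2, 4} then \<Sum>h<N div 2. F (Diam0 h) else 0)
    + (if j \<in> {3, 4} then \<Sum>h<N div 2. F (Diam1 h) else 0))))"
proof -
  have pair: "sum F ((\<lambda>(h, i). K h i) ` ({..<N} \<times> {1..k})) = (\<Sum>i=1..k. \<Sum>h<N. F (K h i))"
    if "\<And>h i h' i'. K h i = K h' i' \<longleftrightarrow> h = h' \<and> i = i'" for K k
  proof -
    have "sum F ((\<lambda>(h, i). K h i) ` ({..<N} \<times> {1..k})) = (\<Sum>(h, i)\<in>{..<N} \<times> {1..k}. F (K h i))"
      by (subst sum.reindex) (auto simp: inj_on_def that case_prod_unfold)
    also have "\<dots> = (\<Sum>i=1..k. \<Sum>h<N. F (K h i))"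
      by (subst sum.cartesian_product[symmetric]) (rule sum.swap)
    finally show ?thesis .
  qed
  have single: "sum F (K ` (if c then {..<n} else {})) = (if c then \<Sum>h<n. F (K h) else 0)"
    if "\<And>h h'. K h = K h' \<longleftrightarrow> h = h'" for K c and n :: nat
    using that by (simp add: sum.reindex inj_on_def)
  show ?thesis
    unfolding edges_bicirculant
    apply (subst sum.union_disjoint, (auto split: if_splits)[3])+
    apply (simp only: pair[of Alpha] pair[of Beta] pair[of Gamma] single[of Diam0] single[of Diam1]
        bc_edge.inject simp_thms)
    done
qed

lemma power_mod_order:
  fixes z :: "'a :: monoid_mult"
  assumes "z ^ N = 1"
  shows "z ^ (a mod N) = z ^ a"
proof -
  have "z ^ a = z ^ (N * (a div N) + a mod N)" by simp
  also have "\<dots> = z ^ (a mod N)" using assms by (simp only: power_add power_mult) simp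
  finally show ?thesis by simp
qed

text \<open>Translation by \<open>a\<close> permutes the residues modulo \<open>N\<close>, so
  exactly one index, k - a, contributes.\<close>

lemma sum_shift_indicator:
  fixes F :: "nat \<Rightarrow> 'a :: semiring_1"
  assumes k: "k < N" and F: "\<And>h. h < N \<Longrightarrow> (h + a) mod N = k \<Longrightarrow> F h = c"
  shows "(\<Sum>h<N. of_bool ((h + a) mod N = k) * F h) = c"
proof -
  have N: "N > 0" using k by simp
  define h0 where "h0 = (k + (N - a mod N)) mod N"
  have h0: "h0 < N" "(h0 + a) mod N = k"
  proof -
    show "h0 < N" using N by (simp add: h0_def)
    have "(h0 + a) mod N = (k + (N - a mod N) + a mod N) mod N"
      unfolding h0_def by (metis mod_add_left_eq mod_add_right_eq)
    also have "k + (N - a mod N) + a mod N = k + N" using mod_less_divisor[OF N, of a] by linarith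
    also have "(k + N) mod N = k" using k by simp
    finally show "(h0 + a) mod N = k" .
  qed
  have uniq: "h = h0" if "h < N" "(h + a) mod N = k" for h
  proof -
    have "[h + a = h0 + a] (mod N)" using that h0 by (simp add: cong_def)
    then have "[h = h0] (mod N)" by (simp only: cong_add_rcancel_nat)
    then show ?thesis using that(1) h0(1) by (simp add: cong_def)
  qed
  have "(\<Sum>h<N. of_bool ((h + a) mod N = k) * F h) = (\<Sum>h<N. if h = h0 then c else 0)"
  proof (intro sum.cong refl)
    fix h assume "h \<in> {..<N}"
    then have "(h + a) mod N = k \<longleftrightarrow> h = h0" using uniq h0(2) by blast
    then show "of_bool ((h + a) mod N = k) * F h = (if h = h0 then c else 0)"
      using F[OF h0] by (cases "h = h0") (simp_all only: of_bool_eq mult_1_left mult_zero_left if_True if_False refl simp_thms)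
  qed
  also have "\<dots> = c" using h0(1) by simp
  finally show ?thesis .
qed

lemma sum_index_indicator:
  fixes F :: "nat \<Rightarrow> 'a :: semiring_1"
  assumes "k < N"
  shows "(\<Sum>h<N. of_bool (h = k) * F h) = F k"
  using assms by simp

definition lap_value :: "nat \<Rightarrow> nat \<Rightarrow> (nat \<Rightarrow> nat) \<Rightarrow> complex \<Rightarrow> complex" where
  "lap_value r s \<alpha> z = of_nat (2 * r + s) - (\<Sum>i=1..r. z ^ \<alpha> i + inverse z ^ \<alpha> i)"

definition gam_value :: "nat \<Rightarrow> (nat \<Rightarrow> nat) \<Rightarrow> complex \<Rightarrow> complex" where
  "gam_value s \<gamma> z = (\<Sum>i=1..s. z ^ \<gamma> i)"

text \<open>For even \<open>N\<close> and z^N = 1 this is 0 or 2 according to the sign of z^(N/2):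
  the summand 2 that separates the other \<open>P_poly\<close> from the first.\<close>

definition diam_value :: "bool \<Rightarrow> nat \<Rightarrow> complex \<Rightarrow> complex" where
  "diam_value d N z = (if d then 1 - z ^ (N div 2) else 0)"

text \<open>All four blocks commute with translations, so they scale the character k -> z^k. The
  mixed blocks carry z and its inverse because a \<open>Gamma\<close> edge is traversed in opposite
  directions from its two sides.\<close>

lemma laplacian_bicirculant_character:
  fixes r t s :: nat and \<alpha> \<beta> \<gamma> :: "nat \<Rightarrow> nat" and z :: complex
  assumes N: "N > 0" and z: "z ^ N = 1" and even: "j = 1 \<or> even N" and j: "j \<in> {1, 2, 3, 4}"
    and k: "k < N"
  defines "G \<equiv> bicirculant r t s \<alpha> \<beta> \<gamma> j N"
  shows "(\<Sum>l<N. laplacian G (k, 0) (l, 0) * z ^ l) =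
      z ^ k * (lap_value r s \<alpha> z + diam_value (j \<in> {2, 4}) N z)"
    and "(\<Sum>l<N. laplacian G (k, 0) (l, 1) * z ^ l) = - (z ^ k * gam_value s \<gamma> z)"
    and "(\<Sum>l<N. laplacian G (k, 1) (l, 0) * z ^ l) = - (z ^ k * gam_value s \<gamma> (inverse z))"
    and "(\<Sum>l<N. laplacian G (k, 1) (l, 1) * z ^ l) =
      z ^ k * (lap_value t s \<beta> z + diam_value (j \<in> {3, 4}) N z)"
proof -
  have z0: "z \<noteq> 0" using z N by (auto simp: power_0_left)
  have fwd: "z ^ ((h + a) mod N) = z ^ h * z ^ a" for h a
    using power_mod_order[OF z] by (simp add: power_add)
  have bwd: "z ^ h = z ^ k * inverse z ^ a" if "(h + a) mod N = k" for h a
    using fwd[of h a] that z0 by (simp add: field_simps power_inverse)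
  \<comment> \<open>The character placed on side \<open>b\<close> and extended by 0, so that the
    full Laplacian acts on it through one column of blocks.\<close>
  define f where "f b x = (if snd x = b then z ^ fst x else 0)" for b :: nat and x :: "nat \<times> nat"
  have split: "(\<Sum>l<N. laplacian G x (l, b) * z ^ l) = (\<Sum>y\<in>verts G. laplacian G x y * f b y)"
    if "b \<in> {0, 1}" for x b
  proof -
    have "(\<Sum>y\<in>verts G. laplacian G x y * f b y) =
        (\<Sum>l\<in>{0..<N}. \<Sum>c\<in>{0, 1}. laplacian G x (l, c) * f b (l, c))"
      unfolding G_def verts_bicirculant by (simp add: sum.cartesian_product del: sum.insert)
    also have "\<dots> = (\<Sum>l\<in>{0..<N}. laplacian G x (l, b) * z ^ l)"
      using that by (intro sum.cong) (auto simp: f_def)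
    finally show ?thesis by (simp add: atLeast0LessThan)
  qed
  define S where "S x b e = of_bool (bc_src e = x) * (f b x - f b (bc_tgt \<alpha> \<beta> \<gamma> N e)) +
     of_bool (bc_tgt \<alpha> \<beta> \<gamma> N e = x) * (f b x - f b (bc_src e))" for x b e
  have act: "(\<Sum>l<N. laplacian G (k, a) (l, b) * z ^ l) = sum (S (k, a) b) (edges G)"
    if "a \<in> {0, 1}" "b \<in> {0, 1}" for a b
    unfolding split[OF that(2)] S_def
    using k that(1) finite_graph_bicirculant[OF N]
    by (intro laplacian_apply) (auto simp: G_def verts_bicirculant ends_bicirculant)
  have loop: "(\<Sum>h<N. of_bool (h = k) * (z ^ k - z ^ ((h + a) mod N)) +
      of_bool ((h + a) mod N = k) * (z ^ k - z ^ h)) = z ^ k * (2 - (z ^ a + inverse z ^ a))" for a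
  proof -
    have "(\<Sum>h<N. of_bool ((h + a) mod N = k) * (z ^ k - z ^ h)) = z ^ k - z ^ k * inverse z ^ a"
      by (rule sum_shift_indicator[OF k]) (simp add: bwd)
    moreover have "(\<Sum>h<N. of_bool (h = k) * (z ^ k - z ^ ((h + a) mod N))) = z ^ k - z ^ k * z ^ a"
      by (subst sum_index_indicator[OF k]) (simp add: fwd)
    ultimately show ?thesis by (simp only: sum.distrib) (simp add: algebra_simps)
  qed
  \<comment> \<open>The summand \<open>of_nat s * z ^ k\<close> is the share of the degree that
    comes from the \<open>Gamma\<close> edges at k.\<close>
  have loops: "(\<Sum>i=1..m. \<Sum>h<N. of_bool (h = k) * (z ^ k - z ^ ((h + \<delta> i) mod N)) +
      of_bool ((h + \<delta> i) mod N = k) * (z ^ k - z ^ h)) + of_nat s * z ^ k = z ^ k * lap_value m s \<delta> z" for m \<delta>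
    unfolding loop lap_value_def by (simp add: sum_distrib_left sum_subtractf sum.distrib algebra_simps)
  have diam: "(\<Sum>h<N div 2. of_bool (h = k) * (z ^ k - z ^ ((h + N div 2) mod N)) +
      of_bool ((h + N div 2) mod N = k) * (z ^ k - z ^ h)) = z ^ k * (1 - z ^ (N div 2))" if "even N"
  proof -
    define n where "n = N div 2"
    have n: "N = 2 * n" using that by (simp add: n_def)
    have zz: "z ^ n * z ^ n = 1" using z by (simp add: n mult_2 power_add)
    \<comment> \<open>Diametral edges are listed for \<open>h < n\<close> only, so exactly one of
      them meets k: it starts at k, or it starts at k - n and ends at k.\<close>
    have "(\<Sum>h<n. of_bool (h = k) * (z ^ k - z ^ ((h + n) mod N)) +
        of_bool ((h + n) mod N = k) * (z ^ k - z ^ h)) =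
      (\<Sum>h<n. if h = (if k < n then k else k - n) then z ^ k * (1 - z ^ n) else 0)"
    proof (rule sum.cong)
      fix h assume "h \<in> {..<n}"
      then have h: "h < n" "(h + n) mod N = h + n" using n by auto
      have "z ^ (h + n) * z ^ n = z ^ h" using zz by (simp add: power_add mult.assoc)
      show "of_bool (h = k) * (z ^ k - z ^ ((h + n) mod N)) +
          of_bool ((h + n) mod N = k) * (z ^ k - z ^ h) =
        (if h = (if k < n then k else k - n) then z ^ k * (1 - z ^ n) else 0)"
      proof (cases "k < n")
        case True
        then show ?thesis using h by (cases "h = k") (simp_all add: right_diff_distrib power_add)
      next
        case False
        then obtain k' where k': "k = k' + n" using le_Suc_ex[of n k] by (auto simp: add.commute)
        show ?thesis
        proof (cases "h = k'")
          case True
          then show ?thesis using h k' False \<open>z ^ (h + n) * z ^ n = z ^ h\<close>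
            by (simp add: right_diff_distrib)
        next
          case False
          then show ?thesis using h k' by simp
        qed
      qed
    qed simp
    also have "\<dots> = z ^ k * (1 - z ^ n)" using k n by (subst sum.delta) (simp_all, linarith)
    finally show ?thesis by (simp only: n_def)
  qed
  have diam_if: "(if j \<in> J then \<Sum>h<N div 2. of_bool (h = k) * (z ^ k - z ^ ((h + N div 2) mod N)) +
      of_bool ((h + N div 2) mod N = k) * (z ^ k - z ^ h) else 0) = z ^ k * diam_value (j \<in> J) N z"
    if "1 \<notin> J" for J
    using that even diam by (auto simp: diam_value_def)
  have not1: "1 \<notin> {2, 4 :: nat}" "1 \<notin> {3, 4 :: nat}" by simp_all
  have out: "(\<Sum>i=1..s. \<Sum>h<N. of_bool (h = k) * c i) = (\<Sum>i=1..s. c i)" for c :: "nat \<Rightarrow> complex"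
    using k by (intro sum.cong refl) (rule sum_index_indicator)
  have into: "(\<Sum>i=1..s. \<Sum>h<N. of_bool ((h + \<gamma> i) mod N = k) * c) = of_nat s * c" for c :: complex
  proof -
    have "(\<Sum>h<N. of_bool ((h + \<gamma> i) mod N = k) * c) = c" for i
      by (rule sum_shift_indicator[OF k]) (rule refl)
    then show ?thesis by (simp only: sum_constant) simp
  qed
  note sum_E = sum_edges_bicirculant[of _ r t s \<alpha> \<beta> \<gamma> j N, folded G_def]
  note sum_simps = sum_E sum.neutral_const if_cancel add_0_left add_0_right out into mult_1_left
  have S00: "S (k, 0) 0 (Alpha h i) = of_bool (h = k) * (z ^ k - z ^ ((h + \<alpha> i) mod N)) + of_bool ((h + \<alpha> i) mod N = k) * (z ^ k - z ^ h)"
    "S (k, 0) 0 (Beta h i) = 0"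
    "S (k, 0) 0 (Gamma h i) = of_bool (h = k) * z ^ k"
    "S (k, 0) 0 (Diam0 h) = of_bool (h = k) * (z ^ k - z ^ ((h + N div 2) mod N)) + of_bool ((h + N div 2) mod N = k) * (z ^ k - z ^ h)"
    "S (k, 0) 0 (Diam1 h) = 0" for h i
    by (simp_all add: S_def f_def)
  have S01: "S (k, 0) 1 (Alpha h i) = 0"
    "S (k, 0) 1 (Beta h i) = 0"
    "S (k, 0) 1 (Gamma h i) = of_bool (h = k) * (- (z ^ ((k + \<gamma> i) mod N)))"
    "S (k, 0) 1 (Diam0 h) = 0"
    "S (k, 0) 1 (Diam1 h) = 0" for h i
    by (simp_all add: S_def f_def)
  have S10: "S (k, 1) 0 (Alpha h i) = 0"
    "S (k, 1) 0 (Beta h i) = 0"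
    "S (k, 1) 0 (Gamma h i) = of_bool ((h + \<gamma> i) mod N = k) * (- (z ^ h))"
    "S (k, 1) 0 (Diam0 h) = 0"
    "S (k, 1) 0 (Diam1 h) = 0" for h i
    by (simp_all add: S_def f_def)
  have S11: "S (k, 1) 1 (Alpha h i) = 0"
    "S (k, 1) 1 (Beta h i) = of_bool (h = k) * (z ^ k - z ^ ((h + \<beta> i) mod N)) + of_bool ((h + \<beta> i) mod N = k) * (z ^ k - z ^ h)"
    "S (k, 1) 1 (Gamma h i) = of_bool ((h + \<gamma> i) mod N = k) * z ^ k"
    "S (k, 1) 1 (Diam0 h) = 0"
    "S (k, 1) 1 (Diam1 h) = of_bool (h = k) * (z ^ k - z ^ ((h + N div 2) mod N)) + of_bool ((h + N div 2) mod N = k) * (z ^ k - z ^ h)" for h i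
    by (simp_all add: S_def f_def)
  show "(\<Sum>l<N. laplacian G (k, 0) (l, 0) * z ^ l) =
      z ^ k * (lap_value r s \<alpha> z + diam_value (j \<in> {2, 4}) N z)"
    unfolding act[OF insertI1 insertI1] distrib_left loops[symmetric]
    by (simp only: sum_simps S00 diam_if[OF not1(1)] add.assoc) simp
  have "(\<Sum>l<N. laplacian G (k, 0) (l, 1) * z ^ l) = (\<Sum>i=1..s. - (z ^ ((k + \<gamma> i) mod N)))"
    unfolding act[OF insertI1 insertI2[OF insertI1]] by (simp only: sum_simps S01)
  then show "(\<Sum>l<N. laplacian G (k, 0) (l, 1) * z ^ l) = - (z ^ k * gam_value s \<gamma> z)"
    by (simp only: gam_value_def fwd sum_distrib_left sum_negf)
  have "(\<Sum>l<N. laplacian G (k, 1) (l, 0) * z ^ l) =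
      (\<Sum>i=1..s. \<Sum>h<N. of_bool ((h + \<gamma> i) mod N = k) * (- (z ^ h)))"
    unfolding act[OF insertI2[OF insertI1] insertI1] by (simp only: sum_simps S10)
  also have "\<dots> = (\<Sum>i=1..s. - (z ^ k * inverse z ^ \<gamma> i))"
    by (intro sum.cong refl sum_shift_indicator[OF k]) (simp add: bwd)
  finally show "(\<Sum>l<N. laplacian G (k, 1) (l, 0) * z ^ l) = - (z ^ k * gam_value s \<gamma> (inverse z))"
    by (simp only: gam_value_def sum_distrib_left sum_negf)
  show "(\<Sum>l<N. laplacian G (k, 1) (l, 1) * z ^ l) =
      z ^ k * (lap_value t s \<beta> z + diam_value (j \<in> {3, 4}) N z)"
    unfolding act[OF insertI2[OF insertI1] insertI2[OF insertI1]] distrib_left loops[symmetric]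
    by (simp only: sum_simps S11 diam_if[OF not1(2)] add.assoc)
qed

section \<open>Diagonalization by the discrete Fourier transform\<close>

definition unit_root :: "nat \<Rightarrow> nat \<Rightarrow> complex" where
  "unit_root N m = cis (2 * pi * real m / real N)"

lemma unit_root_power: "unit_root N m = unit_root N 1 ^ m"
  by (simp add: unit_root_def DeMoivre mult.commute)

lemma bij_betw_unit_root: "N > 0 \<Longrightarrow> bij_betw (unit_root N) {..<N} {z. z ^ N = 1}"
  unfolding unit_root_def by (rule bij_betw_roots_unity)

lemma unit_root_order:
  assumes "N > 0"
  shows "unit_root N m ^ N = 1"
proof -
  have "unit_root N m ^ N = cis (2 * pi) ^ m"
    using assms unfolding unit_root_def by (simp add: DeMoivre mult_ac)
  then show ?thesis by simp
qed

definition fourier_mat :: "nat \<Rightarrow> complex mat" where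
  "fourier_mat N = mat N N (\<lambda>(k, m). unit_root N m ^ k)"

text \<open>Orthogonality of characters: the product with the matrix of inverse characters is
  \<open>N\<close> times the identity.\<close>

lemma det_fourier_mat_nonzero:
  assumes N: "N > 0"
  shows "det (fourier_mat N) \<noteq> 0"
proof -
  define F' where "F' = mat N N (\<lambda>(m, l). inverse (unit_root N m) ^ l)"
  let ?w = "unit_root N 1"
  have w0: "?w \<noteq> 0" by (simp add: unit_root_def)
  have sum: "(\<Sum>m = 0..<N. unit_root N m ^ k * inverse (unit_root N m) ^ l) = (if k = l then of_nat N else 0)"
    if kl: "k < N" "l < N" for k l
  proof -
    define y where "y = ?w ^ k * inverse ?w ^ l"
    have ym: "unit_root N m ^ k * inverse (unit_root N m) ^ l = y ^ m" for m
      unfolding unit_root_power[of N m] y_def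
      by (simp add: power_mult_distrib power_inverse flip: power_mult) (simp add: mult.commute)
    show ?thesis
    proof (cases "k = l")
      case True
      then have "y = 1" using w0 by (simp add: y_def power_inverse)
      then show ?thesis unfolding ym using True by simp
    next
      case False
      have "y \<noteq> 1"
      proof
        assume "y = 1"
        then have "?w ^ k = ?w ^ l" using w0 by (simp add: y_def power_inverse field_simps)
        then have "unit_root N k = unit_root N l" by (simp only: unit_root_power[symmetric])
        with False kl bij_betw_unit_root[OF N] show False by (auto simp: bij_betw_def inj_on_def)
      qed
      moreover have "y ^ N = 1"
      proof -
        have "y ^ N = (?w ^ N) ^ k * inverse (?w ^ N) ^ l"
          unfolding y_def by (simp add: power_mult_distrib power_inverse flip: power_mult) (simp add: mult.commute)
        then show ?thesis using unit_root_order[OF N, of 1] by simp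
      qed
      ultimately have "(\<Sum>m<N. y ^ m) = 0" by (simp add: geometric_sum)
      then show ?thesis unfolding ym using False by (simp add: atLeast0LessThan)
    qed
  qed
  have "fourier_mat N * F' = of_nat N \<cdot>\<^sub>m 1\<^sub>m N"
    by (rule eq_matI) (simp_all add: fourier_mat_def F'_def scalar_prod_def sum)
  then have "det (fourier_mat N) * det F' = of_nat N ^ N"
    using det_mult[of "fourier_mat N" N F'] by (simp add: fourier_mat_def F'_def det_smult)
  then show ?thesis using N by auto
qed

lemma det_mat_diag: "det (mat_diag N f) = (\<Prod>m<N. f m :: 'a :: idom)"
proof -
  have "det (mat_diag N f) = prod_list (diag_mat (mat_diag N f))"
    by (rule det_upper_triangular[of _ N]) (auto simp: mat_diag_def upper_triangular_def)
  also have "\<dots> = (\<Prod>m = 0..<N. f m)"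
    by (simp add: prod_list_diag_prod) (simp add: mat_diag_def)
  finally show ?thesis by (simp add: atLeast0LessThan)
qed

text \<open>Conjugation by the block diagonal matrix with two copies of \<open>F\<close> makes all
  blocks diagonal. These commute, so the determinant is that of A D - B C for the diagonalized
  blocks.\<close>

lemma det_four_block_simultaneously_diagonal:
  fixes F :: "'a :: idom mat"
  assumes F: "F \<in> carrier_mat N N" "det F \<noteq> 0"
    and M: "A \<in> carrier_mat N N" "B \<in> carrier_mat N N" "C \<in> carrier_mat N N" "D \<in> carrier_mat N N"
    and eig: "A * F = F * mat_diag N a" "B * F = F * mat_diag N b"
      "C * F = F * mat_diag N c" "D * F = F * mat_diag N d"
  shows "det (four_block_mat A B C D) = (\<Prod>m<N. a m * d m - b m * c m)"
proof -
  have dg: "mat_diag N f \<in> carrier_mat N N" for f :: "nat \<Rightarrow> 'a" by (simp add: mat_diag_def)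
  let ?Z = "0\<^sub>m N N :: 'a mat"
  have Z: "?Z \<in> carrier_mat N N" by simp
  define X where "X = four_block_mat A B C D"
  define Y where "Y = four_block_mat F ?Z ?Z F"
  define W where "W = four_block_mat (mat_diag N a) (mat_diag N b) (mat_diag N c) (mat_diag N d)"
  have car: "X \<in> carrier_mat (N + N) (N + N)" "Y \<in> carrier_mat (N + N) (N + N)"
    "W \<in> carrier_mat (N + N) (N + N)"
    unfolding X_def Y_def W_def using F M dg by auto
  have "X * Y = W'" if "W' = four_block_mat (A * F) (B * F) (C * F) (D * F)" for W'
    unfolding X_def Y_def that using F M
    by (subst mult_four_block_mat[OF M F(1) Z Z F(1)]) simp
  moreover have "Y * W = W'" if "W' = four_block_mat (A * F) (B * F) (C * F) (D * F)" for W'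
    unfolding W_def Y_def that eig using F(1) dg
    by (subst mult_four_block_mat[OF F(1) Z Z F(1) dg dg dg dg])
      (simp add: left_mult_zero_mat[OF dg] right_add_zero_mat[OF mult_carrier_mat[OF F(1) dg]]
        left_add_zero_mat[OF mult_carrier_mat[OF F(1) dg]])
  ultimately have "det (X * Y) = det (Y * W)" by simp
  then have "det X * det Y = det Y * det W"
    using det_mult[OF car(1,2)] det_mult[OF car(2,3)] by simp
  moreover have "det Y = det F * det F"
    unfolding Y_def by (rule det_four_block_mat_lower_left_zero[OF F(1) Z refl F(1)])
  ultimately have "det X = det W" using F(2) by simp
  also have "\<dots> = det (mat_diag N a * mat_diag N d - mat_diag N b * mat_diag N c)"
    unfolding W_def by (rule det_four_block_mat[OF dg dg dg dg]) (simp add: mat_diag_diag mult.commute)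
  also have "mat_diag N a * mat_diag N d - mat_diag N b * mat_diag N c =
      mat_diag N (\<lambda>m. a m * d m - b m * c m)"
    unfolding mat_diag_diag by (rule eq_matI) (auto simp: mat_diag_def)
  finally show ?thesis by (simp add: X_def det_mat_diag)
qed

lemma tree_count_product:
  fixes r t s :: nat and \<alpha> \<beta> \<gamma> :: "nat \<Rightarrow> nat"
  assumes N: "N > 0" and even: "j = 1 \<or> even N" and j: "j \<in> {1, 2, 3, 4}"
  defines "W \<equiv> \<lambda>z. (lap_value r s \<alpha> z + diam_value (j \<in> {2, 4}) N z) *
    (lap_value t s \<beta> z + diam_value (j \<in> {3, 4}) N z) - gam_value s \<gamma> z * gam_value s \<gamma> (inverse z)"
  shows "of_nat (N * \<tau> (bicirculant r t s \<alpha> \<beta> \<gamma> j N)) =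
    of_nat s * (\<Prod>m\<in>{1..<N}. W (unit_root N m))"
proof -
  define G where "G = bicirculant r t s \<alpha> \<beta> \<gamma> j N"
  \<comment> \<open>Indices below \<open>N\<close> run through side 0 and the others through side 1,
    which displays the Laplacian in four blocks.\<close>
  define v where "v i = (i mod N, i div N)" for i
  define a where "a z = lap_value r s \<alpha> z + diam_value (j \<in> {2, 4}) N z" for z
  define b where "b z = lap_value t s \<beta> z + diam_value (j \<in> {3, 4}) N z" for z
  define c where "c z = gam_value s \<gamma> z" for z
  have W: "W z = a z * b z - c z * c (inverse z)" for z by (simp add: W_def a_def b_def c_def)
  let ?u = "unit_root N"
  let ?F = "fourier_mat N"
  have F: "?F \<in> carrier_mat N N" by (simp add: fourier_mat_def)
  have bij: "bij_betw v {0..<N + N} (verts G)"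
    unfolding G_def verts_bicirculant
  proof (rule bij_betwI[where g = "\<lambda>(k, x). k + N * x"])
    show "v \<in> {0..<N + N} \<rightarrow> {0..<N} \<times> {0, 1}"
    proof
      fix i assume i: "i \<in> {0..<N + N}"
      then have "i div N < 2" using N by (simp add: div_less_iff_less_mult)
      then show "v i \<in> {0..<N} \<times> {0, 1}" using N by (auto simp: v_def)
    qed
  qed (use N in \<open>auto simp: v_def\<close>)
  define M where "M t x y = mat N N (\<lambda>(k, l). t * of_bool (k = l \<and> x = y) + laplacian G (k, x) (l, y))"
    for t :: complex and x y :: nat
  have Mc: "M t x y \<in> carrier_mat N N" for t x y by (simp add: M_def)
  have eig: "M t x y * ?F = ?F * mat_diag N f"
    if "\<And>m k. m < N \<Longrightarrow> k < N \<Longrightarrow> (\<Sum>l<N. laplacian G (k, x) (l, y) * ?u m ^ l) + t * of_bool (x = y) * ?u m ^ k = ?u m ^ k * f m"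
    for t x y f
  proof (rule eq_matI)
    fix k m assume "k < dim_row (?F * mat_diag N f)" "m < dim_col (?F * mat_diag N f)"
    then have km: "k < N" "m < N" by (simp_all add: fourier_mat_def mat_diag_def)
    have "(M t x y * ?F) $$ (k, m) =
        (\<Sum>l<N. (t * of_bool (k = l \<and> x = y) + laplacian G (k, x) (l, y)) * ?u m ^ l)"
      using km by (simp add: M_def fourier_mat_def scalar_prod_def atLeast0LessThan)
    also have "\<dots> = (\<Sum>l<N. laplacian G (k, x) (l, y) * ?u m ^ l) + (\<Sum>l<N. of_bool (l = k) * (t * of_bool (x = y) * ?u m ^ l))"
      unfolding sum.distrib[symmetric] by (rule sum.cong) (auto simp: algebra_simps)
    also have "\<dots> = ?u m ^ k * f m"
      using that[OF km(2,1)] by (subst sum_index_indicator[OF km(1)])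
    also have "\<dots> = (?F * mat_diag N f) $$ (k, m)"
      using km by (subst mat_diag_mult_right[OF F]) (simp add: fourier_mat_def)
    finally show "(M t x y * ?F) $$ (k, m) = (?F * mat_diag N f) $$ (k, m)" .
  qed (simp_all add: M_def fourier_mat_def mat_diag_def)
  note char = laplacian_bicirculant_character[OF N unit_root_order[OF N] even j, of _ r t s \<alpha> \<beta> \<gamma>,
    folded G_def a_def b_def c_def]
  have det: "det (mat (N + N) (N + N) (\<lambda>(i, l). t * of_bool (i = l) + laplacian G (v i) (v l))) =
    (\<Prod>m<N. (a (?u m) + t) * (b (?u m) + t) - c (?u m) * c (inverse (?u m)))" (is "det ?M = _") for t
  proof -
    have "?M = four_block_mat (M t 0 0) (M t 0 1) (M t 1 0) (M t 1 1)"
    proof (rule eq_matI)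
      fix i l assume "i < dim_row (four_block_mat (M t 0 0) (M t 0 1) (M t 1 0) (M t 1 1))"
        "l < dim_col (four_block_mat (M t 0 0) (M t 0 1) (M t 1 0) (M t 1 1))"
      then have il: "i < N + N" "l < N + N" by (simp_all add: M_def)
      have v: "v k = (if k < N then (k, 0) else (k - N, 1))" if "k < N + N" for k
      proof (cases "k < N")
        case False
        then obtain k' where "k = k' + N" using le_Suc_ex[of N k] by (auto simp: add.commute)
        then show ?thesis using that by (simp add: v_def)
      qed (simp add: v_def)
      show "?M $$ (i, l) = four_block_mat (M t 0 0) (M t 0 1) (M t 1 0) (M t 1 1) $$ (i, l)"
        using il by (auto simp: v M_def)
    qed (simp_all add: M_def)
    also have "det \<dots> = (\<Prod>m<N. (a (?u m) + t) * (b (?u m) + t) - (- c (?u m)) * (- c (inverse (?u m))))"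
      by (rule det_four_block_simultaneously_diagonal[OF F det_fourier_mat_nonzero[OF N] Mc Mc Mc Mc];
        rule eig) (simp_all only: char, simp_all add: algebra_simps)
    finally show ?thesis by simp
  qed
  define q where "q m = [:a (?u m), 1:] * [:b (?u m), 1:] - [:c (?u m) * c (inverse (?u m)):]" for m
  have "coeff (\<Prod>m<N. q m) 1 = of_nat (card (verts G) * \<tau> G)"
  proof (rule matrix_tree[OF _ bij])
    show "finite_graph G" unfolding G_def by (rule finite_graph_bicirculant[OF N])
    show "poly (\<Prod>m<N. q m) t = det (mat (N + N) (N + N) (\<lambda>(i, l). t * of_bool (i = l) + laplacian G (v i) (v l)))" for t
      unfolding det poly_prod by (rule prod.cong) (simp_all add: q_def algebra_simps)
  qed
  moreover have "card (verts G) = 2 * N"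
    by (simp add: G_def verts_bicirculant card_cartesian_product)
  moreover have "coeff (\<Prod>m<N. q m) 1 = 2 * of_nat s * (\<Prod>m\<in>{1..<N}. W (?u m))"
  proof -
    have "{..<N} = insert 0 {1..<N}" using N by auto
    then have "(\<Prod>m<N. q m) = q 0 * (\<Prod>m\<in>{1..<N}. q m)" by simp
    \<comment> \<open>At z = 1 all three values are s, so the factor is (s + t)^2 - s^2 = t (t + 2
      s). Its zero at t = 0 reduces the coefficient at 1 to 2 s times the constant terms of the
      other factors.\<close>
    moreover have "q 0 = pCons 0 [:2 * of_nat s, 1:]"
      by (simp add: q_def a_def b_def c_def unit_root_def lap_value_def gam_value_def diam_value_def)
    ultimately have "coeff (\<Prod>m<N. q m) 1 = 2 * of_nat s * coeff (\<Prod>m\<in>{1..<N}. q m) 0"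
      by (simp add: coeff_mult_0 mult_pCons_left)
    also have "coeff (\<Prod>m\<in>{1..<N}. q m) 0 = (\<Prod>m\<in>{1..<N}. W (?u m))"
      unfolding poly_0_coeff_0[symmetric] poly_prod by (simp add: q_def W mult.commute)
    finally show ?thesis .
  qed
  ultimately have "2 * of_nat (N * \<tau> G) = 2 * (of_nat s * (\<Prod>m\<in>{1..<N}. W (?u m)))"
    by (simp add: mult.assoc)
  then show ?thesis unfolding G_def by (simp only: mult_cancel_left) simp
qed

section \<open>Laurent polynomials in \<open>z + 1/z\<close>\<close>

definition leval :: "laurent_poly \<Rightarrow> complex \<Rightarrow> complex" where
  "leval P z = (\<Sum>i\<in>Poly_Mapping.keys P. of_int (Poly_Mapping.lookup P i) * z powi i)"

lemma leval_superset:
  assumes "finite A" "Poly_Mapping.keys P \<subseteq> A"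
  shows "leval P z = (\<Sum>i\<in>A. of_int (Poly_Mapping.lookup P i) * z powi i)"
  unfolding leval_def using assms by (intro sum.mono_neutral_left) (auto simp: in_keys_iff)

lemma leval_0 [simp]: "leval 0 z = 0"
  by (simp add: leval_def)

lemma leval_diff [simp]: "leval (P - Q) z = leval P z - leval Q z"
proof -
  let ?A = "Poly_Mapping.keys P \<union> Poly_Mapping.keys Q"
  have "Poly_Mapping.keys (P - Q) \<subseteq> ?A" by (auto simp: in_keys_iff lookup_minus)
  then show ?thesis
    by (simp add: leval_superset[of ?A] lookup_minus left_diff_distrib sum_subtractf)
qed

lemma leval_add [simp]: "leval (P + Q) z = leval P z + leval Q z"
  using leval_diff[of P "- Q" z] leval_diff[of 0 Q z] by simp

lemma leval_sum [simp]: "leval (sum f A) z = (\<Sum>x\<in>A. leval (f x) z)"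
  by (induction A rule: infinite_finite_induct) simp_all

lemma leval_single [simp]: "leval (Poly_Mapping.single i c) z = of_int c * z powi i"
  by (simp add: leval_def)

lemma leval_of_nat [simp]: "leval (of_nat n) z = of_nat n"
  using leval_single[of 0 "int n" z] by (simp add: single_of_nat)

lemma leval_numeral [simp]: "leval (numeral n) z = numeral n"
  using leval_of_nat[of "numeral n" z] by simp

text \<open>Biadditivity reduces the claim to monomials. The induction principle generates elements
  by differences, which is why \<open>leval_diff\<close> is the basic rule here.\<close>

lemma leval_mult [simp]:
  assumes z: "z \<noteq> 0"
  shows "leval (P * Q) z = leval P z * leval Q z"
proof (induction P rule: frag_induction[OF subset_UNIV, case_names zero one diff])
  case (one i)
  show ?case
  proof (induction Q rule: frag_induction[OF subset_UNIV, case_names zero one diff])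
    case (one j)
    show ?case using z by (simp add: mult_single power_int_add)
  qed (simp_all add: right_diff_distrib)
qed (simp_all add: left_diff_distrib)

lemma leval_lap: "z \<noteq> 0 \<Longrightarrow> leval (lap r s \<alpha>) z = lap_value r s \<alpha> z"
  by (simp add: lap_def lap_value_def power_int_minus power_inverse)

lemma leval_P_poly:
  assumes z: "z \<noteq> 0"
  shows "leval (P_poly r t s \<alpha> \<beta> \<gamma> j) z =
    (lap_value r s \<alpha> z + (if j \<in> {2, 4} then 2 else 0)) *
    (lap_value t s \<beta> z + (if j \<in> {3, 4} then 2 else 0)) - gam_value s \<gamma> z * gam_value s \<gamma> (inverse z)"
  unfolding P_poly_def gam_value_def using z
  by (simp add: leval_lap power_int_minus power_inverse mult.commute)

text \<open>\<open>dickson m\<close> expresses \<open>z\<^sup>m + z\<^sup>-\<^sup>m\<close> as a polynomial in \<open>w = z + z\<^sup>-\<^sup>1\<close>, and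
  \<open>dickson_quot m\<close> is the quotient of \<open>2 - dickson m\<close> by \<open>2 - w\<close>.\<close>

fun dickson_quot :: "nat \<Rightarrow> complex poly" where
  "dickson_quot 0 = 0"
| "dickson_quot (Suc 0) = 1"
| "dickson_quot (Suc (Suc m)) = [:0, 1:] * dickson_quot (Suc m) - dickson_quot m + 2"

definition dickson :: "nat \<Rightarrow> complex poly" where
  "dickson m = 2 - [:2, -1:] * dickson_quot m"

lemma poly_dickson:
  assumes z: "z \<noteq> 0"
  shows "poly (dickson m) (z + inverse z) = z ^ m + inverse z ^ m"
proof (induction m rule: dickson_quot.induct)
  case (3 m)
  let ?w = "z + inverse z"
  have "poly (dickson (Suc (Suc m))) ?w =
      ?w * poly (dickson (Suc m)) ?w - poly (dickson m) ?w"
    by (simp add: dickson_def algebra_simps)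
  also have "\<dots> = z ^ Suc (Suc m) + inverse z ^ Suc (Suc m)"
    unfolding 3 using z by (simp add: field_simps)
  finally show ?case .
qed (simp_all add: dickson_def algebra_simps)

text \<open>This is the limit of (2 - z^m - z^(-m)) / (2 - z - 1/z) as z tends to 1. That it is a
  square drives the positivity argument at w = 2.\<close>

lemma poly_dickson_quot_2: "poly (dickson_quot m) 2 = of_nat (m ^ 2)"
proof (induction m rule: dickson_quot.induct)
  case (3 m)
  then show ?case by (simp add: power2_eq_square algebra_simps)
qed simp_all

definition absdiff :: "nat \<Rightarrow> nat \<Rightarrow> nat" where
  "absdiff a b = (a - b) + (b - a)"

definition lap_quot :: "nat \<Rightarrow> (nat \<Rightarrow> nat) \<Rightarrow> complex poly" where
  "lap_quot r \<alpha> = (\<Sum>i=1..r. dickson_quot (\<alpha> i))"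

text \<open>C(z) C(1/z) is a sum over ordered pairs (i, k). Adding the terms of (i, k) and (k, i)
  gives a Dickson polynomial, and 1/2 undoes the doubling.\<close>

definition gam_quot :: "nat \<Rightarrow> (nat \<Rightarrow> nat) \<Rightarrow> complex poly" where
  "gam_quot s \<gamma> = [:1 / 2:] * (\<Sum>i=1..s. \<Sum>k=1..s. dickson_quot (absdiff (\<gamma> i) (\<gamma> k)))"

lemma lap_value_eq_poly:
  assumes z: "z \<noteq> 0"
  shows "lap_value r s \<alpha> z = poly (of_nat s + [:2, -1:] * lap_quot r \<alpha>) (z + inverse z)"
proof -
  have "(\<Sum>i=1..r. z ^ \<alpha> i + inverse z ^ \<alpha> i) = (\<Sum>i=1..r. poly (dickson (\<alpha> i)) (z + inverse z))"
    using poly_dickson[OF z] by simp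
  also have "\<dots> = 2 * of_nat r - poly ([:2, -1:] * lap_quot r \<alpha>) (z + inverse z)"
    unfolding dickson_def lap_quot_def by (simp add: sum_subtractf poly_sum sum_distrib_left)
  finally show ?thesis by (simp add: lap_value_def)
qed

lemma gam_value_eq_poly:
  assumes z: "z \<noteq> 0"
  shows "gam_value s \<gamma> z * gam_value s \<gamma> (inverse z) =
    poly (of_nat (s ^ 2) - [:2, -1:] * gam_quot s \<gamma>) (z + inverse z)"
proof -
  define g where "g i k = z ^ \<gamma> i * inverse z ^ \<gamma> k" for i k
  have "gam_value s \<gamma> z * gam_value s \<gamma> (inverse z) = (\<Sum>i=1..s. \<Sum>k=1..s. g i k)"
    unfolding gam_value_def g_def by (rule sum_product)
  moreover have "\<dots> = (\<Sum>i=1..s. \<Sum>k=1..s. g k i)" by (rule sum.swap)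
  ultimately have "2 * (gam_value s \<gamma> z * gam_value s \<gamma> (inverse z)) = (\<Sum>i=1..s. \<Sum>k=1..s. g i k + g k i)"
    by (simp add: sum.distrib)
  also have "\<dots> = (\<Sum>i=1..s. \<Sum>k=1..s. poly (dickson (absdiff (\<gamma> i) (\<gamma> k))) (z + inverse z))"
  proof (intro sum.cong refl)
    fix i k
    have sym: "z ^ a * inverse z ^ b + z ^ b * inverse z ^ a = z ^ (a - b) + inverse z ^ (a - b)" if ba: "b \<le> a" for a b
    proof -
      from le_Suc_ex[OF ba] obtain d where d: "a = b + d" ..
      have "z ^ b * inverse z ^ b = 1" using z by (simp flip: power_mult_distrib)
      then have "z ^ a * inverse z ^ b = z ^ d" "z ^ b * inverse z ^ a = inverse z ^ d"
        unfolding d power_add by (metis mult.assoc mult.commute mult_1_left)+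
      then show ?thesis by (simp add: d)
    qed
    show "g i k + g k i = poly (dickson (absdiff (\<gamma> i) (\<gamma> k))) (z + inverse z)"
    proof (cases "\<gamma> k \<le> \<gamma> i")
      case True
      then have "absdiff (\<gamma> i) (\<gamma> k) = \<gamma> i - \<gamma> k" by (simp add: absdiff_def)
      then show ?thesis unfolding poly_dickson[OF z] g_def by (simp only: sym[OF True])
    next
      case False
      then have le: "\<gamma> i \<le> \<gamma> k" and "absdiff (\<gamma> i) (\<gamma> k) = \<gamma> k - \<gamma> i" by (simp_all add: absdiff_def)
      then show ?thesis unfolding poly_dickson[OF z] g_def
        by (simp only: add.commute[of "z ^ \<gamma> i * _"] sym[OF le])
    qed
  qed
  also have "\<dots> = 2 * poly (of_nat (s ^ 2) - [:2, -1:] * gam_quot s \<gamma>) (z + inverse z)"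
    unfolding dickson_def gam_quot_def poly_diff poly_mult poly_sum sum_subtractf sum_distrib_left[symmetric]
    by (simp add: power2_eq_square right_diff_distrib)
  finally show ?thesis by (simp only: mult_cancel_left) simp
qed

section \<open>The polynomials P_j in the variable w, and the factor 2 - w of P_1\<close>

definition char_poly_in_w ::
  "nat \<Rightarrow> nat \<Rightarrow> nat \<Rightarrow> (nat \<Rightarrow> nat) \<Rightarrow> (nat \<Rightarrow> nat) \<Rightarrow> (nat \<Rightarrow> nat) \<Rightarrow> nat \<Rightarrow> complex poly" where
  "char_poly_in_w r t s \<alpha> \<beta> \<gamma> j =
    (of_nat s + [:2, -1:] * lap_quot r \<alpha> + (if j \<in> {2, 4} then 2 else 0)) *
    (of_nat s + [:2, -1:] * lap_quot t \<beta> + (if j \<in> {3, 4} then 2 else 0))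
    - (of_nat (s ^ 2) - [:2, -1:] * gam_quot s \<gamma>)"

lemma poly_char_poly_in_w:
  assumes z: "z \<noteq> 0"
  shows "poly (char_poly_in_w r t s \<alpha> \<beta> \<gamma> j) (z + inverse z) = leval (P_poly r t s \<alpha> \<beta> \<gamma> j) z"
  unfolding leval_P_poly[OF z] lap_value_eq_poly[OF z] gam_value_eq_poly[OF z] char_poly_in_w_def
  by simp

text \<open>Both products in P_1 equal s^2 up to a multiple of 2 - w. The s^2 cancels, and this is
  the cofactor of 2 - w.\<close>

definition tree_quot ::
  "nat \<Rightarrow> nat \<Rightarrow> nat \<Rightarrow> (nat \<Rightarrow> nat) \<Rightarrow> (nat \<Rightarrow> nat) \<Rightarrow> (nat \<Rightarrow> nat) \<Rightarrow> complex poly" where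
  "tree_quot r t s \<alpha> \<beta> \<gamma> = of_nat s * (lap_quot r \<alpha> + lap_quot t \<beta>) + gam_quot s \<gamma>
    + [:2, -1:] * lap_quot r \<alpha> * lap_quot t \<beta>"

lemma char_poly_in_w_1: "char_poly_in_w r t s \<alpha> \<beta> \<gamma> 1 = [:2, -1:] * tree_quot r t s \<alpha> \<beta> \<gamma>"
proof -
  have id: "(of_nat s + x * a) * (of_nat s + x * b) - (of_nat (s ^ 2) - x * c) =
    x * (of_nat s * (a + b) + c + x * a * b)" for x a b c :: "complex poly"
    by (simp add: algebra_simps power2_eq_square)
  have "1 \<notin> {2, 4 :: nat}" "1 \<notin> {3, 4 :: nat}" by simp_all
  then show ?thesis
    by (simp only: char_poly_in_w_def tree_quot_def if_False add_0_right id)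
qed

text \<open>The value at 2 is s times the sum of all squares of \<alpha> and \<beta> plus half the
  sum of the squared differences of \<gamma>. If it vanishes, every summand does, so r = t = 0 and
  \<open>gam_quot\<close> is 0; then the whole quotient is 0.\<close>

lemma tree_quot_2_nonzero:
  assumes nz: "tree_quot r t s \<alpha> \<beta> \<gamma> \<noteq> 0" and s: "s \<ge> 1"
    and \<alpha>: "\<forall>i\<in>{1..r}. 1 \<le> \<alpha> i" and \<beta>: "\<forall>i\<in>{1..t}. 1 \<le> \<beta> i"
  shows "poly (tree_quot r t s \<alpha> \<beta> \<gamma>) 2 \<noteq> 0"
proof
  assume z: "poly (tree_quot r t s \<alpha> \<beta> \<gamma>) 2 = 0"
  let ?A = "\<Sum>i=1..r. \<alpha> i ^ 2" and ?B = "\<Sum>i=1..t. \<beta> i ^ 2"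
    and ?C = "\<Sum>i=1..s. \<Sum>k=1..s. absdiff (\<gamma> i) (\<gamma> k) ^ 2"
  have "poly (tree_quot r t s \<alpha> \<beta> \<gamma>) 2 = of_nat s * (of_nat ?A + of_nat ?B) + of_nat ?C / 2"
    by (simp add: tree_quot_def lap_quot_def gam_quot_def poly_sum poly_dickson_quot_2)
  then have "of_nat (2 * s * (?A + ?B) + ?C) = (0 :: complex)" using z by (simp add: field_simps)
  then have "2 * s * (?A + ?B) + ?C = 0" by (simp only: of_nat_eq_0_iff)
  then have zero: "?A = 0" "?B = 0" "?C = 0" using s by auto
  have "r = 0"
  proof (rule ccontr)
    assume "r \<noteq> 0"
    then have "1 \<in> {1..r}" by simp
    with zero(1) \<alpha> show False by (metis finite_atLeastAtMost not_one_le_zero power_eq_0_iff sum_eq_0_iff)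
  qed
  moreover have "t = 0"
  proof (rule ccontr)
    assume "t \<noteq> 0"
    then have "1 \<in> {1..t}" by simp
    with zero(2) \<beta> show False by (metis finite_atLeastAtMost not_one_le_zero power_eq_0_iff sum_eq_0_iff)
  qed
  moreover have "gam_quot s \<gamma> = 0"
    using zero(3) by (simp add: gam_quot_def)
  ultimately show False using nz by (simp add: tree_quot_def lap_quot_def)
qed

text \<open>Both sides of the identity are compared along \<open>z \<rightarrow> \<infinity>\<close>.\<close>

lemma lead_coeff_eq_laurent_lead:
  assumes P: "P \<noteq> 0" and T: "\<And>z. z \<noteq> 0 \<Longrightarrow> poly T (z + inverse z) = leval P z"
  shows "lead_coeff T = of_int (laurent_lead P)" "T \<noteq> 0"
proof -
  define k where "k = laurent_degree P"
  define a :: complex where "a = of_int (laurent_lead P)"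
  define x :: "nat \<Rightarrow> complex" where "x n = of_nat (Suc n)" for n
  have x0: "x n \<noteq> 0" for n unfolding x_def by (simp only: of_nat_eq_0_iff)
  have keys: "Poly_Mapping.keys P \<noteq> {}" using P by simp
  then have kP: "k \<in> Poly_Mapping.keys P" unfolding k_def laurent_degree_def by simp
  then have a0: "a \<noteq> 0" by (simp add: a_def laurent_lead_def k_def in_keys_iff)
  have inv: "(\<lambda>n. inverse (x n)) \<longlonglongrightarrow> 0"
    unfolding x_def by (rule LIMSEQ_Suc) (rule lim_inverse_n)
  have neg: "(\<lambda>n. x n powi i) \<longlonglongrightarrow> 0" if "i < 0" for i
  proof -
    have "(\<lambda>n. inverse (x n) ^ nat (- i)) \<longlonglongrightarrow> 0 ^ nat (- i)"
      by (intro tendsto_power inv)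
    moreover have "inverse (x n) ^ nat (- i) = x n powi i" for n
      using that by (simp add: power_int_def)
    moreover have "(0 :: complex) ^ nat (- i) = 0" using that by simp
    ultimately show ?thesis by (simp only:)
  qed
  define f where "f n = leval P (x n) * x n powi (- k)" for n
  have f: "f \<longlonglongrightarrow> a"
  proof -
    have f_eq: "f n = (\<Sum>i\<in>Poly_Mapping.keys P. of_int (Poly_Mapping.lookup P i) * x n powi (i - k))" for n
      unfolding f_def leval_def sum_distrib_right
      using x0 by (intro sum.cong) (auto simp: power_int_diff power_int_minus field_simps)
    have "(\<lambda>n. \<Sum>i\<in>Poly_Mapping.keys P. of_int (Poly_Mapping.lookup P i) * x n powi (i - k))
        \<longlonglongrightarrow> (\<Sum>i\<in>Poly_Mapping.keys P. if i = k then a else 0)"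
    proof (rule tendsto_sum)
      fix i assume i: "i \<in> Poly_Mapping.keys P"
      show "(\<lambda>n. of_int (Poly_Mapping.lookup P i) * x n powi (i - k)) \<longlonglongrightarrow> (if i = k then a else 0)"
      proof (cases "i = k")
        case True
        then show ?thesis by (simp add: a_def laurent_lead_def k_def)
      next
        case False
        moreover have "i \<le> k" unfolding k_def laurent_degree_def by (rule Max_ge[OF finite_keys i])
        ultimately have "i - k < 0" by simp
        from tendsto_mult_right_zero[OF neg[OF this]] False show ?thesis by simp
      qed
    qed
    then show ?thesis unfolding ext[of f, OF f_eq] using kP by simp
  qed
  show T0: "T \<noteq> 0"
  proof
    assume "T = 0"
    then have "f = (\<lambda>_. 0)" using T[OF x0] by (simp add: f_def fun_eq_iff)
    with f a0 show False by (simp add: LIMSEQ_const_iff)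
  qed
  define d where "d = int (degree T)"
  define w where "w n = x n + inverse (x n)" for n
  define g where "g n = poly T (w n) * x n powi (- d)" for n
  have wx: "(\<lambda>n. w n * inverse (x n)) \<longlonglongrightarrow> 1"
  proof -
    have "(\<lambda>n. 1 + inverse (x n) * inverse (x n)) \<longlonglongrightarrow> 1 + 0 * 0"
      by (intro tendsto_intros inv)
    then show ?thesis using x0 by (simp add: w_def distrib_right)
  qed
  have g: "g \<longlonglongrightarrow> lead_coeff T"
  proof -
    have g_eq: "g n = (\<Sum>i\<le>degree T. coeff T i * ((w n * inverse (x n)) ^ i * inverse (x n) ^ (degree T - i)))" for n
    proof -
      have "g n = (\<Sum>i\<le>degree T. coeff T i * w n ^ i * x n powi (- d))"
        by (simp add: g_def poly_altdef sum_distrib_right)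
      also have "\<dots> = (\<Sum>i\<le>degree T. coeff T i * ((w n * inverse (x n)) ^ i * inverse (x n) ^ (degree T - i)))"
      proof (rule sum.cong)
        fix i assume "i \<in> {..degree T}"
        then have "x n powi (- d) = inverse (x n) ^ i * inverse (x n) ^ (degree T - i)"
          by (simp add: d_def power_int_minus flip: power_add power_inverse)
        then show "coeff T i * w n ^ i * x n powi (- d) =
          coeff T i * ((w n * inverse (x n)) ^ i * inverse (x n) ^ (degree T - i))"
          by (simp add: power_mult_distrib)
      qed simp
      finally show ?thesis .
    qed
    have "(\<lambda>n. \<Sum>i\<le>degree T. coeff T i * ((w n * inverse (x n)) ^ i * inverse (x n) ^ (degree T - i)))
        \<longlonglongrightarrow> (\<Sum>i\<le>degree T. coeff T i * (1 ^ i * 0 ^ (degree T - i)))"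
      by (intro tendsto_sum tendsto_mult tendsto_const tendsto_power wx inv)
    moreover have "(\<Sum>i\<le>degree T. coeff T i * (1 ^ i * 0 ^ (degree T - i))) =
        (\<Sum>i\<le>degree T. if i = degree T then coeff T i else 0)"
      by (rule sum.cong) (auto simp: power_0_left)
    ultimately show ?thesis unfolding ext[of g, OF g_eq] by simp
  qed
  have fg: "f n = g n * x n powi (d - k)" "g n = f n * x n powi (k - d)" for n
    using T[OF x0, of n] x0[of n] unfolding f_def g_def w_def
    by (simp_all add: power_int_diff power_int_minus field_simps)
  \<comment> \<open>\<open>f\<close> and \<open>g\<close> have nonzero limits and differ by a power
    of \<open>x n\<close>; unequal degrees would force one of the limits to be 0.\<close>
  have "d = k"
  proof (rule ccontr)
    assume "d \<noteq> k"
    then consider "d - k < 0" | "k - d < 0" by linarith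
    then show False
    proof cases
      case 1
      have "(\<lambda>n. g n * x n powi (d - k)) \<longlonglongrightarrow> lead_coeff T * 0"
        by (intro tendsto_mult g neg 1)
      then have "f \<longlonglongrightarrow> 0" unfolding fg(1)[symmetric] by simp
      with f a0 show False using LIMSEQ_unique by blast
    next
      case 2
      have "(\<lambda>n. f n * x n powi (k - d)) \<longlonglongrightarrow> a * 0"
        by (intro tendsto_mult f neg 2)
      then have "g \<longlonglongrightarrow> 0" unfolding fg(2)[symmetric] by simp
      with g T0 show False using LIMSEQ_unique leading_coeff_0_iff by blast
    qed
  qed
  then have "f = g" using fg(1) by (simp add: fun_eq_iff)
  with f g show "lead_coeff T = of_int (laurent_lead P)" using LIMSEQ_unique unfolding a_def by blast
qed

section \<open>Products over roots of unity\<close>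

lemma finite_nth_roots: "n > 0 \<Longrightarrow> u \<noteq> 0 \<Longrightarrow> finite {z :: complex. z ^ n = u}"
  by (metis card_nth_roots card_eq_0_iff less_not_refl)

text \<open>Both sides are monic of degree n in x and agree at the n roots.\<close>

lemma prod_diff_nth_roots:
  fixes u x :: complex
  assumes n: "n > 0" and u: "u \<noteq> 0"
  shows "(\<Prod>z | z ^ n = u. x - z) = x ^ n - u"
proof -
  define Z where "Z = {z. z ^ n = u}"
  have Z: "finite Z" "card Z = n"
    unfolding Z_def using finite_nth_roots[OF n u] card_nth_roots[OF u n] by auto
  define p where "p = (\<Prod>z\<in>Z. [:- z, 1:])"
  define q where "q = monom 1 n - [:u:]"
  have deg_p: "degree p = n"
    using Z by (simp add: p_def degree_prod_eq_sum_degree)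
  have lead_p: "lead_coeff p = 1"
    by (simp only: p_def lead_coeff_prod) simp
  have deg_q: "degree q = n"
    unfolding q_def using n by (subst diff_conv_add_uminus, subst degree_add_eq_left) (simp_all add: degree_monom_eq)
  have lead_q: "coeff q n = 1" using n by (cases n) (simp_all add: q_def)
  have "p = q"
  proof (rule poly_eqI_degree_lead_coeff[of p n q Z])
    show "poly p z = poly q z" if "z \<in> Z" for z
      using that Z(1) unfolding p_def poly_prod q_def by (auto simp: Z_def poly_monom intro!: prod_zero)
  qed (use deg_p deg_q lead_p lead_q Z in auto)
  then have "poly p x = poly q x" by simp
  then show ?thesis by (simp add: p_def q_def poly_prod poly_monom Z_def)
qed

lemma prod_inverse_nth_roots:
  fixes f :: "complex \<Rightarrow> complex"
  assumes "inverse u = u"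
  shows "(\<Prod>z | z ^ n = u. f (inverse z)) = (\<Prod>z | z ^ n = u. f z)"
proof (rule prod.reindex_bij_witness[of _ inverse inverse])
  fix z assume "z \<in> {z. z ^ n = u}"
  then show "inverse z \<in> {z. z ^ n = u}" "inverse z \<in> {z. z ^ n = u}"
    using assms by (simp_all add: power_inverse)
qed auto

text \<open>Each factor is -(1/\<zeta>) (\<zeta> - z) (\<zeta> - 1/z), and inversion permutes the
  roots since 1/u = u. The product is therefore (-1/\<zeta>)^n (\<zeta>^n - u)^2, which u^2 = 1
  simplifies.\<close>

lemma prod_shifted_nth_roots:
  fixes u \<zeta> :: complex
  assumes n: "n > 0" and u: "u ^ 2 = 1" and \<zeta>: "\<zeta> \<noteq> 0"
  shows "(\<Prod>z | z ^ n = u. z + inverse z - (\<zeta> + inverse \<zeta>)) =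
    (-1) ^ n * (\<zeta> ^ n + inverse \<zeta> ^ n - 2 * u)"
proof -
  let ?Z = "{z. z ^ n = u}"
  have u0: "u \<noteq> 0" using u by auto
  have uinv: "inverse u = u" using u u0 by (simp add: field_simps power2_eq_square)
  have card: "card ?Z = n" by (rule card_nth_roots[OF u0 n])
  have "(\<Prod>z\<in>?Z. z + inverse z - (\<zeta> + inverse \<zeta>)) =
      (\<Prod>z\<in>?Z. (- inverse \<zeta>) * (\<zeta> - z) * (\<zeta> - inverse z))"
  proof (rule prod.cong)
    fix z assume "z \<in> ?Z"
    then have "z \<noteq> 0" using u0 n by auto
    then show "z + inverse z - (\<zeta> + inverse \<zeta>) = (- inverse \<zeta>) * (\<zeta> - z) * (\<zeta> - inverse z)"
      using \<zeta> by (simp add: field_simps)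
  qed simp
  also have "\<dots> = (- inverse \<zeta>) ^ n * (\<Prod>z\<in>?Z. \<zeta> - z) * (\<Prod>z\<in>?Z. \<zeta> - inverse z)"
    by (simp only: prod.distrib prod_constant card)
  also have "(\<Prod>z\<in>?Z. \<zeta> - inverse z) = (\<Prod>z\<in>?Z. \<zeta> - z)"
    by (rule prod_inverse_nth_roots[OF uinv, of "\<lambda>z. \<zeta> - z"])
  also have "(- inverse \<zeta>) ^ n * (\<Prod>z\<in>?Z. \<zeta> - z) * (\<Prod>z\<in>?Z. \<zeta> - z) =
      (-1) ^ n * (\<zeta> ^ n + inverse \<zeta> ^ n - 2 * u)"
  proof -
    have m: "(- inverse \<zeta>) ^ n = (-1) ^ n * inverse (\<zeta> ^ n)"
      by (subst power_minus) (simp add: power_inverse)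
    have "inverse y * (y - u) * (y - u) = y + inverse y - 2 * u" if "y \<noteq> 0" for y
      using that u by (simp add: field_simps power2_eq_square)
    from this[of "\<zeta> ^ n"] show ?thesis
      unfolding prod_diff_nth_roots[OF n u0] m using \<zeta> by (simp add: power_inverse mult.assoc)
  qed
  finally show ?thesis .
qed

text \<open>\<zeta> solves \<zeta>^2 - c \<zeta> + 1 = 0, whose roots have product 1.\<close>

lemma joukowsky_surj: "\<exists>\<zeta> :: complex. \<zeta> \<noteq> 0 \<and> \<zeta> + inverse \<zeta> = c"
proof -
  define d where "d = csqrt (c ^ 2 - 4)"
  define \<zeta> where "\<zeta> = (c + d) / 2"
  have "d ^ 2 = c ^ 2 - 4" by (simp add: d_def)
  then have prod: "\<zeta> * (c - \<zeta>) = 1"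
    by (simp add: \<zeta>_def field_simps power2_eq_square)
  then have "\<zeta> \<noteq> 0" by auto
  moreover from this prod have "inverse \<zeta> = c - \<zeta>" by (simp add: field_simps)
  ultimately show ?thesis by (intro exI[of _ \<zeta>]) simp
qed

text \<open>Constants and the sign (-1)^n are the basis sequences with x = 1 and x = -1. Pairing x
  with its inverse is the source of the inversion symmetry of the generating function.\<close>

inductive sym_exp_sum :: "(nat \<Rightarrow> complex) \<Rightarrow> bool" where
  basis: "x \<noteq> 0 \<Longrightarrow> sym_exp_sum (\<lambda>n. c * (x ^ n + inverse x ^ n))"
| add: "sym_exp_sum f \<Longrightarrow> sym_exp_sum g \<Longrightarrow> sym_exp_sum (\<lambda>n. f n + g n)"

lemma sym_exp_sum_const: "sym_exp_sum (\<lambda>n. c)"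
  using sym_exp_sum.basis[of 1 "c / 2"] by simp

lemma sym_exp_sum_minus_one: "sym_exp_sum (\<lambda>n. (-1) ^ n)"
proof -
  have "(1 / 2 :: complex) * ((-1) ^ n + inverse (-1) ^ n) = (-1) ^ n" for n by simp
  moreover have "sym_exp_sum (\<lambda>n. (1 / 2) * ((-1) ^ n + inverse (-1) ^ n))"
    by (rule sym_exp_sum.basis) simp
  ultimately show ?thesis by (simp only:)
qed

text \<open>The product of basis sequences for x and y is the sum of those for x y and x /
  y.\<close>

lemma sym_exp_sum_mult:
  assumes "sym_exp_sum f" "sym_exp_sum g"
  shows "sym_exp_sum (\<lambda>n. f n * g n)"
  using assms(1)
proof (induction rule: sym_exp_sum.induct)
  case (basis x c)
  from assms(2) show ?case
  proof (induction rule: sym_exp_sum.induct)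
    case (basis y d)
    have "sym_exp_sum (\<lambda>n. (c * d) * ((x * y) ^ n + inverse (x * y) ^ n) +
        (c * d) * ((x * inverse y) ^ n + inverse (x * inverse y) ^ n))"
      using basis \<open>x \<noteq> 0\<close> by (intro sym_exp_sum.intros) simp_all
    moreover have "(c * d) * ((x * y) ^ n + inverse (x * y) ^ n) +
        (c * d) * ((x * inverse y) ^ n + inverse (x * inverse y) ^ n) =
      c * (x ^ n + inverse x ^ n) * (d * (y ^ n + inverse y ^ n))" for n
      by (simp add: power_mult_distrib algebra_simps)
    ultimately show ?case by (simp only:)
  next
    case (add f g)
    from sym_exp_sum.add[OF add.IH] show ?case by (simp add: distrib_left)
  qed
next
  case (add f g)
  from sym_exp_sum.add[OF add.IH] show ?case by (simp add: distrib_right)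
qed

lemma sym_exp_sum_prod:
  assumes "\<And>i. i \<in> A \<Longrightarrow> sym_exp_sum (f i)"
  shows "sym_exp_sum (\<lambda>n. \<Prod>i\<in>A. f i n)"
  using assms
proof (induction A rule: infinite_finite_induct)
  case (insert i A)
  then show ?case by (simp add: sym_exp_sum_mult)
qed (simp_all add: sym_exp_sum_const)

text \<open>\<open>R\<close> splits into linear factors, and each root is written as \<zeta> +
  1/\<zeta>. Exchanging the products over roots of \<open>R\<close> and roots of \<open>u\<close>
  leaves, for each of the former, one symmetric sequence in n, so a single \<open>f\<close> serves
  all n.\<close>

lemma prod_poly_nth_roots:
  fixes R :: "complex poly"
  assumes u: "u ^ 2 = 1"
  shows "\<exists>f. sym_exp_sum f \<and> (\<forall>n>0. (\<Prod>z | z ^ n = u. poly R (z + inverse z)) = lead_coeff R ^ n * f n)"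
proof -
  obtain w where w: "Polynomial.smult (lead_coeff R) (\<Prod>i<degree R. [:- w i, 1:]) = R"
    by (rule complex_poly_decompose')
  have "\<forall>i. \<exists>\<zeta>. \<zeta> \<noteq> 0 \<and> \<zeta> + inverse \<zeta> = w i" using joukowsky_surj by blast
  then obtain \<zeta> where \<zeta>: "\<And>i. \<zeta> i \<noteq> 0" "\<And>i. \<zeta> i + inverse (\<zeta> i) = w i" by metis
  define f where "f n = (\<Prod>i<degree R. (-1) ^ n * (1 * (\<zeta> i ^ n + inverse (\<zeta> i) ^ n) + - 2 * u))" for n
  have "sym_exp_sum f"
    unfolding f_def
    by (intro sym_exp_sum_prod sym_exp_sum_mult sym_exp_sum_minus_one sym_exp_sum.intros \<zeta> sym_exp_sum_const)
  moreover have "(\<Prod>z | z ^ n = u. poly R (z + inverse z)) = lead_coeff R ^ n * f n" if n: "n > 0" for n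
  proof -
    have u0: "u \<noteq> 0" using u by auto
    have "poly R x = lead_coeff R * (\<Prod>i<degree R. x - w i)" for x
      by (subst w[symmetric]) (simp add: poly_prod)
    then have "(\<Prod>z | z ^ n = u. poly R (z + inverse z)) =
        (\<Prod>z | z ^ n = u. lead_coeff R * (\<Prod>i<degree R. z + inverse z - w i))"
      by simp
    also have "\<dots> = lead_coeff R ^ n * (\<Prod>z | z ^ n = u. \<Prod>i<degree R. z + inverse z - w i)"
      by (simp add: prod.distrib card_nth_roots[OF u0 n])
    also have "(\<Prod>z | z ^ n = u. \<Prod>i<degree R. z + inverse z - w i) =
        (\<Prod>i<degree R. \<Prod>z | z ^ n = u. z + inverse z - (\<zeta> i + inverse (\<zeta> i)))"
      unfolding \<zeta>(2) by (rule prod.swap)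
    also have "\<dots> = f n"
      unfolding prod_shifted_nth_roots[OF n u \<zeta>(1)] f_def by simp
    finally show ?thesis .
  qed
  ultimately show ?thesis by blast
qed

text \<open>Cancelling X - 1 in X^n - 1 leaves 1 + X + ... + X^(n-1), whose value at 1 is n.\<close>

lemma prod_one_minus_roots_unity:
  assumes n: "n > 0"
  shows "(\<Prod>z\<in>{z. z ^ n = 1} - {1}. 1 - z) = (of_nat n :: complex)"
proof -
  let ?Z = "{z :: complex. z ^ n = 1}"
  have fin: "finite ?Z" by (rule finite_nth_roots[OF n]) simp
  define p :: "complex poly" where "p = (\<Prod>z\<in>?Z - {1}. [:- z, 1:])"
  define q :: "complex poly" where "q = (\<Sum>i<n. monom 1 i)"
  have "poly ([:-1, 1:] * p) x = poly ([:-1, 1:] * q) x" for x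
  proof -
    have "poly ([:-1, 1:] * p) x = (\<Prod>z\<in>?Z. x - z)"
      unfolding p_def poly_mult poly_prod using fin by (subst prod.remove[of _ 1]) simp_all
    also have "\<dots> = x ^ n - 1" by (rule prod_diff_nth_roots[OF n]) simp
    also have "\<dots> = poly ([:-1, 1:] * q) x"
      by (simp add: q_def poly_sum poly_monom power_diff_1_eq left_diff_distrib)
    finally show ?thesis .
  qed
  then have "[:-1, 1:] * p = [:-1, 1:] * q" using poly_eq_poly_eq_iff by blast
  then have "p = q" by (simp only: mult_cancel_left) simp
  then have "poly p 1 = poly q 1" by simp
  then show ?thesis by (simp add: p_def q_def poly_prod poly_sum poly_monom)
qed

text \<open>2 - z - 1/z = (1 - z) (1 - 1/z), and inversion permutes the nontrivial roots.\<close>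

lemma prod_two_minus_roots_unity:
  assumes n: "n > 0"
  shows "(\<Prod>z\<in>{z. z ^ n = 1} - {1}. 2 - (z + inverse z)) = (of_nat n ^ 2 :: complex)"
proof -
  let ?Z = "{z :: complex. z ^ n = 1} - {1}"
  have "(\<Prod>z\<in>?Z. 2 - (z + inverse z)) = (\<Prod>z\<in>?Z. (1 - z) * (1 - inverse z))"
  proof (rule prod.cong)
    fix z assume "z \<in> ?Z"
    then have "z \<noteq> 0" using n by (auto simp: power_0_left)
    then show "2 - (z + inverse z) = (1 - z) * (1 - inverse z)" by (simp add: field_simps)
  qed simp
  also have "\<dots> = (\<Prod>z\<in>?Z. 1 - z) * (\<Prod>z\<in>?Z. 1 - inverse z)" by (rule prod.distrib)
  also have "(\<Prod>z\<in>?Z. 1 - inverse z) = (\<Prod>z\<in>?Z. 1 - z)"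
    by (rule prod.reindex_bij_witness[of _ inverse inverse]) (auto simp: power_inverse)
  finally show ?thesis by (simp add: prod_one_minus_roots_unity[OF n] power2_eq_square)
qed

lemma prod_unit_roots:
  assumes N: "N > 0"
  shows "(\<Prod>m\<in>{1..<N}. g (unit_root N m)) = (\<Prod>z\<in>{z. z ^ N = 1} - {1}. g z)"
proof -
  note bij = bij_betw_unit_root[OF N]
  have "unit_root N 0 = 1" by (simp add: unit_root_def)
  moreover have "{1..<N} = {..<N} - {0}" by auto
  moreover have "unit_root N ` ({..<N} - {0}) = unit_root N ` {..<N} - unit_root N ` {0}"
    using bij N by (intro inj_on_image_set_diff[of _ "{..<N}"]) (auto simp: bij_betw_def)
  ultimately have "bij_betw (unit_root N) {1..<N} ({z. z ^ N = 1} - {1})"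
    using bij by (auto simp: bij_betw_def intro: inj_on_subset)
  then show ?thesis by (rule prod.reindex_bij_betw)
qed

text \<open>The n-th powers of the leading coefficients of P_1 and, for j > 1, of P_j split off from
  the two root products; this is the origin of \<open>ell\<close>.\<close>

theorem tree_count_formula:
  fixes r t s :: nat and \<alpha> \<beta> \<gamma> :: "nat \<Rightarrow> nat"
  assumes s: "1 \<le> s" and \<alpha>: "\<forall>i\<in>{1..r}. 1 \<le> \<alpha> i" and \<beta>: "\<forall>i\<in>{1..t}. 1 \<le> \<beta> i"
    and P: "\<And>i. i \<in> {1, 2, 3, 4} \<Longrightarrow> P_poly r t s \<alpha> \<beta> \<gamma> i \<noteq> 0" and j: "j \<in> {1, 2, 3, 4}"
  shows "\<exists>f. sym_exp_sum f \<and> (\<forall>n>0. of_nat (\<tau> (bicirculant r t s \<alpha> \<beta> \<gamma> j (group_order j n))) =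
    of_nat n * of_int (ell r t s \<alpha> \<beta> \<gamma> j) ^ n * f n)" and "ell r t s \<alpha> \<beta> \<gamma> j \<noteq> 0"
proof -
  let ?T = "char_poly_in_w r t s \<alpha> \<beta> \<gamma>" and ?R = "tree_quot r t s \<alpha> \<beta> \<gamma>"
  let ?l = "\<lambda>i. laurent_lead (P_poly r t s \<alpha> \<beta> \<gamma> i)"
  have T: "lead_coeff (?T i) = of_int (?l i)" "?T i \<noteq> 0" if "i \<in> {1, 2, 3, 4}" for i
    using lead_coeff_eq_laurent_lead[OF P[OF that] poly_char_poly_in_w] by auto
  have one: "1 \<in> {1, 2, 3, 4 :: nat}" by simp
  have l0: "?l i \<noteq> 0" if "i \<in> {1, 2, 3, 4}" for i
    using T[OF that] by auto
  show "ell r t s \<alpha> \<beta> \<gamma> j \<noteq> 0" unfolding ell_def using l0[OF one] l0[OF j] by simp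
  have R0: "?R \<noteq> 0" using T(2)[OF one] unfolding char_poly_in_w_1 by auto
  have R2: "poly ?R 2 \<noteq> 0" by (rule tree_quot_2_nonzero[OF R0 s \<alpha> \<beta>])
  \<comment> \<open>The sign is the leading coefficient -1 of 2 - w; it is compensated by the factor
    \<open>(-1) ^ n\<close> in \<open>P1\<close>.\<close>
  have leadR: "lead_coeff ?R = - of_int (?l 1)"
  proof -
    have "lead_coeff ([:2, -1:] * ?R) = - lead_coeff ?R" by (simp only: lead_coeff_mult) simp
    then have "- lead_coeff ?R = of_int (?l 1)" using T(1)[OF one] unfolding char_poly_in_w_1 by (rule subst)
    then show ?thesis by (metis minus_minus)
  qed
  obtain f where f: "sym_exp_sum f"
    "\<And>n. n > 0 \<Longrightarrow> (\<Prod>z | z ^ n = 1. poly ?R (z + inverse z)) = lead_coeff ?R ^ n * f n"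
    using prod_poly_nth_roots[of 1 ?R] by auto
  have P1: "(\<Prod>z\<in>{z. z ^ n = 1} - {1}. leval (P_poly r t s \<alpha> \<beta> \<gamma> 1) z) =
      of_nat n ^ 2 * of_int (?l 1) ^ n * (inverse (poly ?R 2) * ((-1) ^ n * f n))" if n: "n > 0" for n
  proof -
    let ?Z = "{z :: complex. z ^ n = 1}"
    have fin: "finite ?Z" by (rule finite_nth_roots[OF n]) simp
    have "(\<Prod>z\<in>?Z - {1}. leval (P_poly r t s \<alpha> \<beta> \<gamma> 1) z) =
        (\<Prod>z\<in>?Z - {1}. (2 - (z + inverse z)) * poly ?R (z + inverse z))"
    proof (rule prod.cong)
      fix z assume "z \<in> ?Z - {1}"
      then have "z \<noteq> 0" using n by (auto simp: power_0_left)
      then show "leval (P_poly r t s \<alpha> \<beta> \<gamma> 1) z = (2 - (z + inverse z)) * poly ?R (z + inverse z)"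
        unfolding poly_char_poly_in_w[symmetric, OF \<open>z \<noteq> 0\<close>] char_poly_in_w_1 poly_mult by simp
    qed simp
    also have "\<dots> = of_nat n ^ 2 * (\<Prod>z\<in>?Z - {1}. poly ?R (z + inverse z))"
      by (simp add: prod.distrib prod_two_minus_roots_unity[OF n])
    \<comment> \<open>\<open>f\<close> describes the product over all n-th roots of unity; the
      surplus factor belongs to z = 1, that is, w = 2.\<close>
    also have "(\<Prod>z\<in>?Z - {1}. poly ?R (z + inverse z)) = inverse (poly ?R 2) * (\<Prod>z\<in>?Z. poly ?R (z + inverse z))"
      using R2 fin by (subst prod.remove[of ?Z 1]) simp_all
    also have "(\<Prod>z\<in>?Z. poly ?R (z + inverse z)) = of_int (?l 1) ^ n * ((-1) ^ n * f n)"
      unfolding f(2)[OF n] leadR by (subst power_minus) simp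
    finally show ?thesis by (simp only: mult_ac)
  qed
  show "\<exists>f. sym_exp_sum f \<and> (\<forall>n>0. of_nat (\<tau> (bicirculant r t s \<alpha> \<beta> \<gamma> j (group_order j n))) =
    of_nat n * of_int (ell r t s \<alpha> \<beta> \<gamma> j) ^ n * f n)"
  proof (cases "j = 1")
    case True
    define h where "h n = of_nat s * inverse (poly ?R 2) * ((-1) ^ n * f n)" for n
    have "sym_exp_sum h"
      unfolding h_def by (intro sym_exp_sum_mult sym_exp_sum_const sym_exp_sum_minus_one f)
    moreover have "of_nat (\<tau> (bicirculant r t s \<alpha> \<beta> \<gamma> j (group_order j n))) =
      of_nat n * of_int (ell r t s \<alpha> \<beta> \<gamma> j) ^ n * h n" if n: "n > 0" for n
    proof -
      define W where "W z = (lap_value r s \<alpha> z + diam_value (j \<in> {2, 4}) n z) *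
        (lap_value t s \<beta> z + diam_value (j \<in> {3, 4}) n z) -
        gam_value s \<gamma> z * gam_value s \<gamma> (inverse z)" for z
      have "of_nat (n * \<tau> (bicirculant r t s \<alpha> \<beta> \<gamma> j n)) =
          of_nat s * (\<Prod>m\<in>{1..<n}. W (unit_root n m))"
        unfolding W_def by (rule tree_count_product[OF n disjI1[OF True] j])
      also have "(\<Prod>m\<in>{1..<n}. W (unit_root n m)) = (\<Prod>z\<in>{z. z ^ n = 1} - {1}. W z)"
        by (rule prod_unit_roots[OF n])
      also have "\<dots> = (\<Prod>z\<in>{z. z ^ n = 1} - {1}. leval (P_poly r t s \<alpha> \<beta> \<gamma> 1) z)"
      proof (rule prod.cong)
        fix z :: complex assume "z \<in> {z. z ^ n = 1} - {1}"
        then have "z \<noteq> 0" using n by (auto simp: power_0_left)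
        then show "W z = leval (P_poly r t s \<alpha> \<beta> \<gamma> 1) z"
          using True by (simp add: leval_P_poly diam_value_def W_def)
      qed simp
      finally have "of_nat (n * \<tau> (bicirculant r t s \<alpha> \<beta> \<gamma> j n)) =
          of_nat s * (\<Prod>z\<in>{z. z ^ n = 1} - {1}. leval (P_poly r t s \<alpha> \<beta> \<gamma> 1) z)" .
      then have "of_nat n * of_nat (\<tau> (bicirculant r t s \<alpha> \<beta> \<gamma> j n)) =
          of_nat n * (of_nat n * of_int (?l 1) ^ n * h n)"
        unfolding P1[OF n] h_def by (simp only: of_nat_mult power2_eq_square mult_ac)
      then show ?thesis using n True by (simp add: group_order_def ell_def)
    qed
    ultimately show ?thesis by blast
  next
    case False
    obtain f' where f': "sym_exp_sum f'"
      "\<And>n. n > 0 \<Longrightarrow> (\<Prod>z | z ^ n = -1. poly (?T j) (z + inverse z)) = lead_coeff (?T j) ^ n * f' n"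
      using prod_poly_nth_roots[of "-1" "?T j"] by auto
    \<comment> \<open>The 1/2 cancels the 2 in the group order 2 n.\<close>
    define h where "h n = of_nat s / 2 * inverse (poly ?R 2) * ((-1) ^ n * f n) * f' n" for n
    have "sym_exp_sum h"
      unfolding h_def by (intro sym_exp_sum_mult sym_exp_sum_const sym_exp_sum_minus_one f f')
    moreover have "of_nat (\<tau> (bicirculant r t s \<alpha> \<beta> \<gamma> j (group_order j n))) =
      of_nat n * of_int (ell r t s \<alpha> \<beta> \<gamma> j) ^ n * h n" if n: "n > 0" for n
    proof -
      define W where "W z = (lap_value r s \<alpha> z + diam_value (j \<in> {2, 4}) (2 * n) z) *
        (lap_value t s \<beta> z + diam_value (j \<in> {3, 4}) (2 * n) z) -
        gam_value s \<gamma> z * gam_value s \<gamma> (inverse z)" for z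
      let ?Z = "{z :: complex. z ^ n = 1} - {1}" and ?Y = "{z :: complex. z ^ n = -1}"
      have N: "2 * n > 0" "j = 1 \<or> even (2 * n)" using n by simp_all
      \<comment> \<open>On \<open>?Z\<close> the diametral values vanish and the factor is P_1; on
        \<open>?Y\<close> each one present is 2 and the factor is P_j.\<close>
      have split: "{z :: complex. z ^ (2 * n) = 1} - {1} = ?Z \<union> ?Y"
      proof -
        have "z ^ (2 * n) = 1 \<longleftrightarrow> z ^ n = 1 \<or> z ^ n = -1" for z :: complex
          by (simp only: mult.commute[of 2 n] power_mult power2_eq_1_iff)
        then show ?thesis using n by auto
      qed
      have "(\<Prod>z\<in>{z. z ^ (2 * n) = 1} - {1}. W z) = (\<Prod>z\<in>?Z. W z) * (\<Prod>z\<in>?Y. W z)"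
        unfolding split using finite_nth_roots[OF n, of 1] finite_nth_roots[OF n, of "-1"]
        by (intro prod.union_disjoint) auto
      also have "(\<Prod>z\<in>?Z. W z) = (\<Prod>z\<in>?Z. leval (P_poly r t s \<alpha> \<beta> \<gamma> 1) z)"
      proof (rule prod.cong)
        fix z assume z: "z \<in> ?Z"
        then have "z \<noteq> 0" using n by (auto simp: power_0_left)
        then show "W z = leval (P_poly r t s \<alpha> \<beta> \<gamma> 1) z"
          using z by (simp add: leval_P_poly diam_value_def W_def)
      qed simp
      also have "(\<Prod>z\<in>?Y. W z) = (\<Prod>z\<in>?Y. poly (?T j) (z + inverse z))"
      proof (rule prod.cong)
        fix z assume z: "z \<in> ?Y"
        then have "z \<noteq> 0" using n by (auto simp: power_0_left)
        then show "W z = poly (?T j) (z + inverse z)"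
          unfolding poly_char_poly_in_w[OF \<open>z \<noteq> 0\<close>] using z
          by (simp add: leval_P_poly diam_value_def W_def)
      qed simp
      finally have prod_W: "(\<Prod>z\<in>{z. z ^ (2 * n) = 1} - {1}. W z) =
        of_nat n ^ 2 * of_int (?l 1) ^ n * (inverse (poly ?R 2) * ((-1) ^ n * f n)) *
        (of_int (?l j) ^ n * f' n)"
        unfolding P1[OF n] f'(2)[OF n] T(1)[OF j] .
      have "of_nat (2 * n * \<tau> (bicirculant r t s \<alpha> \<beta> \<gamma> j (2 * n))) =
          of_nat s * (\<Prod>m\<in>{1..<2 * n}. W (unit_root (2 * n) m))"
        unfolding W_def by (rule tree_count_product[OF N j])
      then have "of_nat (2 * n) * of_nat (\<tau> (bicirculant r t s \<alpha> \<beta> \<gamma> j (2 * n))) =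
          of_nat (2 * n) * (of_nat n * (of_int (?l 1) * of_int (?l j)) ^ n * h n)"
        unfolding prod_unit_roots[OF N(1), of W] prod_W h_def by (simp add: power2_eq_square power_mult_distrib mult_ac)
      then show ?thesis using n False by (simp add: group_order_def ell_def)
    qed
    ultimately show ?thesis by blast
  qed
qed

section \<open>Generating functions\<close>

lemma linear_fps_mult_nth:
  fixes x :: "'a :: comm_ring_1"
  shows "(fps_of_poly [:1, - x:] * F) $ n = F $ n - (if n = 0 then 0 else x * F $ (n - 1))"
proof -
  have "fps_of_poly [:1, - x:] = 1 - fps_const x * fps_X"
    by (simp add: fps_of_poly_pCons)
  then have eq: "fps_of_poly [:1, - x:] * F = F - fps_const x * (fps_X * F)"
    by (simp only: left_diff_distrib mult.assoc mult_1_left)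
  show ?thesis unfolding eq by simp
qed

text \<open>Multiplying by 1 - x X telescopes n x^n to x^n for n > 0; a second multiplication leaves
  only x X.\<close>

lemma fps_geometric_deriv:
  fixes x :: complex
  shows "fps_of_poly ([:1, - x:] ^ 2) * Abs_fps (\<lambda>n. of_nat n * x ^ n) = fps_of_poly [:0, x:]"
proof -
  have "fps_of_poly [:1, - x:] * Abs_fps (\<lambda>n. of_nat n * x ^ n) = Abs_fps (\<lambda>n. if n = 0 then 0 else x ^ n)"
  proof (rule fps_ext)
    fix n show "(fps_of_poly [:1, - x:] * Abs_fps (\<lambda>n. of_nat n * x ^ n)) $ n =
      Abs_fps (\<lambda>n. if n = 0 then 0 else x ^ n) $ n"
      unfolding linear_fps_mult_nth by (cases n) (simp_all add: algebra_simps)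
  qed
  moreover have "fps_of_poly [:1, - x:] * Abs_fps (\<lambda>n. if n = 0 then 0 else x ^ n) = fps_of_poly [:0, x:]"
  proof (rule fps_ext)
    fix n show "(fps_of_poly [:1, - x:] * Abs_fps (\<lambda>n. if n = 0 then 0 else x ^ n)) $ n =
      fps_of_poly [:0, x:] $ n"
      unfolding linear_fps_mult_nth by (cases n; cases "n - 1") (simp_all add: coeff_pCons)
  qed
  ultimately show ?thesis by (simp only: power2_eq_square fps_of_poly_mult mult.assoc)
qed

text \<open>For a basis sequence, numerator and denominator are palindromic about the same exponent
  2. The symmetry is stated in cross-multiplied form, which is preserved when two fractions are
  brought to a common denominator and added.\<close>

lemma sym_exp_sum_generating_function:
  assumes "sym_exp_sum f"
  shows "\<exists>p q. q \<noteq> 0 \<and> fps_of_poly q * Abs_fps (\<lambda>n. of_nat n * f n) = fps_of_poly p \<and>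
    (\<forall>x. x \<noteq> 0 \<longrightarrow> poly p x * poly q (inverse x) = poly p (inverse x) * poly q x)"
  using assms
proof (induction rule: sym_exp_sum.induct)
  case (basis x c)
  define y where "y = inverse x"
  have xy: "x * y = 1" "y * x = 1" using basis by (simp_all add: y_def)
  define a where "a = x + y"
  \<comment> \<open>The numerator of c x X / (1 - x X)^2 + c y X / (1 - y X)^2; x y = 1 collapses
    its coefficients.\<close>
  define p where "p = [:0, c * a, - 4 * c, c * a:]"
  define q where "q = [:1, - a, 1:] ^ 2"
  have q: "q = [:1, - x:] ^ 2 * [:1, - y:] ^ 2"
    unfolding q_def power_mult_distrib[symmetric] using xy by (simp add: a_def)
  have p: "p = [:c:] * ([:1, - y:] ^ 2 * [:0, x:] + [:1, - x:] ^ 2 * [:0, y:])"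
  proof -
    have sq: "[:1, - v:] ^ 2 * [:0, u:] = [:0, u, - 2 * (v * u), v * (v * u):]" for u v :: complex
      by (simp add: power2_eq_square)
    show ?thesis unfolding sq xy by (simp add: p_def a_def)
  qed
  have "Abs_fps (\<lambda>n. of_nat n * (c * (x ^ n + inverse x ^ n))) =
      fps_of_poly [:c:] * (Abs_fps (\<lambda>n. of_nat n * x ^ n) + Abs_fps (\<lambda>n. of_nat n * y ^ n))"
    by (rule fps_ext) (simp add: y_def fps_of_poly_const algebra_simps)
  then have "fps_of_poly q * Abs_fps (\<lambda>n. of_nat n * (c * (x ^ n + inverse x ^ n))) =
      fps_of_poly [:c:] * (fps_of_poly ([:1, - y:] ^ 2) * (fps_of_poly ([:1, - x:] ^ 2) * Abs_fps (\<lambda>n. of_nat n * x ^ n)) +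
      fps_of_poly ([:1, - x:] ^ 2) * (fps_of_poly ([:1, - y:] ^ 2) * Abs_fps (\<lambda>n. of_nat n * y ^ n)))"
    unfolding q fps_of_poly_mult by (simp only: distrib_left mult_ac)
  also have "\<dots> = fps_of_poly p"
    unfolding fps_geometric_deriv p by (simp only: fps_of_poly_mult fps_of_poly_add)
  finally have fps: "fps_of_poly q * Abs_fps (\<lambda>n. of_nat n * (c * (x ^ n + inverse x ^ n))) = fps_of_poly p" .
  have "poly p u * poly q (inverse u) = poly p (inverse u) * poly q u" if u: "u \<noteq> 0" for u
  proof -
    define v where "v = inverse u"
    have uv: "u * v = 1" using u by (simp add: v_def)
    \<comment> \<open>p(u) = u^2 b and q(u) = (u e)^2, where b and e are symmetric in u and v = 1/u;
      so both cross products equal (u v)^2 b e^2.\<close>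
    define b where "b = c * (a * (u + v) - 4)"
    define e where "e = u + v - a"
    have "poly p u = u ^ 2 * b"
    proof -
      have "u ^ 2 * b = c * a * u ^ 3 + c * a * u * (u * v) - 4 * c * u ^ 2"
        by (simp add: b_def power2_eq_square power3_eq_cube algebra_simps)
      then show ?thesis unfolding uv by (simp add: p_def power2_eq_square power3_eq_cube algebra_simps)
    qed
    moreover have "poly p v = v ^ 2 * b"
    proof -
      have "v ^ 2 * b = c * a * v ^ 3 + c * a * v * (u * v) - 4 * c * v ^ 2"
        by (simp add: b_def power2_eq_square power3_eq_cube algebra_simps)
      then show ?thesis unfolding uv by (simp add: p_def power2_eq_square power3_eq_cube algebra_simps)
    qed
    moreover have "poly q u = (u * e) ^ 2"
    proof -
      have "u * e = u ^ 2 + u * v - a * u" by (simp add: e_def power2_eq_square algebra_simps)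
      also have "\<dots> = poly [:1, - a, 1:] u" unfolding uv by (simp add: power2_eq_square algebra_simps)
      finally show ?thesis by (simp only: q_def poly_power)
    qed
    moreover have "poly q v = (v * e) ^ 2"
    proof -
      have "v * e = v ^ 2 + u * v - a * v" by (simp add: e_def power2_eq_square algebra_simps)
      also have "\<dots> = poly [:1, - a, 1:] v" unfolding uv by (simp add: power2_eq_square algebra_simps)
      finally show ?thesis by (simp only: q_def poly_power)
    qed
    ultimately show ?thesis by (simp add: v_def[symmetric] power_mult_distrib)
  qed
  moreover have "q \<noteq> 0" by (simp add: q_def)
  ultimately show ?case using fps by blast
next
  case (add f g)
  from add.IH(1) obtain p q where pq: "q \<noteq> 0" "fps_of_poly q * Abs_fps (\<lambda>n. of_nat n * f n) = fps_of_poly p"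
    "\<And>x. x \<noteq> 0 \<Longrightarrow> poly p x * poly q (inverse x) = poly p (inverse x) * poly q x" by blast
  from add.IH(2) obtain p' q' where pq': "q' \<noteq> 0" "fps_of_poly q' * Abs_fps (\<lambda>n. of_nat n * g n) = fps_of_poly p'"
    "\<And>x. x \<noteq> 0 \<Longrightarrow> poly p' x * poly q' (inverse x) = poly p' (inverse x) * poly q' x" by blast
  let ?F = "Abs_fps (\<lambda>n. of_nat n * f n)" and ?G = "Abs_fps (\<lambda>n. of_nat n * g n)"
  have "Abs_fps (\<lambda>n. of_nat n * (f n + g n)) = ?F + ?G"
    by (rule fps_ext) (simp add: distrib_left)
  then have "fps_of_poly (q * q') * Abs_fps (\<lambda>n. of_nat n * (f n + g n)) =
      fps_of_poly q' * (fps_of_poly q * ?F) + fps_of_poly q * (fps_of_poly q' * ?G)"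
    by (simp only: fps_of_poly_mult distrib_left mult_ac)
  also have "\<dots> = fps_of_poly (q' * p + q * p')"
    unfolding pq(2) pq'(2) by (simp only: fps_of_poly_mult fps_of_poly_add)
  finally have fps: "fps_of_poly (q * q') * Abs_fps (\<lambda>n. of_nat n * (f n + g n)) = fps_of_poly (q' * p + q * p')" .
  have "poly (q' * p + q * p') x * poly (q * q') (inverse x) =
      poly (q' * p + q * p') (inverse x) * poly (q * q') x" if x: "x \<noteq> 0" for x
  proof -
    let ?y = "inverse x"
    have "poly (q' * p + q * p') x * poly (q * q') ?y =
        (poly p x * poly q ?y) * (poly q' x * poly q' ?y) + (poly p' x * poly q' ?y) * (poly q x * poly q ?y)"
      by (simp add: algebra_simps)
    also have "\<dots> = (poly p ?y * poly q x) * (poly q' x * poly q' ?y) + (poly p' ?y * poly q' x) * (poly q x * poly q ?y)"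
      by (simp only: pq(3)[OF x] pq'(3)[OF x])
    also have "\<dots> = poly (q' * p + q * p') ?y * poly (q * q') x"
      by (simp add: algebra_simps)
    finally show ?thesis .
  qed
  with fps pq(1) pq'(1) show ?case by (intro exI[of _ "q' * p + q * p'"] exI[of _ "q * q'"]) simp
qed

section \<open>Descent from complex to integer coefficients\<close>

lemma ex_rational_functional:
  assumes "c \<noteq> 0"
  shows "\<exists>\<phi> :: complex \<Rightarrow> rat. \<phi> c \<noteq> 0 \<and> (\<forall>x y. \<phi> (x + y) = \<phi> x + \<phi> y) \<and>
    (\<forall>k x. \<phi> (of_int k * x) = of_int k * \<phi> x)"
proof -
  interpret vector_space_pair "\<lambda>(q :: rat) (x :: complex). of_rat q * x" "(*) :: rat \<Rightarrow> rat \<Rightarrow> rat"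
    by unfold_locales (simp_all add: distrib_left distrib_right of_rat_add of_rat_mult)
  \<comment> \<open>In the complex numbers as a rational vector space, c is part of a basis, so c ->
    1 extends linearly.\<close>
  have "vs1.independent {c}" using assms by simp
  from linear_independent_extend[OF this, of "\<lambda>_. 1"] obtain \<phi> where
    \<phi>: "Vector_Spaces.linear (\<lambda>(q :: rat) (x :: complex). of_rat q * x) ((*) :: rat \<Rightarrow> rat \<Rightarrow> rat) \<phi>" "\<phi> c = 1"
    by auto
  interpret \<phi>: Vector_Spaces.linear "\<lambda>(q :: rat) (x :: complex). of_rat q * x" "(*) :: rat \<Rightarrow> rat \<Rightarrow> rat" \<phi>
    by (rule \<phi>(1))
  have "\<phi> (of_int k * x) = of_int k * \<phi> x" for k x
    using \<phi>.scale[of "of_int k" x] by simp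
  then show ?thesis using \<phi>(2) \<phi>.add by (intro exI[of _ \<phi>]) simp
qed

lemma common_denominator:
  fixes f :: "'i \<Rightarrow> rat"
  assumes "finite A"
  shows "\<exists>D > 0. \<forall>i\<in>A. \<exists>k. of_int D * f i = of_int k"
  using assms
proof (induction A)
  case empty
  show ?case by (intro exI[of _ 1]) simp
next
  case (insert i A)
  then obtain D where D: "D > 0" "\<And>j. j \<in> A \<Longrightarrow> \<exists>k. of_int D * f j = of_int k" by blast
  obtain a b where ab: "quotient_of (f i) = (a, b)" by (cases "quotient_of (f i)")
  then have b: "b > 0" "f i = of_int a / of_int b"
    using quotient_of_denom_pos quotient_of_div by auto
  show ?case
  proof (rule exI[of _ "D * b"], intro conjI ballI)
    show "D * b > 0" using D(1) b(1) by (rule mult_pos_pos)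
    fix j assume j: "j \<in> insert i A"
    show "\<exists>k. of_int (D * b) * f j = of_int k"
    proof (cases "j = i")
      case True
      then show ?thesis using b by (intro exI[of _ "D * a"]) simp
    next
      case False
      with j D(2) obtain k where "of_int D * f j = of_int k" by blast
      then have "of_int (D * b) * f j = of_int (b * k)" by (simp add: mult.commute mult.left_commute)
      then show ?thesis by blast
    qed
  qed
qed

text \<open>Apply a rational-linear functional to the coefficients of the complex denominator.\<close>

lemma rational_fps_descent:
  fixes F :: "int fps" and p q :: "complex poly"
  assumes q: "q \<noteq> 0" and pq: "fps_of_poly q * Abs_fps (\<lambda>n. of_int (F $ n)) = fps_of_poly p"
  shows "\<exists>p' q'. q' \<noteq> 0 \<and> fps_of_poly q' * F = fps_of_poly p'"
proof -
  \<comment> \<open>The functional is chosen not to kill the leading coefficient, which keeps the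
    new denominator nonzero.\<close>
  have "lead_coeff q \<noteq> 0" using q by simp
  from ex_rational_functional[OF this] obtain \<phi> :: "complex \<Rightarrow> rat" where
    \<phi>: "\<phi> (lead_coeff q) \<noteq> 0" "\<And>x y. \<phi> (x + y) = \<phi> x + \<phi> y" "\<And>k x. \<phi> (of_int k * x) = of_int k * \<phi> x"
    by blast
  have \<phi>0: "\<phi> 0 = 0" using \<phi>(3)[of 0 0] by simp
  have \<phi>sum: "\<phi> (sum g A) = (\<Sum>i\<in>A. \<phi> (g i))" for g :: "nat \<Rightarrow> complex" and A
    by (induction A rule: infinite_finite_induct) (simp_all add: \<phi>0 \<phi>(2))
  obtain D where D: "D > 0" "\<And>i. i \<le> degree q \<Longrightarrow> \<exists>k. of_int D * \<phi> (coeff q i) = of_int k"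
    using common_denominator[of "{..degree q}" "\<lambda>i. \<phi> (coeff q i)"] by auto
  have "\<exists>k. of_int D * \<phi> (coeff q i) = of_int k" for i
  proof (cases "i \<le> degree q")
    case False
    then have "coeff q i = 0" by (simp add: coeff_eq_0)
    then show ?thesis using \<phi>0 by (intro exI[of _ 0]) simp
  qed (rule D)
  then obtain k where k: "\<And>i. of_int D * \<phi> (coeff q i) = of_int (k i)" by metis
  define q' where "q' = (\<Sum>i\<le>degree q. monom (k i) i)"
  have k0: "k i = 0" if "i > degree q" for i
    using k[of i] that \<phi>0 by (simp add: coeff_eq_0)
  have coeff_q': "coeff q' i = k i" for i
    using k0[of i] by (auto simp: q'_def coeff_sum)
  have "k (degree q) \<noteq> 0" using k[of "degree q"] D(1) \<phi>(1) by auto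
  then have "q' \<noteq> 0" using coeff_q'[of "degree q"] by auto
  define G where "G = fps_of_poly q' * F"
  \<comment> \<open>\<phi> passes through the convolution because the coefficients of
    \<open>F\<close> are integers. Hence \<open>G\<close> vanishes beyond the degree of
    \<open>p\<close> and is a polynomial.\<close>
  have G: "of_int (G $ n) = of_int D * \<phi> (coeff p n)" for n
  proof -
    have "coeff p n = (\<Sum>i=0..n. coeff q i * of_int (F $ (n - i)))"
      using arg_cong[OF pq, of "\<lambda>G. fps_nth G n"] by (simp add: fps_mult_nth)
    also have "\<dots> = (\<Sum>i=0..n. of_int (F $ (n - i)) * coeff q i)" by (simp add: mult.commute)
    finally have "\<phi> (coeff p n) = (\<Sum>i=0..n. of_int (F $ (n - i)) * \<phi> (coeff q i))"
      by (simp add: \<phi>sum \<phi>(3))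
    then have "of_int D * \<phi> (coeff p n) = (\<Sum>i=0..n. of_int (F $ (n - i)) * (of_int D * \<phi> (coeff q i)))"
      by (simp add: sum_distrib_left mult.left_commute)
    also have "\<dots> = of_int (G $ n)"
      unfolding k G_def fps_mult_nth by (simp add: coeff_q' mult.commute[of "of_int (fps_nth F _)"])
    finally show ?thesis by simp
  qed
  have "G $ n = 0" if "n > degree p" for n
    using G[of n] that \<phi>0 by (simp add: coeff_eq_0)
  then have "G = fps_of_poly (\<Sum>i\<le>degree p. monom (G $ i) i)"
    by (intro fps_ext) (auto simp: coeff_sum)
  with \<open>q' \<noteq> 0\<close> show ?thesis unfolding G_def by blast
qed

text \<open>\<open>rat_fun_subst\<close> uses the normalized quotient, so the expansion is needed
  for that particular pair and not just for some representation.\<close>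

lemma is_expansion_quot_of_fract:
  assumes "is_expansion R F"
  shows "fps_of_poly (snd (quot_of_fract R)) * F = fps_of_poly (fst (quot_of_fract R))"
proof -
  obtain p q where pq: "quot_of_fract R = (p, q)" by (cases "quot_of_fract R")
  from assms obtain p' q' where q': "q' \<noteq> 0" "R = Fract p' q'" "fps_of_poly q' * F = fps_of_poly p'"
    unfolding is_expansion_def by blast
  have q: "q \<noteq> 0" and "R = Fract p q"
    using snd_quot_of_fract_nonzero[of R] Fract_quot_of_fract[of R] pq by auto
  then have "p * q' = p' * q" using q' by (simp add: eq_fract)
  then have "fps_of_poly q' * (fps_of_poly q * F) = fps_of_poly q' * fps_of_poly p"
    using q'(3) by (metis fps_of_poly_mult mult.assoc mult.commute)
  then have "fps_of_poly q * F = fps_of_poly p"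
    using q'(1) by (simp add: fps_of_poly_eq_iff[of q' 0, simplified])
  then show ?thesis by (simp add: pq)
qed

section \<open>Substitution, and transfer of the functional equation to rational functions\<close>

text \<open>The numerator of \<open>r(a / b)\<close> over the common denominator \<open>b\<^sup>d\<close>.\<close>

definition subst_num :: "int poly \<Rightarrow> nat \<Rightarrow> int poly \<Rightarrow> int poly \<Rightarrow> int poly" where
  "subst_num r d a b = (\<Sum>i\<le>d. [:coeff r i:] * a ^ i * b ^ (d - i))"

lemma poly_map_of_int_sum:
  fixes y :: "'a :: {comm_ring_1, ring_char_0}"
  assumes "degree r \<le> d"
  shows "poly (map_poly of_int r) y = (\<Sum>i\<le>d. of_int (coeff r i) * y ^ i)"
proof -
  have "poly (map_poly of_int r) y = (\<Sum>i\<le>degree r. of_int (coeff r i) * y ^ i)"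
    by (simp add: poly_altdef degree_map_poly coeff_map_poly)
  also have "\<dots> = (\<Sum>i\<le>d. of_int (coeff r i) * y ^ i)"
    using assms by (intro sum.mono_neutral_left) (auto simp: coeff_eq_0)
  finally show ?thesis .
qed

text \<open>The homomorphism \<open>h\<close> is kept general for two uses: evaluation at a complex
  number and the embedding \<open>to_fract\<close>.\<close>

lemma subst_num_hom:
  fixes h :: "int poly \<Rightarrow> 'a :: field_char_0"
  assumes add: "\<And>x y. h (x + y) = h x + h y" and mult: "\<And>x y. h (x * y) = h x * h y"
    and const: "\<And>c. h [:c:] = of_int c" and b: "h b \<noteq> 0" and d: "degree r \<le> d"
  shows "h (subst_num r d a b) = poly (map_poly of_int r) (h a / h b) * h b ^ d"
proof -
  have h0: "h 0 = 0" using const[of 0] by simp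
  have h1: "h 1 = 1" using const[of 1] by (simp add: one_pCons)
  have hsum: "h (sum g A) = (\<Sum>i\<in>A. h (g i))" for g :: "nat \<Rightarrow> int poly" and A
    by (induction A rule: infinite_finite_induct) (simp_all add: h0 add)
  have hpow: "h (x ^ n) = h x ^ n" for x n
    by (induction n) (simp_all add: h1 mult)
  have "h (subst_num r d a b) = (\<Sum>i\<le>d. of_int (coeff r i) * h a ^ i * h b ^ (d - i))"
    by (simp only: subst_num_def hsum hpow mult const)
  also have "\<dots> = (\<Sum>i\<le>d. of_int (coeff r i) * (h a / h b) ^ i * h b ^ d)"
    using b by (intro sum.cong refl) (simp add: power_divide power_diff)
  finally show ?thesis
    unfolding poly_map_of_int_sum[OF d] sum_distrib_right .
qed

lemma to_fract_of_int: "to_fract (of_int c :: int poly) = of_int c"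
  by (induction c rule: int_induct[of _ 0]) (simp_all)

lemma mult_common_factors: "(y * X) * (z * X) = (y * z) * (X * X)" for y z X :: "'a :: comm_semiring_1"
  by (simp add: mult_ac)

text \<open>Cleared of denominators, the claim is an identity of integer polynomials. It holds at
  all but finitely many complex points, where p / q agrees with P / Q, hence identically, and so it
  can be read in the fraction field.\<close>

lemma functional_equation_transfer:
  fixes R :: rat_fun and l :: int and P Q :: "complex poly" and F :: "int fps"
  assumes l: "l \<noteq> 0" and R: "is_expansion R F" and Q: "Q \<noteq> 0"
    and PQ: "fps_of_poly Q * Abs_fps (\<lambda>n. of_int (F $ n)) = fps_of_poly P"
    and sym: "\<And>x. x \<noteq> 0 \<Longrightarrow> poly P (x / of_int l) * poly Q (1 / (of_int l * x)) =
      poly P (1 / (of_int l * x)) * poly Q (x / of_int l)"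
  shows "rat_fun_subst R (var / of_int l) = rat_fun_subst R (1 / (of_int l * var))"
proof -
  obtain p q where pq: "quot_of_fract R = (p, q)" by (cases "quot_of_fract R")
  have q0: "q \<noteq> 0" using snd_quot_of_fract_nonzero[of R] pq by simp
  have qF: "fps_of_poly q * F = fps_of_poly p" using is_expansion_quot_of_fract[OF R] pq by simp
  define cp cq :: "complex poly" where "cp = map_poly of_int p" and "cq = map_poly of_int q"
  have cqF: "fps_of_poly cq * Abs_fps (\<lambda>n. of_int (F $ n)) = fps_of_poly cp"
  proof (rule fps_ext)
    fix n
    have "coeff p n = (\<Sum>i=0..n. coeff q i * fps_nth F (n - i))"
      using arg_cong[OF qF, of "\<lambda>G. fps_nth G n"] by (simp add: fps_mult_nth)
    then show "fps_nth (fps_of_poly cq * Abs_fps (\<lambda>n. of_int (F $ n))) n = fps_nth (fps_of_poly cp) n"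
      by (simp add: fps_mult_nth cp_def cq_def coeff_map_poly)
  qed
  have "fps_of_poly (P * cq) = fps_of_poly (cp * Q)"
    unfolding fps_of_poly_mult PQ[symmetric] cqF[symmetric] by (simp only: mult_ac)
  then have cross: "poly P x * poly cq x = poly cp x * poly Q x" for x
    by (metis fps_of_poly_eq_iff poly_mult)
  have cq0: "cq \<noteq> 0" using q0 unfolding cq_def by (simp add: map_poly_eq_0_iff)
  define d where "d = max (degree p) (degree q)"
  \<comment> \<open>Both arguments receive the denominator l x: x / l = x^2 / (l x) with numerator
    \<open>a1\<close>, and 1 / (l x) with numerator \<open>a2\<close>.\<close>
  define b :: "int poly" where "b = [:0, l:]"
  define a1 a2 :: "int poly" where "a1 = [:0, 0, 1:]" and "a2 = 1"
  have dpq: "degree p \<le> d" "degree q \<le> d" by (simp_all add: d_def)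
  define ev :: "complex \<Rightarrow> int poly \<Rightarrow> complex" where "ev x r = poly (map_poly of_int r) x" for x r
  have ev_hom: "ev x (r + r') = ev x r + ev x r'" "ev x (r * r') = ev x r * ev x r'"
    "ev x [:c:] = of_int c" for x r r' c
  proof -
    have "map_poly of_int (r + r') = (map_poly of_int r + map_poly of_int r' :: complex poly)"
      by (rule poly_eqI) (simp add: coeff_map_poly)
    then show "ev x (r + r') = ev x r + ev x r'" by (simp add: ev_def)
    have "map_poly of_int (r * r') = (map_poly of_int r * map_poly of_int r' :: complex poly)"
      by (rule poly_eqI) (simp add: coeff_map_poly coeff_mult)
    then show "ev x (r * r') = ev x r * ev x r'" by (simp add: ev_def)
    show "ev x [:c:] = of_int c" by (simp add: ev_def map_poly_pCons)
  qed
  have ev_b: "ev x b = of_int l * x" for x by (simp add: ev_def b_def map_poly_pCons mult.commute)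
  have ev_a: "ev x a1 = x ^ 2" "ev x a2 = 1" for x
    by (simp_all add: ev_def a1_def a2_def map_poly_pCons power2_eq_square)
  have ev1: "ev x (subst_num r d a1 b) = poly (map_poly of_int r) (x / of_int l) * (of_int l * x) ^ d"
    and ev2: "ev x (subst_num r d a2 b) = poly (map_poly of_int r) (1 / (of_int l * x)) * (of_int l * x) ^ d"
    if "x \<noteq> 0" "degree r \<le> d" for x r
    using subst_num_hom[of "ev x" b r d a1, OF ev_hom _ that(2)] subst_num_hom[of "ev x" b r d a2, OF ev_hom _ that(2)]
      that(1) l by (simp_all add: ev_b ev_a power2_eq_square)
  \<comment> \<open>Contains 0 and all points at which x / l or 1 / (l x) is a zero of
    \<open>Q\<close> or \<open>cq\<close>.\<close>
  define bad where "bad = {0} \<union> (\<lambda>x. of_int l * x) ` {x. poly (Q * cq) x = 0} \<union>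
    (\<lambda>x. 1 / (of_int l * x)) ` {x. poly (Q * cq) x = 0}"
  have "finite bad" unfolding bad_def using Q cq0 by (intro finite_UnI finite_imageI poly_roots_finite) auto
  then have inf: "infinite (- bad)" using infinite_UNIV_char_0[where ?'a = complex] by (simp add: Compl_eq_Diff_UNIV)
  have good: "x \<noteq> 0" "poly Q (x / of_int l) \<noteq> 0" "poly Q (1 / (of_int l * x)) \<noteq> 0"
    "poly cq (x / of_int l) \<noteq> 0" "poly cq (1 / (of_int l * x)) \<noteq> 0" if "x \<in> - bad" for x
  proof -
    have "poly (Q * cq) (x / of_int l) \<noteq> 0"
    proof
      assume "poly (Q * cq) (x / of_int l) = 0"
      then have "of_int l * (x / of_int l) \<in> bad" unfolding bad_def by blast
      with that l show False by simp
    qed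
    moreover have "poly (Q * cq) (1 / (of_int l * x)) \<noteq> 0"
    proof
      assume "poly (Q * cq) (1 / (of_int l * x)) = 0"
      then have "1 / (of_int l * (1 / (of_int l * x))) \<in> bad" unfolding bad_def by blast
      with that l show False by simp
    qed
    ultimately show "x \<noteq> 0" "poly Q (x / of_int l) \<noteq> 0" "poly Q (1 / (of_int l * x)) \<noteq> 0"
      "poly cq (x / of_int l) \<noteq> 0" "poly cq (1 / (of_int l * x)) \<noteq> 0"
      using that by (auto simp: bad_def)
  qed
  have zeroI: "r = 0" if "\<And>x. x \<in> - bad \<Longrightarrow> ev x r = 0" for r
  proof -
    have "- bad \<subseteq> {x. poly (map_poly of_int r :: complex poly) x = 0}" using that by (auto simp: ev_def)
    then have "infinite {x. poly (map_poly of_int r :: complex poly) x = 0}" using inf infinite_super by blast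
    then have "(map_poly of_int r :: complex poly) = 0" using poly_roots_finite by blast
    then show ?thesis by (simp add: map_poly_eq_0_iff)
  qed
  \<comment> \<open>One point outside \<open>bad\<close> suffices to show that the substituted
    denominators are nonzero polynomials.\<close>
  obtain x0 where x0: "x0 \<in> - bad" using inf by (metis finite.emptyI ex_in_conv)
  have nz: "subst_num q d a1 b \<noteq> 0" "subst_num q d a2 b \<noteq> 0"
  proof -
    have "ev x0 (subst_num q d a1 b) \<noteq> 0" "ev x0 (subst_num q d a2 b) \<noteq> 0"
      unfolding ev1[OF good(1)[OF x0] dpq(2)] ev2[OF good(1)[OF x0] dpq(2)] cq_def[symmetric]
      using good[OF x0] l by simp_all
    moreover have "ev x0 0 = 0" by (simp add: ev_def)
    ultimately show "subst_num q d a1 b \<noteq> 0" "subst_num q d a2 b \<noteq> 0" by auto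
  qed
  have "subst_num p d a1 b * subst_num q d a2 b - subst_num p d a2 b * subst_num q d a1 b = 0"
  proof (rule zeroI)
    fix x assume x: "x \<in> - bad"
    note g = good[OF x]
    let ?u = "x / of_int l" and ?v = "1 / (of_int l * x)"
    have "(poly cp ?u * poly cq ?v) * (poly Q ?u * poly Q ?v) =
        (poly cp ?u * poly Q ?u) * poly cq ?v * poly Q ?v" by (simp only: mult_ac)
    also have "\<dots> = (poly P ?u * poly Q ?v) * poly cq ?u * poly cq ?v"
      unfolding cross[symmetric] by (simp only: mult_ac)
    also have "\<dots> = (poly P ?v * poly cq ?v) * poly cq ?u * poly Q ?u"
      unfolding sym[OF g(1)] by (simp only: mult_ac)
    also have "\<dots> = (poly cp ?v * poly cq ?u) * (poly Q ?u * poly Q ?v)"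
      unfolding cross by (simp only: mult_ac)
    finally have "poly cp ?u * poly cq ?v = poly cp ?v * poly cq ?u" using g by simp
    then have "ev x (subst_num p d a1 b * subst_num q d a2 b) = ev x (subst_num p d a2 b * subst_num q d a1 b)"
      unfolding ev_hom ev1[OF g(1) dpq(1)] ev1[OF g(1) dpq(2)] ev2[OF g(1) dpq(1)] ev2[OF g(1) dpq(2)]
        cp_def[symmetric] cq_def[symmetric] by (subst (1 2) mult_common_factors) (rule arg_cong)
    then show "ev x (subst_num p d a1 b * subst_num q d a2 b - subst_num p d a2 b * subst_num q d a1 b) = 0"
      using ev_hom(1)[of x "subst_num p d a1 b * subst_num q d a2 b - subst_num p d a2 b * subst_num q d a1 b"
        "subst_num p d a2 b * subst_num q d a1 b"] by simp
  qed
  then have eq: "to_fract (subst_num p d a1 b) * to_fract (subst_num q d a2 b) =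
      to_fract (subst_num p d a2 b) * to_fract (subst_num q d a1 b)"
    by (simp flip: to_fract_mult)
  have tf_const: "to_fract [:c:] = of_int c" for c :: int
    using to_fract_of_int[of c] by (simp add: of_int_poly)
  have lvar: "to_fract b = of_int l * var"
  proof -
    have "b = [:l:] * [:0, 1:]" by (simp add: b_def)
    then show ?thesis by (simp only: to_fract_mult tf_const) (simp add: var_def to_fract_def)
  qed
  have b0: "to_fract b \<noteq> 0" using l by (simp add: b_def)
  have var0: "var \<noteq> 0" using b0 lvar by auto
  have g1: "to_fract a1 / to_fract b = var / of_int l"
  proof -
    have "a1 = [:0, 1:] * [:0, 1:]" by (simp add: a1_def)
    then have "to_fract a1 = var * var" by (simp only: to_fract_mult) (simp add: var_def to_fract_def)
    then show ?thesis using lvar var0 by simp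
  qed
  have g2: "to_fract a2 / to_fract b = 1 / (of_int l * var)" by (simp add: a2_def lvar)
  note hom = subst_num_hom[of to_fract b, OF to_fract_add to_fract_mult tf_const b0]
  let ?X = "\<lambda>r g. poly (map_poly of_int r) g :: rat_fun"
  have h1: "to_fract (subst_num r d a1 b) = ?X r (var / of_int l) * to_fract b ^ d"
    and h2: "to_fract (subst_num r d a2 b) = ?X r (1 / (of_int l * var)) * to_fract b ^ d"
    if "degree r \<le> d" for r
    using hom[OF that, of a1] hom[OF that, of a2] unfolding g1 g2 by simp_all
  have "?X q (var / of_int l) \<noteq> 0" "?X q (1 / (of_int l * var)) \<noteq> 0"
    using nz h1[OF dpq(2)] h2[OF dpq(2)] by (metis mult_zero_left to_fract_eq_0_iff)+
  moreover have "(?X p (var / of_int l) * ?X q (1 / (of_int l * var))) * (to_fract b ^ d * to_fract b ^ d) =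
      (?X p (1 / (of_int l * var)) * ?X q (var / of_int l)) * (to_fract b ^ d * to_fract b ^ d)"
  proof -
    show ?thesis
      using eq unfolding h1[OF dpq(1)] h1[OF dpq(2)] h2[OF dpq(1)] h2[OF dpq(2)]
      by (subst (1 2) mult_common_factors[symmetric])
  qed
  then have "?X p (var / of_int l) * ?X q (1 / (of_int l * var)) =
      ?X p (1 / (of_int l * var)) * ?X q (var / of_int l)"
    using b0 by (simp only: mult_cancel_right) simp
  ultimately show ?thesis
    unfolding rat_fun_subst_def pq by (simp add: frac_eq_eq)
qed

theorem theorem6p1:
  fixes r t s :: nat and \<alpha> \<beta> \<gamma> :: "nat \<Rightarrow> nat" and k :: int and j :: nat
  assumes "1 \<le> s"
    and "strict_mono_on {1..r} \<alpha>" and "\<forall>i\<in>{1..r}. 1 \<le> \<alpha> i"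
    and "strict_mono_on {1..t} \<beta>" and "\<forall>i\<in>{1..t}. 1 \<le> \<beta> i"
    and "strict_mono_on {1..s} \<gamma>"
    and "\<forall>i\<in>{1,2,3,4}. P_poly r t s \<alpha> \<beta> \<gamma> i \<noteq> 0 \<and> laurent_degree (P_poly r t s \<alpha> \<beta> \<gamma> i) = k"
    and "j \<in> {1,2,3,4}"
    and "\<forall>n\<ge>1. gcd_condition r t s \<alpha> \<beta> \<gamma> (group_order j n)"
  shows "\<exists>F :: rat_fun. is_expansion F (tree_gf r t s \<alpha> \<beta> \<gamma> j) \<and>
    rat_fun_subst F (var / of_int (ell r t s \<alpha> \<beta> \<gamma> j)) =
    rat_fun_subst F (1 / (of_int (ell r t s \<alpha> \<beta> \<gamma> j) * var))"
proof -
  define l where "l = ell r t s \<alpha> \<beta> \<gamma> j"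
  define F where "F = tree_gf r t s \<alpha> \<beta> \<gamma> j"
  have P: "P_poly r t s \<alpha> \<beta> \<gamma> i \<noteq> 0" if "i \<in> {1, 2, 3, 4}" for i
    using assms(7) that by blast
  have l0: "l \<noteq> 0" unfolding l_def by (rule tree_count_formula(2)[OF assms(1,3,5) P assms(8)])
  obtain f where f: "sym_exp_sum f"
    "\<And>n. n > 0 \<Longrightarrow> of_nat (\<tau> (bicirculant r t s \<alpha> \<beta> \<gamma> j (group_order j n))) = of_nat n * of_int l ^ n * f n"
    using tree_count_formula(1)[OF assms(1,3,5) P assms(8)] unfolding l_def by blast
  obtain p q where q: "q \<noteq> 0" and pq: "fps_of_poly q * Abs_fps (\<lambda>n. of_nat n * f n) = fps_of_poly p"
    and sym: "\<And>x. x \<noteq> 0 \<Longrightarrow> poly p x * poly q (inverse x) = poly p (inverse x) * poly q x"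
    using sym_exp_sum_generating_function[OF f(1)] by blast
  let ?l = "[:0, of_int l:] :: complex poly"
  \<comment> \<open>At n = 0 both sides vanish: \<open>tree_gf\<close> omits that term, and the
    factor n removes it on the right.\<close>
  have F: "of_int (fps_nth F n) = of_int l ^ n * (of_nat n * f n)" for n
    using f(2)[of n] by (cases "n = 0") (simp_all add: F_def tree_gf_def)
  \<comment> \<open>Scaling the n-th coefficient by l^n amounts to replacing X by l X in numerator
    and denominator.\<close>
  have PQ: "fps_of_poly (pcompose q ?l) * Abs_fps (\<lambda>n. of_int (fps_nth F n)) = fps_of_poly (pcompose p ?l)"
  proof (rule fps_ext)
    fix n
    have "coeff p n = (\<Sum>i=0..n. coeff q i * (of_nat (n - i) * f (n - i)))"
      using arg_cong[OF pq, of "\<lambda>G. fps_nth G n"] by (simp add: fps_mult_nth)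
    then have "of_int l ^ n * coeff p n = (\<Sum>i=0..n. of_int l ^ n * (coeff q i * (of_nat (n - i) * f (n - i))))"
      by (simp only: sum_distrib_left)
    also have "\<dots> = (\<Sum>i=0..n. (of_int l ^ i * coeff q i) * (of_int l ^ (n - i) * (of_nat (n - i) * f (n - i))))"
    proof (rule sum.cong)
      fix i assume "i \<in> {0..n}"
      then have "of_int l ^ n = (of_int l ^ i * of_int l ^ (n - i) :: complex)" by (simp flip: power_add)
      then show "of_int l ^ n * (coeff q i * (of_nat (n - i) * f (n - i))) =
        (of_int l ^ i * coeff q i) * (of_int l ^ (n - i) * (of_nat (n - i) * f (n - i)))" by simp
    qed simp
    finally show "fps_nth (fps_of_poly (pcompose q ?l) * Abs_fps (\<lambda>n. of_int (fps_nth F n))) n =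
      fps_nth (fps_of_poly (pcompose p ?l)) n"
      by (simp add: fps_mult_nth coeff_pcompose_linear F)
  qed
  have Q0: "pcompose q ?l \<noteq> 0" using q l0 by (simp add: pcompose_eq_0_iff)
  from rational_fps_descent[OF Q0 PQ] obtain p' q' where
    "q' \<noteq> 0" "fps_of_poly q' * F = fps_of_poly p'" by blast
  then have R: "is_expansion (Fract p' q') F" unfolding is_expansion_def by blast
  moreover have "rat_fun_subst (Fract p' q') (var / of_int l) = rat_fun_subst (Fract p' q') (1 / (of_int l * var))"
  proof (rule functional_equation_transfer[OF l0 R Q0 PQ])
    fix x :: complex assume x: "x \<noteq> 0"
    \<comment> \<open>The replacement of X by l X turns the arguments x / l and 1 / (l x) into x and
      1 / x, for which \<open>sym\<close> was proved.\<close>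
    have "poly ?l (x / of_int l) = x" "poly ?l (1 / (of_int l * x)) = inverse x"
      using l0 by (simp_all add: field_simps)
    with sym[OF x] show "poly (pcompose p ?l) (x / of_int l) * poly (pcompose q ?l) (1 / (of_int l * x)) =
      poly (pcompose p ?l) (1 / (of_int l * x)) * poly (pcompose q ?l) (x / of_int l)"
      by (simp only: poly_pcompose)
  qed
  ultimately show ?thesis unfolding F_def l_def by blast
qed

end
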